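(* In the tabular episodic setting described in the context, suppose: (i) (uniform $Q$-gap) there is $\Delta>0$ such that for all $\theta\in\Theta$, all $h\in\{0,\dots,H-1\}$ and all $s\in\mathcal S$ there is $a^*\in\mathcal A$ with $Q_h(s,a^*;\theta)\ge Q_h(s,a';\theta)+\Delta$ for all $a'\in\mathcal A\setminus\{a^*\}$; and (ii) with $p_h(s;\theta):=\Pr_{\theta,\pi^*(\theta)}(s_h=s)$, the quantity $\underline p:=\inf\{p_h(s;\theta): 0\le h<H,\ s\in\mathcal S,\ \theta\in\Theta,\ p_h(s;\theta)>0\}$ satisfies $\underline p>0$. Then for all sufficiently large $\beta$, with the threshold not depending on $L$, the Bayesian regret of iPSRL satisfies $$\mathfrak{BR}_T(\phi^{\mathrm{iPSRL}})=O\!\left(\sqrt{\varepsilon_L H^4S^2AT}\,(1+\log T)\right),\qquad \varepsilon_L=\min\left\{1,\ 2SH\left[\exp\left(-\frac{L\underline p^2}{18}\right)+\exp\left(-\frac{L\underline p}{36}\right)\right]\right\}.$$ That is, there is an absolute constant $C$ and, for each problem instance, a threshold $\beta_0$ not depending on $L$, such that for all $\beta\ge\beta_0$ and all integers $L,T\ge1$, $\mathfrak{BR}_T(\phi^{\mathrm{iPSRL}})\le C\sqrt{\varepsilon_L H^4S^2AT}\,(1+\log T)$.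
   Context: Setting. A finite-horizon MDP has finite state space $\mathcal S$ ($|\mathcal S|=S$), finite action space $\mathcal A$ ($|\mathcal A|=A$), horizon $H\ge 1$, initial state distribution $\nu$, known deterministic rewards $r_h(s,a)\in[0,1]$ for $h=0,\dots,H-1$ and terminal reward $r_H(s)\in[0,1]$ (also written $r_H(s,a)$, although no action is taken at period $H$), and transition kernels $P_h(s'|s,a)$, $0\le h\le H-1$. The kernel is unknown to the agent: $\theta=(P_h^\theta)_h$ ranges over a set $\Theta$ of transition kernels, and the true parameter $\theta^*$ is random with prior $\mu_0$ on $\Theta$, independent across (state, period, action) triples. $\Pr_{\theta,\pi}$ is the law of a trajectory under kernel $\theta$ and policy $\pi$. The optimal values under $\theta$ are given by $V_H(s;\theta)=r_H(s)$, $Q_h(s,a;\theta)=r_h(s,a)+\sum_{s'}P_h^\theta(s'|s,a)V_{h+1}(s';\theta)$, $V_h(s;\theta)=\max_a Q_h(s,a;\theta)$; write $V_0^*(s;\theta)=V_0(s;\theta)$. Canonical optimal policy. Fix an order on $\mathcal A$ and an action $\bar a_0\in\mathcal A$. The deterministic Markov policy $\pi^*(\theta)=(\pi_h^*(\cdot;\theta))_{h=0}^{H-1}$ is defined sequentially in $h$: $\pi_h^*(s;\theta)=\arg\max_a Q_h(s,a;\theta)$ (ties broken by the fixed order) if $\Pr_{\theta,\pi^*_{0:h-1}(\theta)}(s_h=s)>0$, and $\pi_h^*(s;\theta)=\bar a_0$ otherwise. It is an optimal policy for $\theta$. Offline data. Given $\theta^*$, the expert generates an offline dataset $\mathcal D_0$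 of $L$ independent trajectories $(\bar s_0^l,\bar a_0^l,\dots,\bar s_H^l)$, $l=1,\dots,L$, in the MDP $\theta^*$ (with $\bar s_0^l\sim\nu$) using the policy $\pi_h^\beta(a|s)=\exp(\beta Q_h(s,a;\theta^* ))/\sum_b\exp(\beta Q_h(s,b;\theta^* ))$, where $\beta\ge0$ is a known constant. iPSRL. For episodes $t=1,\dots,T$: let $\mu_t$ be the exact posterior of $\theta^*$ given $\mathcal D_0$ and the online history $\mathcal H_{t-1}$ of the first $t-1$ online episodes; sample $\tilde\theta_t\sim\mu_t$ (conditionally independent of $\theta^*$ given $\mathcal D_0,\mathcal H_{t-1}$); set $\tilde\pi^t=\pi^*(\tilde\theta_t)$; draw $s_0^t\sim\nu$ and run $\tilde\pi^t$ for the episode in the MDP $\theta^*$, observing $(s_h^t,a_h^t)$. Bayesian regret. $\mathfrak{BR}_T(\phi^{\mathrm{iPSRL}})=\mathbb E\big[\sum_{t=1}^T\big(V_0^*(s_0^t;\theta^* )-\sum_{h=0}^{H}r_h(s_h^t,a_h^t)\big)\big]$, the expectation being over $\theta^*$, $\mathcal D_0$, and the algorithm–environment interaction. $O(\cdot)$ hides an absolute constant. *)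

theory Defs
  imports "HOL-Probability.Probability"
begin

text \<open>
  States are numbered \<open>0, \<dots>, S - 1\<close> and actions \<open>0, \<dots>, A - 1\<close>; the actions are numbered
  along the fixed tie-breaking order.  Index ranges are natural numbers rather than finite
  types so that an absolute constant can be quantified before \<open>S\<close> and \<open>A\<close>.
\<close>

record mdp =
  nS :: nat
  nA :: nat
  hor :: nat
  init :: "nat pmf"
  rew :: "nat \<Rightarrow> nat \<Rightarrow> nat \<Rightarrow> real"  \<comment> \<open>period, state, action\<close>
  trew :: "nat \<Rightarrow> real"
  act0 :: nat

definition valid_mdp :: "mdp \<Rightarrow> bool" where
  "valid_mdp m \<longleftrightarrow>
     1 \<le> hor m \<and> set_pmf (init m) \<subseteq> {..<nS m} \<and> act0 m < nA m \<and>
     (\<forall>h<hor m. \<forall>s<nS m. \<forall>a<nA m. rew m h s a \<in> {0..1}) \<and>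
     (\<forall>s<nS m. trew m s \<in> {0..1})"

text \<open>\<open>\<theta> h s a\<close> is the law of the next state.  Only its values for \<open>h < H\<close>, \<open>s < S\<close>,
  \<open>a < A\<close> matter.\<close>

type_synonym kernel = "nat \<Rightarrow> nat \<Rightarrow> nat \<Rightarrow> nat pmf"

type_synonym policy = "nat \<Rightarrow> nat \<Rightarrow> nat pmf"

definition kernels :: "mdp \<Rightarrow> kernel set" where
  "kernels m = {\<theta>. \<forall>h<hor m. \<forall>s<nS m. \<forall>a<nA m. set_pmf (\<theta> h s a) \<subseteq> {..<nS m}}"

text \<open>The trajectory \<open>(s\<^sub>0, a\<^sub>0, \<dots>, s\<^sub>H\<^sub>-\<^sub>1, a\<^sub>H\<^sub>-\<^sub>1, s\<^sub>H)\<close> is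
  \<open>([(s\<^sub>0, a\<^sub>0), \<dots>, (s\<^sub>H\<^sub>-\<^sub>1, a\<^sub>H\<^sub>-\<^sub>1)], s\<^sub>H)\<close>.\<close>

type_synonym traj = "(nat \<times> nat) list \<times> nat"

definition state_at :: "nat \<Rightarrow> traj \<Rightarrow> nat" where
  "state_at h \<tau> = (if h < length (fst \<tau>) then fst (fst \<tau> ! h) else snd \<tau>)"

definition action_at :: "nat \<Rightarrow> traj \<Rightarrow> nat" where
  "action_at h \<tau> = snd (fst \<tau> ! h)"

text \<open>\<open>rollout \<theta> \<pi> k h s\<close> runs \<open>k\<close> periods, starting in state \<open>s\<close> at period \<open>h\<close>.\<close>

primrec rollout :: "kernel \<Rightarrow> policy \<Rightarrow> nat \<Rightarrow> nat \<Rightarrow> nat \<Rightarrow> traj pmf" where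
  "rollout \<theta> \<pi> 0 h s = return_pmf ([], s)"
| "rollout \<theta> \<pi> (Suc k) h s =
     do {
       a \<leftarrow> \<pi> h s;
       s' \<leftarrow> \<theta> h s a;
       \<tau> \<leftarrow> rollout \<theta> \<pi> k (Suc h) s';
       return_pmf ((s, a) # fst \<tau>, snd \<tau>)
     }"

definition traj_law :: "mdp \<Rightarrow> kernel \<Rightarrow> policy \<Rightarrow> traj pmf" where
  "traj_law m \<theta> \<pi> = bind_pmf (init m) (rollout \<theta> \<pi> (hor m) 0)"

definition state_prob :: "mdp \<Rightarrow> kernel \<Rightarrow> policy \<Rightarrow> nat \<Rightarrow> nat \<Rightarrow> real" where
  "state_prob m \<theta> \<pi> h s = measure_pmf.prob (traj_law m \<theta> \<pi>) {\<tau>. state_at h \<tau> = s}"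

function V :: "mdp \<Rightarrow> kernel \<Rightarrow> nat \<Rightarrow> nat \<Rightarrow> real" where
  "V m \<theta> h s =
     (if h < hor m
      then Max ((\<lambda>a. rew m h s a + (\<Sum>s'<nS m. pmf (\<theta> h s a) s' * V m \<theta> (Suc h) s')) ` {..<nA m})
      else trew m s)"
  by auto
termination
  by (relation "Wellfounded.measure (\<lambda>(m, \<theta>, h, s). hor m - h)") auto

declare V.simps [simp del]

definition Q :: "mdp \<Rightarrow> kernel \<Rightarrow> nat \<Rightarrow> nat \<Rightarrow> nat \<Rightarrow> real" where
  "Q m \<theta> h s a = rew m h s a + (\<Sum>s'<nS m. pmf (\<theta> h s a) s' * V m \<theta> (Suc h) s')"

definition greedy :: "mdp \<Rightarrow> kernel \<Rightarrow> nat \<Rightarrow> nat \<Rightarrow> nat" where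
  "greedy m \<theta> h s = (LEAST a. a < nA m \<and> (\<forall>b<nA m. Q m \<theta> h s b \<le> Q m \<theta> h s a))"

definition det :: "(nat \<Rightarrow> nat \<Rightarrow> nat) \<Rightarrow> policy" where
  "det f h s = return_pmf (f h s)"

text \<open>\<open>opt_prefix m \<theta> h\<close> is the canonical policy in the periods before \<open>h\<close>.  From period
  \<open>h\<close> on it is a placeholder, which does not influence the law of \<open>s\<^sub>h\<close>.\<close>

primrec opt_prefix :: "mdp \<Rightarrow> kernel \<Rightarrow> nat \<Rightarrow> nat \<Rightarrow> nat \<Rightarrow> nat" where
  "opt_prefix m \<theta> 0 = (\<lambda>_ _. act0 m)"
| "opt_prefix m \<theta> (Suc h) = (opt_prefix m \<theta> h)
     (h := \<lambda>s. if state_prob m \<theta> (det (opt_prefix m \<theta> h)) h s > 0 then greedy m \<theta> h s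
               else act0 m)"

definition opt_policy :: "mdp \<Rightarrow> kernel \<Rightarrow> policy" where
  "opt_policy m \<theta> = det (opt_prefix m \<theta> (hor m))"

definition p_opt :: "mdp \<Rightarrow> nat \<Rightarrow> nat \<Rightarrow> kernel \<Rightarrow> real" where
  "p_opt m h s \<theta> = state_prob m \<theta> (opt_policy m \<theta>) h s"

definition p_min :: "mdp \<Rightarrow> kernel set \<Rightarrow> real" where
  "p_min m \<Theta> =
     Inf {p_opt m h s \<theta> | h s \<theta>. h < hor m \<and> s < nS m \<and> \<theta> \<in> \<Theta> \<and> p_opt m h s \<theta> > 0}"

definition uniform_gap :: "mdp \<Rightarrow> kernel set \<Rightarrow> bool" where
  "uniform_gap m \<Theta> \<longleftrightarrow>
     (\<exists>\<Delta>>0. \<forall>\<theta>\<in>\<Theta>. \<forall>h<hor m. \<forall>s<nS m. \<exists>a<nA m.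
        \<forall>a'<nA m. a' \<noteq> a \<longrightarrow> Q m \<theta> h s a \<ge> Q m \<theta> h s a' + \<Delta>)"

text \<open>The Borel structure on \<open>\<Theta>\<close>, coming from the coordinates \<open>P\<^sub>h(s' | s, a)\<close>.\<close>

definition kernel_space :: "mdp \<Rightarrow> kernel set \<Rightarrow> kernel measure" where
  "kernel_space m \<Theta> =
     (let I = {..<hor m} \<times> {..<nS m} \<times> {..<nA m} \<times> {..<nS m}
      in vimage_algebra \<Theta> (\<lambda>\<theta>. \<lambda>(h, s, a, s')\<in>I. pmf (\<theta> h s a) s') (\<Pi>\<^sub>M i\<in>I. borel))"

definition is_prior :: "mdp \<Rightarrow> kernel set \<Rightarrow> kernel measure \<Rightarrow> bool" where
  "is_prior m \<Theta> \<mu> \<longleftrightarrow>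
     \<Theta> \<subseteq> kernels m \<and> prob_space \<mu> \<and> sets \<mu> = sets (kernel_space m \<Theta>) \<and>
     prob_space.indep_vars \<mu> (\<lambda>_. \<Pi>\<^sub>M s'\<in>{..<nS m}. borel)
       (\<lambda>(s, h, a) \<theta>. \<lambda>s'\<in>{..<nS m}. pmf (\<theta> h s a) s')
       ({..<nS m} \<times> {..<hor m} \<times> {..<nA m})"

definition expert :: "mdp \<Rightarrow> real \<Rightarrow> kernel \<Rightarrow> policy" where
  "expert m \<beta> \<theta> h s = embed_pmf (\<lambda>a.
     if a < nA m then exp (\<beta> * Q m \<theta> h s a) / (\<Sum>b<nA m. exp (\<beta> * Q m \<theta> h s b)) else 0)"

type_synonym data = "traj list \<times> traj list"  \<comment> \<open>offline dataset, online history\<close>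

definition posterior :: "kernel measure \<Rightarrow> (kernel \<times> data) measure \<Rightarrow> data \<Rightarrow> kernel measure" where
  "posterior \<mu> J d = distr (uniform_measure J {x \<in> space J. snd x = d}) \<mu> fst"

text \<open>\<open>ipsrl m \<mu> \<beta> L t\<close> is the joint law of \<open>(\<theta>\<^sup>*, \<D>\<^sub>0, \<H>\<^sub>t)\<close>.  The data take countably many values, so
  the posterior is an elementary conditional law under the joint law of the parameter and
  the data seen so far.\<close>

primrec ipsrl :: "mdp \<Rightarrow> kernel measure \<Rightarrow> real \<Rightarrow> nat \<Rightarrow> nat \<Rightarrow> (kernel \<times> data) measure" where
  "ipsrl m \<mu> \<beta> L 0 =
     do {
       \<theta> \<leftarrow> \<mu>;
       D \<leftarrow> measure_pmf (replicate_pmf L (traj_law m \<theta> (expert m \<beta> \<theta>)));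
       return (\<mu> \<Otimes>\<^sub>M count_space UNIV) (\<theta>, D, [])
     }"
| "ipsrl m \<mu> \<beta> L (Suc t) =
     do {
       (\<theta>, D, hist) \<leftarrow> ipsrl m \<mu> \<beta> L t;
       \<theta>' \<leftarrow> posterior \<mu> (ipsrl m \<mu> \<beta> L t) (D, hist);
       \<tau> \<leftarrow> measure_pmf (traj_law m \<theta> (opt_policy m \<theta>'));
       return (\<mu> \<Otimes>\<^sub>M count_space UNIV) (\<theta>, D, hist @ [\<tau>])
     }"

definition total_reward :: "mdp \<Rightarrow> traj \<Rightarrow> real" where
  "total_reward m \<tau> =
     (\<Sum>h<hor m. rew m h (state_at h \<tau>) (action_at h \<tau>)) + trew m (state_at (hor m) \<tau>)"

definition bayes_regret :: "mdp \<Rightarrow> kernel measure \<Rightarrow> real \<Rightarrow> nat \<Rightarrow> nat \<Rightarrow> real" where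
  "bayes_regret m \<mu> \<beta> L T =
     (\<integral>(\<theta>, D, hist). (\<Sum>\<tau>\<leftarrow>hist. V m \<theta> 0 (state_at 0 \<tau>) - total_reward m \<tau>) \<partial>ipsrl m \<mu> \<beta> L T)"

definition eps :: "mdp \<Rightarrow> kernel set \<Rightarrow> nat \<Rightarrow> real" where
  "eps m \<Theta> L =
     min 1 (2 * real (nS m) * real (hor m) *
       (exp (- real L * (p_min m \<Theta>)\<^sup>2 / 18) + exp (- real L * p_min m \<Theta> / 36)))"

end

(*
  Conditionally on the data, the true and the sampled parameter are exchangeable. Hence the expected
  regret of an episode equals the expectation of the difference of the values of the sampled policy
  under the sampled and the true kernel, on the event that the two canonical optimal policies differ.
  Both parameters' policies coincide with an estimate read off the offline data (the action seen more
  than L p / 2 times) with probability at least 1 - eps_L, provided beta is large, so that event has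
  probability at most 2 eps_L. The value difference is at most H times the L1 distance D of the
  kernels along the trajectory, and D * 1{differ} is split by D <= kappa / 2 + D^2 / (2 kappa). The
  online empirical frequencies lie within sqrt(y / n) of either kernel off an event of probability
  O(1 / T), by an exponential supermartingale, and the sum of 1 / n over the visited triples is
  logarithmic. Optimising kappa, which is proportional to eps_L^(-1/2), gives the bound.
*)

theory Submission
  imports Defs
begin

section \<open>Trajectories and occupation laws\<close>

text \<open>The indicator that the policies differ and the distance D both depend on both
  parameters. Splitting their product with a deterministic \<open>\<kappa>\<close> keeps the
  indicator on the constant part only, where its expectation is of order eps_L, and drops it from
  D^2, whose sum over all episodes is controlled without it; this yields the root of eps_L.
  Concentration cannot be applied directly to the sampled kernel, which depends on the very history
  it would be compared with: it is proved for the true kernel, under which the deviations form a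
  martingale, and transferred by exchangeability. The L1 norm is a maximum of linear functionals
  over 2^S sign patterns; this union forces y to be of order S + log T and gives one of the two
  factors S under the root, the number of triples giving the other. The best tilt depends on the
  random number n of visits, so the union also runs over n = 1, ..., T, and y contains 4 log T so
  that a failure probability 1/T per triple is left.\<close>

lemma expectation_bind_pmf_finite:
  fixes g :: "'b \<Rightarrow> real"
  assumes "finite (set_pmf p)" "\<And>x. x \<in> set_pmf p \<Longrightarrow> finite (set_pmf (f x))"
  shows "measure_pmf.expectation (bind_pmf p f) g
       = measure_pmf.expectation p (\<lambda>x. measure_pmf.expectation (f x) g)"
  using assms
  by (subst pmf_expectation_bind[where A = "set_pmf p"])
     (auto simp: integral_measure_pmf[where A = "set_pmf p"])

lemma pmf_bind_sum:
  assumes "finite A" "set_pmf p \<subseteq> A"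
  shows "pmf (bind_pmf p f) y = (\<Sum>x\<in>A. pmf p x * pmf (f x) y)"
  using assms by (simp add: pmf_bind integral_measure_pmf[where A = A] subset_iff)

text \<open>Forward recursion for the law of the state at period \<open>h\<close>.
  \<open>rollout\<close> unfolds a trajectory from its first period, whereas the canonical policy,
  the telescoping and the comparison with the expert all advance the law of the current
  state.\<close>

primrec occ :: "mdp \<Rightarrow> kernel \<Rightarrow> policy \<Rightarrow> nat \<Rightarrow> nat pmf" where
  "occ m \<theta> \<pi> 0 = init m"
| "occ m \<theta> \<pi> (Suc h) = do {s \<leftarrow> occ m \<theta> \<pi> h; a \<leftarrow> \<pi> h s; \<theta> h s a}"

lemma state_at_0 [simp]: "state_at 0 ((s, a) # xs, e) = s"
  and state_at_Suc [simp]: "state_at (Suc j) (x # xs, e) = state_at j (xs, e)"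
  and action_at_0 [simp]: "action_at 0 ((s, a) # xs, e) = a"
  and action_at_Suc [simp]: "action_at (Suc j) (x # xs, e) = action_at j (xs, e)"
  and state_at_Nil [simp]: "state_at j ([], e) = e"
  by (auto simp: state_at_def action_at_def)

lemma state_at_0_rollout: "map_pmf (state_at 0) (rollout \<theta> \<pi> k h s) = return_pmf s"
  by (cases k) (simp_all add: map_bind_pmf map_pmf_def bind_assoc_pmf bind_return_pmf)

text \<open>Peeling off one period of the rollout turns the start law
  \<open>occ m \<theta> \<pi> h\<close> into \<open>occ m \<theta> \<pi> (Suc h)\<close>. The start
  is an arbitrary period with its occupation law, rather than period 0, so that the induction on
  \<open>j\<close> closes.\<close>

lemma map_triple_rollout:
  assumes "j < k"
  shows "map_pmf (\<lambda>\<tau>. (state_at j \<tau>, action_at j \<tau>, state_at (Suc j) \<tau>))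
           (bind_pmf (occ m \<theta> \<pi> h) (rollout \<theta> \<pi> k h))
       = do {s \<leftarrow> occ m \<theta> \<pi> (h + j); a \<leftarrow> \<pi> (h + j) s; s' \<leftarrow> \<theta> (h + j) s a; return_pmf (s, a, s')}"
  using assms
proof (induction j arbitrary: k h)
  case 0
  then obtain k' where k: "k = Suc k'" by (cases k) auto
  have *: "bind_pmf (rollout \<theta> \<pi> k' (Suc h) s') (\<lambda>\<tau>. return_pmf (s, a, state_at 0 \<tau>)) = return_pmf (s, a, s')"
    for s a s'
    using arg_cong[OF state_at_0_rollout[of \<theta> \<pi> k' "Suc h" s'], of "map_pmf (\<lambda>x. (s, a, x))"]
    by (simp add: pmf.map_comp o_def map_pmf_def[symmetric])
  show ?case
    by (simp add: k map_bind_pmf bind_assoc_pmf bind_return_pmf map_pmf_def *)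
next
  case (Suc j)
  then obtain k' where k: "k = Suc k'" "j < k'" by (cases k) auto
  have "map_pmf (\<lambda>\<tau>. (state_at (Suc j) \<tau>, action_at (Suc j) \<tau>, state_at (Suc (Suc j)) \<tau>))
           (bind_pmf (occ m \<theta> \<pi> h) (rollout \<theta> \<pi> k h)) =
        map_pmf (\<lambda>\<tau>. (state_at j \<tau>, action_at j \<tau>, state_at (Suc j) \<tau>))
           (bind_pmf (occ m \<theta> \<pi> (Suc h)) (rollout \<theta> \<pi> k' (Suc h)))"
    by (simp add: k map_bind_pmf bind_assoc_pmf bind_return_pmf map_pmf_def)
  also have "\<dots> = do {s \<leftarrow> occ m \<theta> \<pi> (h + Suc j); a \<leftarrow> \<pi> (h + Suc j) s;
                    s' \<leftarrow> \<theta> (h + Suc j) s a; return_pmf (s, a, s')}"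
    using Suc.IH[OF k(2), of "Suc h"] by simp
  finally show ?case .
qed

lemma map_triple_traj_law:
  assumes "j < hor m"
  shows "map_pmf (\<lambda>\<tau>. (state_at j \<tau>, action_at j \<tau>, state_at (Suc j) \<tau>)) (traj_law m \<theta> \<pi>)
       = do {s \<leftarrow> occ m \<theta> \<pi> j; a \<leftarrow> \<pi> j s; s' \<leftarrow> \<theta> j s a; return_pmf (s, a, s')}"
  using map_triple_rollout[OF assms, of m \<theta> \<pi> 0] by (simp add: traj_law_def)

lemma map_pair_traj_law:
  assumes "j < hor m"
  shows "map_pmf (\<lambda>\<tau>. (state_at j \<tau>, action_at j \<tau>)) (traj_law m \<theta> \<pi>)
       = do {s \<leftarrow> occ m \<theta> \<pi> j; a \<leftarrow> \<pi> j s; return_pmf (s, a)}"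
  using arg_cong[OF map_triple_traj_law[OF assms, of \<theta> \<pi>], of "map_pmf (\<lambda>(s, a, s'). (s, a))"]
  by (simp add: pmf.map_comp o_def map_bind_pmf)

lemma map_state_traj_law:
  assumes "j \<le> hor m" "1 \<le> hor m"
  shows "map_pmf (state_at j) (traj_law m \<theta> \<pi>) = occ m \<theta> \<pi> j"
proof (cases "j < hor m")
  case True
  show ?thesis
    using arg_cong[OF map_triple_traj_law[OF True, of \<theta> \<pi>], of "map_pmf (\<lambda>(s, a, s'). s)"]
    by (simp add: pmf.map_comp o_def map_bind_pmf)
       (simp add: map_pmf_def bind_return_pmf bind_assoc_pmf bind_return_pmf')
next
  case False
  \<comment> \<open>The final state has no action attached and appears only as successor in the
    triple of period H - 1; this is where a horizon of at least one enters.\<close>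
  then obtain i where i: "j = Suc i" "i < hor m" using assms by (cases j) auto
  show ?thesis
    using arg_cong[OF map_triple_traj_law[OF i(2), of \<theta> \<pi>], of "map_pmf (\<lambda>(s, a, s'). s')"] i
    by (simp add: pmf.map_comp o_def map_bind_pmf)
       (simp add: map_pmf_def bind_return_pmf bind_assoc_pmf bind_return_pmf')
qed

lemma state_prob_eq_occ:
  assumes "h \<le> hor m" "1 \<le> hor m"
  shows "state_prob m \<theta> \<pi> h s = pmf (occ m \<theta> \<pi> h) s"
  by (simp add: state_prob_def map_state_traj_law[OF assms, symmetric] pmf_map vimage_def)

lemma occ_cong:
  assumes "\<And>i s. i < h \<Longrightarrow> \<pi> i s = \<pi>' i s"
  shows "occ m \<theta> \<pi> h = occ m \<theta> \<pi>' h"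
  using assms by (induction h) (auto intro!: bind_pmf_cong)

definition policies :: "mdp \<Rightarrow> policy set" where
  "policies m = {\<pi>. \<forall>h<hor m. \<forall>s<nS m. set_pmf (\<pi> h s) \<subseteq> {..<nA m}}"

definition trajs :: "mdp \<Rightarrow> traj set" where
  "trajs m = {xs. set xs \<subseteq> {..<nS m} \<times> {..<nA m} \<and> length xs = hor m} \<times> {..<nS m}"

lemma finite_trajs: "finite (trajs m)"
  unfolding trajs_def by (intro finite_cartesian_product finite_lists_length_eq) auto

lemma set_rollout:
  assumes "\<theta> \<in> kernels m" "\<pi> \<in> policies m" "h + k \<le> hor m" "s < nS m"
  shows "set_pmf (rollout \<theta> \<pi> k h s)
       \<subseteq> {xs. set xs \<subseteq> {..<nS m} \<times> {..<nA m} \<and> length xs = k} \<times> {..<nS m}"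
  using assms(3,4)
proof (induction k arbitrary: h s)
  case (Suc k)
  then have h: "h < hor m" by simp
  have a: "a < nA m" if "a \<in> set_pmf (\<pi> h s)" for a
    using that assms(2) h Suc.prems(2) unfolding policies_def by blast
  have s': "s' < nS m" if "a \<in> set_pmf (\<pi> h s)" "s' \<in> set_pmf (\<theta> h s a)" for a s'
    using that a[OF that(1)] assms(1) h Suc.prems(2) unfolding kernels_def by blast
  have IH: "set_pmf (rollout \<theta> \<pi> k (Suc h) s')
       \<subseteq> {xs. set xs \<subseteq> {..<nS m} \<times> {..<nA m} \<and> length xs = k} \<times> {..<nS m}" if "s' < nS m" for s'
    using Suc.IH[of "Suc h" s'] Suc.prems that by simp
  show ?case
  proof
    fix \<tau> assume "\<tau> \<in> set_pmf (rollout \<theta> \<pi> (Suc k) h s)"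
    then obtain a s' \<tau>' where "a \<in> set_pmf (\<pi> h s)" "s' \<in> set_pmf (\<theta> h s a)"
      "\<tau>' \<in> set_pmf (rollout \<theta> \<pi> k (Suc h) s')" "\<tau> = ((s, a) # fst \<tau>', snd \<tau>')"
      by auto
    moreover from calculation have "a < nA m" "\<tau>' \<in> {xs. set xs \<subseteq> {..<nS m} \<times> {..<nA m} \<and> length xs = k} \<times> {..<nS m}"
      using a s' IH by blast+
    ultimately show "\<tau> \<in> {xs. set xs \<subseteq> {..<nS m} \<times> {..<nA m} \<and> length xs = Suc k} \<times> {..<nS m}"
      using Suc.prems(2) by (cases \<tau>') auto
  qed
qed simp

lemma set_traj_law:
  assumes "valid_mdp m" "\<theta> \<in> kernels m" "\<pi> \<in> policies m"
  shows "set_pmf (traj_law m \<theta> \<pi>) \<subseteq> trajs m"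
proof
  fix \<tau> assume "\<tau> \<in> set_pmf (traj_law m \<theta> \<pi>)"
  then obtain s where "s \<in> set_pmf (init m)" "\<tau> \<in> set_pmf (rollout \<theta> \<pi> (hor m) 0 s)"
    by (auto simp: traj_law_def)
  then show "\<tau> \<in> trajs m"
    using assms(1) set_rollout[OF assms(2,3), of 0 "hor m" s] by (auto simp: trajs_def valid_mdp_def)
qed

lemma finite_set_traj_law:
  assumes "valid_mdp m" "\<theta> \<in> kernels m" "\<pi> \<in> policies m"
  shows "finite (set_pmf (traj_law m \<theta> \<pi>))"
  using set_traj_law[OF assms] finite_trajs finite_subset by blast

lemma fst_nth_trajs: "\<tau> \<in> trajs m \<Longrightarrow> h < hor m \<Longrightarrow> fst \<tau> ! h \<in> {..<nS m} \<times> {..<nA m}"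
proof -
  assume "\<tau> \<in> trajs m" "h < hor m"
  then have "set (fst \<tau>) \<subseteq> {..<nS m} \<times> {..<nA m}" "fst \<tau> ! h \<in> set (fst \<tau>)"
    by (auto simp: trajs_def)
  then show ?thesis by (rule subsetD)
qed

lemma state_at_trajs: "\<tau> \<in> trajs m \<Longrightarrow> state_at h \<tau> < nS m"
  using fst_nth_trajs[of \<tau> m h] by (auto simp: state_at_def trajs_def)

lemma action_at_trajs: "\<tau> \<in> trajs m \<Longrightarrow> h < hor m \<Longrightarrow> action_at h \<tau> < nA m"
  using fst_nth_trajs[of \<tau> m h] by (auto simp: action_at_def)

lemma set_occ:
  assumes "valid_mdp m" "\<theta> \<in> kernels m" "\<pi> \<in> policies m" "h \<le> hor m"
  shows "set_pmf (occ m \<theta> \<pi> h) \<subseteq> {..<nS m}"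
proof -
  have "set_pmf (occ m \<theta> \<pi> h) = state_at h ` set_pmf (traj_law m \<theta> \<pi>)"
    using assms map_state_traj_law[of h m \<theta> \<pi>] by (metis set_map_pmf valid_mdp_def)
  then show ?thesis using set_traj_law[OF assms(1-3)] state_at_trajs by fastforce
qed

lemma finite_set_occ:
  assumes "valid_mdp m" "\<theta> \<in> kernels m" "\<pi> \<in> policies m" "h \<le> hor m"
  shows "finite (set_pmf (occ m \<theta> \<pi> h))"
  using set_occ[OF assms] finite_subset by blast

lemma det_policies: "(\<And>h s. h < hor m \<Longrightarrow> s < nS m \<Longrightarrow> f h s < nA m) \<Longrightarrow> det f \<in> policies m"
  by (auto simp: policies_def det_def)

lemma expectation_traj_law_det:
  fixes g :: "nat \<Rightarrow> nat \<Rightarrow> real"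
  assumes "h < hor m"
  shows "measure_pmf.expectation (traj_law m \<theta> (det f)) (\<lambda>\<tau>. g (state_at h \<tau>) (action_at h \<tau>))
       = measure_pmf.expectation (occ m \<theta> (det f) h) (\<lambda>s. g s (f h s))"
proof -
  have "map_pmf (\<lambda>\<tau>. (state_at h \<tau>, action_at h \<tau>)) (traj_law m \<theta> (det f))
      = map_pmf (\<lambda>s. (s, f h s)) (occ m \<theta> (det f) h)"
    using map_pair_traj_law[OF assms, of \<theta> "det f"] by (simp add: det_def bind_return_pmf flip: map_pmf_def)
  from arg_cong[OF this, of "\<lambda>p. measure_pmf.expectation p (\<lambda>(s, a). g s a)"] show ?thesis
    by simp
qed

section \<open>Values of deterministic policies\<close>

definition pvalue :: "mdp \<Rightarrow> kernel \<Rightarrow> (nat \<Rightarrow> nat \<Rightarrow> nat) \<Rightarrow> real" where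
  "pvalue m \<theta> f = measure_pmf.expectation (traj_law m \<theta> (det f)) (total_reward m)"

text \<open>Telescoping along the trajectory; \<open>u\<close> need not be a value function.\<close>

lemma performance_difference:
  assumes m: "valid_mdp m" and \<theta>: "\<theta> \<in> kernels m" and f: "det f \<in> policies m"
    and u: "\<And>s. s < nS m \<Longrightarrow> u (hor m) s = trew m s"
  shows "measure_pmf.expectation (init m) (u 0) - pvalue m \<theta> f =
    (\<Sum>h<hor m. measure_pmf.expectation (occ m \<theta> (det f) h)
       (\<lambda>s. u h s - rew m h s (f h s) - measure_pmf.expectation (\<theta> h s (f h s)) (u (Suc h))))"
proof -
  let ?p = "occ m \<theta> (det f)"
  let ?E = measure_pmf.expectation
  note fin = finite_set_occ[OF m \<theta> f]
  have int: "integrable (measure_pmf (?p h)) g" if "h \<le> hor m" for h and g :: "nat \<Rightarrow> real"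
    by (rule integrable_measure_pmf_finite[OF fin[OF that]])
  have intt: "integrable (measure_pmf (traj_law m \<theta> (det f))) g" for g :: "traj \<Rightarrow> real"
    by (rule integrable_measure_pmf_finite[OF finite_set_traj_law[OF m \<theta> f]])
  have H: "1 \<le> hor m" using m by (simp add: valid_mdp_def)
  have "pvalue m \<theta> f = (\<Sum>h<hor m. ?E (?p h) (\<lambda>s. rew m h s (f h s))) + ?E (?p (hor m)) (trew m)"
    unfolding pvalue_def total_reward_def
    by (simp add: intt expectation_traj_law_det flip: map_state_traj_law[OF order_refl H])
  also have "?E (?p (hor m)) (trew m) = ?E (?p (hor m)) (u (hor m))"
    using set_occ[OF m \<theta> f order_refl] u
    by (intro Bochner_Integration.integral_cong_AE) (auto simp: AE_measure_pmf_iff subset_iff)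
  finally have *: "pvalue m \<theta> f = (\<Sum>h<hor m. ?E (?p h) (\<lambda>s. rew m h s (f h s))) + ?E (?p (hor m)) (u (hor m))" .
  have step: "?E (?p (Suc h)) g = ?E (?p h) (\<lambda>s. ?E (\<theta> h s (f h s)) g)" if "h < hor m"
    for h and g :: "nat \<Rightarrow> real"
  proof -
    have "?p (Suc h) = bind_pmf (?p h) (\<lambda>s. \<theta> h s (f h s))"
      by (simp add: det_def bind_return_pmf)
    moreover have "finite (set_pmf (\<theta> h s (f h s)))" if "s \<in> set_pmf (?p h)" for s
    proof -
      have "s < nS m" using set_occ[OF m \<theta> f, of h] that \<open>h < hor m\<close> by auto
      with f \<open>h < hor m\<close> have "f h s < nA m" by (auto simp: policies_def det_def)
      with \<open>s < nS m\<close> \<open>h < hor m\<close> \<theta> have "set_pmf (\<theta> h s (f h s)) \<subseteq> {..<nS m}"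
        by (auto simp: kernels_def)
      then show ?thesis using finite_subset by blast
    qed
    ultimately show ?thesis
      using fin[of h] that by (simp add: expectation_bind_pmf_finite)
  qed
  have "(\<Sum>h<hor m. ?E (?p h) (\<lambda>s. u h s - rew m h s (f h s) - ?E (\<theta> h s (f h s)) (u (Suc h))))
      = (\<Sum>h<hor m. ?E (?p h) (u h) - ?E (?p h) (\<lambda>s. rew m h s (f h s)) - ?E (?p (Suc h)) (u (Suc h)))"
    by (intro sum.cong refl) (simp only: step lessThan_iff, simp add: int)
  also have "\<dots> = (\<Sum>h<hor m. ?E (?p h) (u h) - ?E (?p (Suc h)) (u (Suc h))) - (\<Sum>h<hor m. ?E (?p h) (\<lambda>s. rew m h s (f h s)))"
    by (simp add: sum_subtractf)
  also have "(\<Sum>h<hor m. ?E (?p h) (u h) - ?E (?p (Suc h)) (u (Suc h))) = ?E (?p 0) (u 0) - ?E (?p (hor m)) (u (hor m))"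
    by (rule sum_lessThan_telescope')
  finally show ?thesis using * by simp
qed

section \<open>Values and the canonical optimal policy\<close>

abbreviation opt_act :: "mdp \<Rightarrow> kernel \<Rightarrow> nat \<Rightarrow> nat \<Rightarrow> nat" where
  "opt_act m \<theta> \<equiv> opt_prefix m \<theta> (hor m)"

lemma V_terminal: "hor m \<le> h \<Longrightarrow> V m \<theta> h s = trew m s"
  by (subst V.simps) simp

lemma V_eq_Max: "h < hor m \<Longrightarrow> V m \<theta> h s = Max (Q m \<theta> h s ` {..<nA m})"
  by (subst V.simps) (simp add: Q_def[abs_def])

lemma greedy:
  assumes "0 < nA m"
  shows greedy_less: "greedy m \<theta> h s < nA m"
    and Q_le_Q_greedy: "b < nA m \<Longrightarrow> Q m \<theta> h s b \<le> Q m \<theta> h s (greedy m \<theta> h s)"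
proof -
  have ne: "Q m \<theta> h s ` {..<nA m} \<noteq> {}" using assms by auto
  have "Max (Q m \<theta> h s ` {..<nA m}) \<in> Q m \<theta> h s ` {..<nA m}" by (rule Max_in) (use ne in auto)
  then obtain a where "a < nA m" "Q m \<theta> h s a = Max (Q m \<theta> h s ` {..<nA m})" by auto
  then have "a < nA m \<and> (\<forall>b<nA m. Q m \<theta> h s b \<le> Q m \<theta> h s a)" by auto
  from LeastI[of "\<lambda>a. a < nA m \<and> (\<forall>b<nA m. Q m \<theta> h s b \<le> Q m \<theta> h s a)", OF this]
  show "greedy m \<theta> h s < nA m"
    and "b < nA m \<Longrightarrow> Q m \<theta> h s b \<le> Q m \<theta> h s (greedy m \<theta> h s)"
    unfolding greedy_def by auto
qed

lemma V_eq_Q_greedy: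
  assumes "h < hor m" "0 < nA m"
  shows "V m \<theta> h s = Q m \<theta> h s (greedy m \<theta> h s)"
  unfolding V_eq_Max[OF assms(1)]
  by (rule Max_eqI) (use greedy[OF assms(2)] in auto)

lemma opt_prefix_ge: "h \<le> i \<Longrightarrow> opt_prefix m \<theta> h i s = act0 m"
  by (induction h) auto

lemma opt_prefix_stable: "i < h \<Longrightarrow> opt_prefix m \<theta> h i s = opt_prefix m \<theta> (Suc i) i s"
  by (induction h) (auto simp: less_Suc_eq)

lemma opt_act_ge: "hor m \<le> h \<Longrightarrow> opt_act m \<theta> h s = act0 m"
  by (rule opt_prefix_ge)

text \<open>The law of the state at period \<open>h\<close> depends only on the actions before
  \<open>h\<close>, where the prefix and the finished policy agree. The sequential definition thus
  becomes a self-consistent one: greedy on the states that the policy itself reaches, the default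
  action elsewhere.\<close>

lemma opt_act_eq:
  assumes "h < hor m"
  shows "opt_act m \<theta> h s =
    (if s \<in> set_pmf (occ m \<theta> (det (opt_act m \<theta>)) h) then greedy m \<theta> h s else act0 m)"
proof -
  have "occ m \<theta> (det (opt_prefix m \<theta> h)) h = occ m \<theta> (det (opt_act m \<theta>)) h"
    using assms by (intro occ_cong) (simp add: det_def opt_prefix_stable[of _ h] opt_prefix_stable[of _ "hor m"])
  then show ?thesis
    using assms opt_prefix_stable[OF assms, of m \<theta> s]
    by (simp add: state_prob_eq_occ set_pmf_iff pmf_positive_iff)
qed

lemma nA_pos: "valid_mdp m \<Longrightarrow> 0 < nA m"
  by (auto simp: valid_mdp_def)

lemma opt_act_less: "valid_mdp m \<Longrightarrow> opt_act m \<theta> h s < nA m"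
  by (cases "h < hor m") (auto simp: opt_act_eq opt_act_ge greedy_less nA_pos valid_mdp_def)

lemma opt_policy_eq: "opt_policy m \<theta> = det (opt_act m \<theta>)"
  by (simp add: opt_policy_def)

lemma opt_policy_in: "valid_mdp m \<Longrightarrow> det (opt_act m \<theta>) \<in> policies m"
  by (intro det_policies opt_act_less)

text \<open>Makes equality of canonical policies as functions on all natural numbers the same as
  equality on the relevant periods and states, so that policies can be compared by plain
  equality.\<close>

lemma opt_act_out:
  assumes "valid_mdp m" "\<theta> \<in> kernels m" "\<not> (h < hor m \<and> s < nS m)"
  shows "opt_act m \<theta> h s = act0 m"
proof (cases "h < hor m")
  case True
  then show ?thesis
    using assms set_occ[OF assms(1,2) opt_policy_in[OF assms(1)], of h \<theta>] by (auto simp: opt_act_eq)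
qed (simp add: opt_act_ge)

lemma kernels_expectation:
  assumes "\<theta> \<in> kernels m" "h < hor m" "s < nS m" "a < nA m"
  shows "measure_pmf.expectation (\<theta> h s a) g = (\<Sum>s'<nS m. pmf (\<theta> h s a) s' * g s')"
proof -
  have "set_pmf (\<theta> h s a) \<subseteq> {..<nS m}" using assms unfolding kernels_def by blast
  then show ?thesis
    by (subst integral_measure_pmf[where A = "{..<nS m}"]) (auto simp: mult.commute)
qed

lemma kernels_sum_pmf:
  assumes "\<theta> \<in> kernels m" "h < hor m" "s < nS m" "a < nA m"
  shows "(\<Sum>s'<nS m. pmf (\<theta> h s a) s') = 1"
  using kernels_expectation[OF assms, of "\<lambda>_. 1"] by simp

text \<open>With \<open>V\<close> as the telescoped function every summand vanishes: on occupied
  states the policy is greedy, and default actions are taken only on states of probability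
  zero.\<close>

lemma pvalue_opt_act:
  assumes m: "valid_mdp m" and \<theta>: "\<theta> \<in> kernels m"
  shows "pvalue m \<theta> (opt_act m \<theta>) = measure_pmf.expectation (init m) (V m \<theta> 0)"
proof -
  let ?f = "opt_act m \<theta>"
  have "measure_pmf.expectation (occ m \<theta> (det ?f) h)
       (\<lambda>s. V m \<theta> h s - rew m h s (?f h s) - measure_pmf.expectation (\<theta> h s (?f h s)) (V m \<theta> (Suc h))) = 0"
    if h: "h < hor m" for h
  proof -
    have "V m \<theta> h s - rew m h s (?f h s) - measure_pmf.expectation (\<theta> h s (?f h s)) (V m \<theta> (Suc h)) = 0"
      if s: "s \<in> set_pmf (occ m \<theta> (det ?f) h)" for s
    proof -
      have "s < nS m" using set_occ[OF m \<theta> opt_policy_in[OF m], of h \<theta>] h s by auto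
      moreover have "?f h s = greedy m \<theta> h s" using opt_act_eq[OF h, of \<theta> s] s by simp
      ultimately show ?thesis
        using h \<theta> m by (simp add: V_eq_Q_greedy nA_pos kernels_expectation greedy_less Q_def)
    qed
    then show ?thesis
      by (subst Bochner_Integration.integral_cong_AE[where g = "\<lambda>_. 0"]) (auto simp: AE_measure_pmf_iff)
  qed
  then show ?thesis
    using performance_difference[OF m \<theta> opt_policy_in[OF m], of "V m \<theta>" \<theta>]
    by (simp add: V_terminal)
qed

lemma total_reward_bounds:
  assumes m: "valid_mdp m" and \<tau>: "\<tau> \<in> trajs m"
  shows "0 \<le> total_reward m \<tau>" "total_reward m \<tau> \<le> real (hor m) + 1"
proof -
  have "rew m h (state_at h \<tau>) (action_at h \<tau>) \<in> {0..1}" if "h < hor m" for h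
    using that m state_at_trajs[OF \<tau>, of h] action_at_trajs[OF \<tau> that] unfolding valid_mdp_def by blast
  moreover have "trew m (state_at (hor m) \<tau>) \<in> {0..1}"
    using m state_at_trajs[OF \<tau>] unfolding valid_mdp_def by blast
  moreover from calculation have "0 \<le> (\<Sum>h<hor m. rew m h (state_at h \<tau>) (action_at h \<tau>))"
    "(\<Sum>h<hor m. rew m h (state_at h \<tau>) (action_at h \<tau>)) \<le> (\<Sum>h<hor m. 1)"
    by (auto intro!: sum_nonneg simp del: sum_constant intro: sum_mono)
  ultimately show "0 \<le> total_reward m \<tau>" "total_reward m \<tau> \<le> real (hor m) + 1"
    by (auto simp: total_reward_def)
qed

lemma pvalue_bounds:
  assumes m: "valid_mdp m" and \<theta>: "\<theta> \<in> kernels m" and f: "det f \<in> policies m"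
  shows "0 \<le> pvalue m \<theta> f" "pvalue m \<theta> f \<le> real (hor m) + 1"
proof -
  have AE: "AE \<tau> in traj_law m \<theta> (det f). \<tau> \<in> trajs m"
    using set_traj_law[OF m \<theta> f] by (auto simp: AE_measure_pmf_iff)
  show "0 \<le> pvalue m \<theta> f"
    unfolding pvalue_def
    by (rule integral_nonneg_AE, rule AE_mp[OF AE], rule AE_I2) (simp add: total_reward_bounds[OF m])
  show "pvalue m \<theta> f \<le> real (hor m) + 1"
    unfolding pvalue_def
    by (rule measure_pmf.integral_le_const, rule integrable_measure_pmf_finite[OF finite_set_traj_law[OF m \<theta> f]],
        rule AE_mp[OF AE], rule AE_I2) (simp add: total_reward_bounds[OF m])
qed

lemma V_bounds:
  assumes m: "valid_mdp m" and \<theta>: "\<theta> \<in> kernels m"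
  shows "s < nS m \<Longrightarrow> 0 \<le> V m \<theta> h s \<and> V m \<theta> h s \<le> real (hor m - h) + 1"
proof (induction "hor m - h" arbitrary: h s)
  case 0
  then have "trew m s \<in> {0..1}" using m unfolding valid_mdp_def by blast
  with 0 show ?case by (simp add: V_terminal)
next
  case (Suc k)
  then have h: "h < hor m" and k: "k = hor m - Suc h" by auto
  let ?a = "greedy m \<theta> h s"
  have a: "?a < nA m" using m by (simp add: greedy_less nA_pos)
  have r: "rew m h s ?a \<in> {0..1}" using m a h Suc.prems unfolding valid_mdp_def by blast
  have IH: "0 \<le> V m \<theta> (Suc h) s' \<and> V m \<theta> (Suc h) s' \<le> real k + 1" if "s' < nS m" for s'
    using Suc.hyps(1)[OF k that] k by simp
  have "(\<Sum>s'<nS m. pmf (\<theta> h s ?a) s' * V m \<theta> (Suc h) s') \<le> (\<Sum>s'<nS m. pmf (\<theta> h s ?a) s' * (real k + 1))"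
    by (intro sum_mono mult_left_mono) (use IH in auto)
  also have "\<dots> = real k + 1"
    using kernels_sum_pmf[OF \<theta> h Suc.prems a] by (simp flip: sum_distrib_right)
  finally have "(\<Sum>s'<nS m. pmf (\<theta> h s ?a) s' * V m \<theta> (Suc h) s') \<le> real k + 1" .
  moreover have "0 \<le> (\<Sum>s'<nS m. pmf (\<theta> h s ?a) s' * V m \<theta> (Suc h) s')"
    by (intro sum_nonneg mult_nonneg_nonneg) (use IH in auto)
  moreover have "V m \<theta> h s = rew m h s ?a + (\<Sum>s'<nS m. pmf (\<theta> h s ?a) s' * V m \<theta> (Suc h) s')"
    using V_eq_Q_greedy[OF h nA_pos[OF m]] by (simp add: Q_def)
  ultimately show ?case using r Suc.hyps(2) by auto
qed

text \<open>\<open>togo m \<theta> f k s\<close> is the value of state \<open>s\<close> when \<open>k\<close> periods remain.\<close>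

primrec togo :: "mdp \<Rightarrow> kernel \<Rightarrow> (nat \<Rightarrow> nat \<Rightarrow> nat) \<Rightarrow> nat \<Rightarrow> nat \<Rightarrow> real" where
  "togo m \<theta> f 0 s = trew m s"
| "togo m \<theta> f (Suc k) s = (let h = hor m - Suc k; a = f h s in
     rew m h s a + measure_pmf.expectation (\<theta> h s a) (togo m \<theta> f k))"

lemma togo_bounds:
  assumes m: "valid_mdp m" and \<theta>: "\<theta> \<in> kernels m" and f: "det f \<in> policies m"
  shows "k \<le> hor m \<Longrightarrow> s < nS m \<Longrightarrow> 0 \<le> togo m \<theta> f k s \<and> togo m \<theta> f k s \<le> real k + 1"
proof (induction k arbitrary: s)
  case 0
  then have "trew m s \<in> {0..1}" using m unfolding valid_mdp_def by blast
  then show ?case by simp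
next
  case (Suc k)
  define h where "h = hor m - Suc k"
  have h: "h < hor m" using Suc.prems by (simp add: h_def)
  have a: "f h s < nA m" using f h Suc.prems by (auto simp: policies_def det_def)
  have r: "rew m h s (f h s) \<in> {0..1}" using m a h Suc.prems unfolding valid_mdp_def by blast
  have IH: "0 \<le> togo m \<theta> f k s' \<and> togo m \<theta> f k s' \<le> real k + 1" if "s' < nS m" for s'
    using Suc.IH[OF _ that] Suc.prems by simp
  have "(\<Sum>s'<nS m. pmf (\<theta> h s (f h s)) s' * togo m \<theta> f k s') \<le> (\<Sum>s'<nS m. pmf (\<theta> h s (f h s)) s' * (real k + 1))"
    by (intro sum_mono mult_left_mono) (use IH in auto)
  also have "\<dots> = real k + 1"
    using kernels_sum_pmf[OF \<theta> h Suc.prems(2) a] by (simp flip: sum_distrib_right)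
  finally have "(\<Sum>s'<nS m. pmf (\<theta> h s (f h s)) s' * togo m \<theta> f k s') \<le> real k + 1" .
  moreover have "0 \<le> (\<Sum>s'<nS m. pmf (\<theta> h s (f h s)) s' * togo m \<theta> f k s')"
    by (intro sum_nonneg mult_nonneg_nonneg) (use IH in auto)
  ultimately show ?case
    using r kernels_expectation[OF \<theta> h Suc.prems(2) a] by (auto simp: Let_def simp flip: h_def)
qed

section \<open>Sensitivity of a policy's value to the kernel\<close>

definition l1dist :: "mdp \<Rightarrow> kernel \<Rightarrow> kernel \<Rightarrow> nat \<Rightarrow> nat \<Rightarrow> nat \<Rightarrow> real" where
  "l1dist m \<theta> \<theta>' h s a = (\<Sum>s'<nS m. \<bar>pmf (\<theta> h s a) s' - pmf (\<theta>' h s a) s'\<bar>)"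

text \<open>Telescope the value-to-go of \<open>f\<close> under \<open>\<theta>'\<close>: along
  \<open>\<theta>'\<close> all summands vanish, along \<open>\<theta>\<close> each leaves the
  difference of two next-state expectations of a function with values in [0, H]. The expectation is
  under \<open>\<theta>\<close>, the kernel that produces the data, so the visited triples are those
  that get counted.\<close>

lemma pvalue_diff_le:
  assumes m: "valid_mdp m" and \<theta>: "\<theta> \<in> kernels m" and \<theta>': "\<theta>' \<in> kernels m" and f: "det f \<in> policies m"
  shows "pvalue m \<theta>' f - pvalue m \<theta> f \<le> real (hor m) *
    measure_pmf.expectation (traj_law m \<theta> (det f))
      (\<lambda>\<tau>. \<Sum>h<hor m. l1dist m \<theta> \<theta>' h (state_at h \<tau>) (action_at h \<tau>))"
proof -
  define u where "u h = togo m \<theta>' f (hor m - h)" for h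
  have u_Suc: "u h s = rew m h s (f h s) + measure_pmf.expectation (\<theta>' h s (f h s)) (u (Suc h))"
    if "h < hor m" for h s
  proof -
    have "hor m - h = Suc (hor m - Suc h)" using that by simp
    then show ?thesis using that by (simp add: u_def Let_def)
  qed
  have uH: "u (hor m) s = trew m s" for s by (simp add: u_def)
  have "pvalue m \<theta>' f = measure_pmf.expectation (init m) (u 0)"
    using performance_difference[OF m \<theta>' f, of u] by (simp add: u_Suc uH)
  then have "pvalue m \<theta>' f - pvalue m \<theta> f = (\<Sum>h<hor m. measure_pmf.expectation (occ m \<theta> (det f) h)
      (\<lambda>s. measure_pmf.expectation (\<theta>' h s (f h s)) (u (Suc h)) - measure_pmf.expectation (\<theta> h s (f h s)) (u (Suc h))))"
    using performance_difference[OF m \<theta> f, of u] by (simp add: u_Suc uH)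
  also have "\<dots> \<le> (\<Sum>h<hor m. measure_pmf.expectation (occ m \<theta> (det f) h) (\<lambda>s. real (hor m) * l1dist m \<theta> \<theta>' h s (f h s)))"
  proof (intro sum_mono integral_mono_AE)
    fix h assume "h \<in> {..<hor m}"
    then have h: "h < hor m" by simp
    note int = integrable_measure_pmf_finite[OF finite_set_occ[OF m \<theta> f, of h]]
    show "integrable (occ m \<theta> (det f) h) (\<lambda>s. measure_pmf.expectation (\<theta>' h s (f h s)) (u (Suc h)) -
           measure_pmf.expectation (\<theta> h s (f h s)) (u (Suc h)))"
      and "integrable (occ m \<theta> (det f) h) (\<lambda>s. real (hor m) * l1dist m \<theta> \<theta>' h s (f h s))"
      using h by (auto intro!: int)
    have "measure_pmf.expectation (\<theta>' h s (f h s)) (u (Suc h)) - measure_pmf.expectation (\<theta> h s (f h s)) (u (Suc h))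
        \<le> real (hor m) * l1dist m \<theta> \<theta>' h s (f h s)" if s: "s < nS m" for s
    proof -
      have a: "f h s < nA m" using f h s by (auto simp: policies_def det_def)
      have "measure_pmf.expectation (\<theta>' h s (f h s)) (u (Suc h)) - measure_pmf.expectation (\<theta> h s (f h s)) (u (Suc h))
        = (\<Sum>s'<nS m. (pmf (\<theta>' h s (f h s)) s' - pmf (\<theta> h s (f h s)) s') * u (Suc h) s')"
        by (simp add: kernels_expectation[OF \<theta> h s a] kernels_expectation[OF \<theta>' h s a] left_diff_distrib sum_subtractf)
      also have "\<dots> \<le> (\<Sum>s'<nS m. \<bar>pmf (\<theta> h s (f h s)) s' - pmf (\<theta>' h s (f h s)) s'\<bar> * real (hor m))"
      proof (intro sum_mono)
        fix s' assume "s' \<in> {..<nS m}"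
        then have "0 \<le> u (Suc h) s' \<and> u (Suc h) s' \<le> real (hor m - Suc h) + 1"
          unfolding u_def by (intro togo_bounds[OF m \<theta>' f]) auto
        \<comment> \<open>The terminal reward adds one to the \<open>hor m - Suc h\<close> remaining
          periods, which makes \<open>hor m - h\<close>, hence at most H.\<close>
        then have "\<bar>u (Suc h) s'\<bar> \<le> real (hor m)" using h by (auto simp: of_nat_diff)
        then have "\<bar>(pmf (\<theta>' h s (f h s)) s' - pmf (\<theta> h s (f h s)) s') * u (Suc h) s'\<bar>
          \<le> \<bar>pmf (\<theta>' h s (f h s)) s' - pmf (\<theta> h s (f h s)) s'\<bar> * real (hor m)"
          unfolding abs_mult by (intro mult_left_mono) auto
        then show "(pmf (\<theta>' h s (f h s)) s' - pmf (\<theta> h s (f h s)) s') * u (Suc h) s'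
          \<le> \<bar>pmf (\<theta> h s (f h s)) s' - pmf (\<theta>' h s (f h s)) s'\<bar> * real (hor m)"
          by (simp add: abs_minus_commute)
      qed
      also have "\<dots> = real (hor m) * l1dist m \<theta> \<theta>' h s (f h s)"
        by (simp add: l1dist_def sum_distrib_left mult.commute)
      finally show ?thesis .
    qed
    then show "AE s in occ m \<theta> (det f) h. measure_pmf.expectation (\<theta>' h s (f h s)) (u (Suc h)) -
           measure_pmf.expectation (\<theta> h s (f h s)) (u (Suc h)) \<le> real (hor m) * l1dist m \<theta> \<theta>' h s (f h s)"
      using set_occ[OF m \<theta> f, of h] h by (auto simp: AE_measure_pmf_iff)
  qed
  also have "\<dots> = real (hor m) * (\<Sum>h<hor m. measure_pmf.expectation (occ m \<theta> (det f) h) (\<lambda>s. l1dist m \<theta> \<theta>' h s (f h s)))"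
    by (simp add: sum_distrib_left)
  also have "(\<Sum>h<hor m. measure_pmf.expectation (occ m \<theta> (det f) h) (\<lambda>s. l1dist m \<theta> \<theta>' h s (f h s)))
    = (\<Sum>h<hor m. measure_pmf.expectation (traj_law m \<theta> (det f)) (\<lambda>\<tau>. l1dist m \<theta> \<theta>' h (state_at h \<tau>) (action_at h \<tau>)))"
    by (intro sum.cong refl) (simp add: expectation_traj_law_det)
  also have "\<dots> = measure_pmf.expectation (traj_law m \<theta> (det f))
      (\<lambda>\<tau>. \<Sum>h<hor m. l1dist m \<theta> \<theta>' h (state_at h \<tau>) (action_at h \<tau>))"
    by (rule Bochner_Integration.integral_sum[symmetric])
       (rule integrable_measure_pmf_finite[OF finite_set_traj_law[OF m \<theta> f]])
  finally show ?thesis .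
qed

section \<open>Recovering the optimal policy from the expert\<close>

lemma nn_integral_exp_replicate_pmf:
  fixes l :: real
  shows "(\<integral>\<^sup>+D. ennreal (exp (l * real (length (filter E D)))) \<partial>replicate_pmf L q)
       = ennreal (1 + measure_pmf.prob q {x. E x} * (exp l - 1)) ^ L"
proof (induction L)
  case (Suc L)
  let ?e = "measure_pmf.prob q {x. E x}"
  have c: "measure_pmf.prob q {x. \<not> E x} = 1 - ?e"
    using measure_pmf.prob_compl[of "{x. E x}" q] by (simp add: Compl_eq Compl_eq_Diff_UNIV[symmetric])
  have "(\<integral>\<^sup>+x. ennreal (exp (l * of_bool (E x))) \<partial>q)
      = (\<integral>\<^sup>+x. ennreal (exp l) * indicator {x. E x} x + indicator {x. \<not> E x} x \<partial>q)"
    by (intro nn_integral_cong) (auto split: split_indicator)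
  also have "\<dots> = ennreal (exp l) * ennreal ?e + ennreal (1 - ?e)"
    by (subst nn_integral_add) (auto simp: nn_integral_cmult measure_pmf.emeasure_eq_measure c)
  also have "\<dots> = ennreal (1 + ?e * (exp l - 1))"
    by (simp add: ennreal_mult[symmetric] ennreal_plus[symmetric] algebra_simps del: ennreal_plus)
  finally have 1: "(\<integral>\<^sup>+x. ennreal (exp (l * of_bool (E x))) \<partial>q) = ennreal (1 + ?e * (exp l - 1))" .
  have "(\<integral>\<^sup>+D. ennreal (exp (l * real (length (filter E D)))) \<partial>replicate_pmf (Suc L) q)
     = (\<integral>\<^sup>+x. \<integral>\<^sup>+D. ennreal (exp (l * of_bool (E x))) * ennreal (exp (l * real (length (filter E D)))) \<partial>replicate_pmf L q \<partial>q)"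
    by (auto intro!: nn_integral_cong simp: ennreal_mult[symmetric] exp_add[symmetric] algebra_simps)
  also have "\<dots> = ennreal (1 + ?e * (exp l - 1)) ^ Suc L"
    by (simp add: nn_integral_cmult nn_integral_multc 1 Suc)
  finally show ?case .
qed simp

text \<open>Markov's inequality for the exponential of the count, whose moment generating function
  is a power of the one for a single draw. The tilt \<open>l\<close> may have either sign, so that
  both tails are covered.\<close>

lemma replicate_pmf_chernoff:
  fixes l t :: real and q :: "'a pmf" and E
  defines "e \<equiv> measure_pmf.prob q {x. E x}"
  shows "measure_pmf.prob (replicate_pmf L q) {D. t \<le> l * real (length (filter E D))}
       \<le> exp (- t) * (1 + e * (exp l - 1)) ^ L"
proof -
  have "e \<le> 1" "0 \<le> e" by (auto simp: e_def)
  \<comment> \<open>The base of the power is a convex combination of 1 and \<open>exp l\<close>,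
    hence nonnegative; the passage between \<open>ennreal\<close> and real powers relies on
    this.\<close>
  have "0 \<le> (1 - e) + e * exp l"
    using \<open>e \<le> 1\<close> \<open>0 \<le> e\<close> by (intro add_nonneg_nonneg) auto
  then have nn: "0 \<le> 1 + e * (exp l - 1)" by (simp add: algebra_simps)
  have "emeasure (replicate_pmf L q) {D. t \<le> l * real (length (filter E D))}
     = (\<integral>\<^sup>+D. indicator {D. t \<le> l * real (length (filter E D))} D \<partial>replicate_pmf L q)"
    by simp
  also have "\<dots> \<le> (\<integral>\<^sup>+D. ennreal (exp (- t)) * ennreal (exp (l * real (length (filter E D)))) \<partial>replicate_pmf L q)"
    by (intro nn_integral_mono) (auto simp: ennreal_mult[symmetric] exp_add[symmetric] split: split_indicator)
  also have "\<dots> = ennreal (exp (- t) * (1 + e * (exp l - 1)) ^ L)"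
    using nn by (simp add: nn_integral_cmult nn_integral_exp_replicate_pmf e_def ennreal_mult ennreal_power)
  finally show ?thesis
    using nn by (simp add: measure_pmf.emeasure_eq_measure)
qed

text \<open>Tilt \<open>p\<close>: since \<open>exp p - 1 \<le> 2\<close>, a rate of at most p^2/6
  contributes at most p^2/3 per draw, against p^2/2 from the threshold. The surplus p^2/6 exceeds
  the p^2/18 that is claimed.\<close>

lemma replicate_pmf_rare:
  assumes p: "0 < p" "p \<le> 1" and e: "measure_pmf.prob q {x. E x} \<le> p\<^sup>2 / 6"
  shows "measure_pmf.prob (replicate_pmf L q) {D. real L * p / 2 < real (length (filter E D))}
       \<le> exp (- real L * p\<^sup>2 / 18)"
proof -
  let ?e = "measure_pmf.prob q {x. E x}"
  have "exp p \<le> 1 + p + p\<^sup>2" using p by (intro exp_bound) auto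
  moreover have "p\<^sup>2 \<le> 1" using p by (simp add: power_le_one)
  ultimately have "exp p - 1 \<le> 2" using p by simp
  then have "1 + ?e * (exp p - 1) \<le> 1 + ?e * 2" by (intro add_left_mono mult_left_mono) auto
  also have "\<dots> \<le> 1 + p\<^sup>2 / 3" using e by simp
  also have "\<dots> \<le> exp (p\<^sup>2 / 3)" by (rule exp_ge_add_one_self)
  finally have "(1 + ?e * (exp p - 1)) ^ L \<le> exp (p\<^sup>2 / 3) ^ L"
    using p by (intro power_mono add_nonneg_nonneg mult_nonneg_nonneg) auto
  also have "\<dots> = exp (real L * (p\<^sup>2 / 3))" by (rule exp_of_nat_mult[symmetric])
  finally have *: "(1 + ?e * (exp p - 1)) ^ L \<le> exp (real L * (p\<^sup>2 / 3))" .
  have "measure_pmf.prob (replicate_pmf L q) {D. real L * p / 2 < real (length (filter E D))}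
     \<le> measure_pmf.prob (replicate_pmf L q) {D. real L * p\<^sup>2 / 2 \<le> p * real (length (filter E D))}"
  proof (intro measure_pmf.finite_measure_mono subsetI CollectI)
    fix D assume "D \<in> {D. real L * p / 2 < real (length (filter E D))}"
    then have "p * (real L * p / 2) \<le> p * real (length (filter E D))"
      using p by (intro mult_left_mono) auto
    then show "real L * p\<^sup>2 / 2 \<le> p * real (length (filter E D))"
      by (simp add: power2_eq_square algebra_simps)
  qed simp
  also have "\<dots> \<le> exp (- (real L * p\<^sup>2 / 2)) * (1 + ?e * (exp p - 1)) ^ L"
    by (rule replicate_pmf_chernoff)
  also have "\<dots> \<le> exp (- (real L * p\<^sup>2 / 2)) * exp (real L * (p\<^sup>2 / 3))"
    by (intro mult_left_mono *) auto
  also have "\<dots> = exp (- real L * p\<^sup>2 / 6)" by (simp add: exp_add[symmetric] field_simps)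
  also have "\<dots> \<le> exp (- real L * p\<^sup>2 / 18)" by (simp add: field_simps)
  finally show ?thesis .
qed

text \<open>Tilt -1/2: as \<open>exp (- 1 / 2) \<le> 8 / 13\<close>, a draw contributes at most -
  3/8 * 5/6 * p = - 5/16 * p, against p/4 from the threshold. The remaining exponent - p/16 is below
  - p^2/18 because \<open>p \<le> 1\<close>.\<close>

lemma replicate_pmf_frequent:
  assumes p: "0 < p" "p \<le> 1" and e: "5 / 6 * p \<le> measure_pmf.prob q {x. E x}"
  shows "measure_pmf.prob (replicate_pmf L q) {D. real (length (filter E D)) \<le> real L * p / 2}
       \<le> exp (- real L * p\<^sup>2 / 18)"
proof -
  let ?e = "measure_pmf.prob q {x. E x}"
  let ?l = "- 1 / 2 :: real"
  have "1 + 1 / 2 + (1 / 2)\<^sup>2 / 2 \<le> exp (1 / 2 :: real)" by (rule exp_lower_Taylor_quadratic) simp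
  then have "13 / 8 \<le> exp (1 / 2 :: real)" by (simp add: power2_eq_square)
  then have "exp ?l \<le> 1 / (13 / 8)"
    by (simp add: exp_minus field_simps)
  then have l: "exp ?l - 1 \<le> - 3 / 8" by simp
  have nn: "0 \<le> 1 + ?e * (exp ?l - 1)"
  proof -
    have "0 \<le> (1 - ?e) + ?e * exp ?l" by (intro add_nonneg_nonneg) auto
    then show ?thesis by (simp add: algebra_simps)
  qed
  have "?e * (exp ?l - 1) \<le> ?e * (- 3 / 8)" using l by (intro mult_left_mono) auto
  then have "1 + ?e * (exp ?l - 1) \<le> 1 + (- 5 / 16 * p)" using e by simp
  also have "\<dots> \<le> exp (- 5 / 16 * p)" by (rule exp_ge_add_one_self)
  finally have "(1 + ?e * (exp ?l - 1)) ^ L \<le> exp (- 5 / 16 * p) ^ L"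
    using nn by (intro power_mono) auto
  also have "\<dots> = exp (real L * (- 5 / 16 * p))" by (rule exp_of_nat_mult[symmetric])
  finally have *: "(1 + ?e * (exp ?l - 1)) ^ L \<le> exp (real L * (- 5 / 16 * p))" .
  have "measure_pmf.prob (replicate_pmf L q) {D. real (length (filter E D)) \<le> real L * p / 2}
     \<le> measure_pmf.prob (replicate_pmf L q) {D. - (real L * p / 4) \<le> ?l * real (length (filter E D))}"
    by (intro measure_pmf.finite_measure_mono) auto
  also have "\<dots> \<le> exp (- (- (real L * p / 4))) * (1 + ?e * (exp ?l - 1)) ^ L"
    by (rule replicate_pmf_chernoff)
  also have "\<dots> \<le> exp (- (- (real L * p / 4))) * exp (real L * (- 5 / 16 * p))"
    by (intro mult_left_mono *) auto
  also have "\<dots> = exp (- real L * p / 16)" by (simp add: exp_add[symmetric] field_simps)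
  also have "\<dots> \<le> exp (- real L * p\<^sup>2 / 18)"
  proof -
    have "p\<^sup>2 \<le> p" using p by (simp add: power2_eq_square mult_left_le)
    then have "real L * p\<^sup>2 \<le> real L * p" by (intro mult_left_mono) auto
    moreover have "0 \<le> real L * p" using p by simp
    ultimately show ?thesis by simp
  qed
  finally show ?thesis .
qed

section \<open>The softmax expert is nearly optimal and nearly follows the canonical policy\<close>

lemma pmf_expert:
  assumes "0 < nA m"
  shows "pmf (expert m \<beta> \<theta> h s) a =
    (if a < nA m then exp (\<beta> * Q m \<theta> h s a) / (\<Sum>b<nA m. exp (\<beta> * Q m \<theta> h s b)) else 0)"
  unfolding expert_def
proof (rule pmf_embed_pmf)
  let ?Z = "\<Sum>b<nA m. exp (\<beta> * Q m \<theta> h s b)"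
  have Z: "0 < ?Z" using assms by (intro sum_pos) auto
  show "0 \<le> (if a < nA m then exp (\<beta> * Q m \<theta> h s a) / ?Z else 0)" for a
    using Z by simp
  have "(\<integral>\<^sup>+ a. ennreal (if a < nA m then exp (\<beta> * Q m \<theta> h s a) / ?Z else 0) \<partial>count_space UNIV)
     = (\<Sum>a<nA m. ennreal (exp (\<beta> * Q m \<theta> h s a) / ?Z))"
    by (subst nn_integral_count_space'[of "{..<nA m}"]) auto
  also have "\<dots> = ennreal (\<Sum>a<nA m. exp (\<beta> * Q m \<theta> h s a) / ?Z)"
    using Z by (intro sum_ennreal) simp
  also have "(\<Sum>a<nA m. exp (\<beta> * Q m \<theta> h s a) / ?Z) = 1"
    using Z by (simp add: sum_divide_distrib[symmetric])
  finally show "(\<integral>\<^sup>+ a. ennreal (if a < nA m then exp (\<beta> * Q m \<theta> h s a) / ?Z else 0) \<partial>count_space UNIV) = 1"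
    by simp
qed

lemma expert_policies: "valid_mdp m \<Longrightarrow> expert m \<beta> \<theta> \<in> policies m"
  using nA_pos[of m] by (auto simp: policies_def set_pmf_iff pmf_expert split: if_splits)

text \<open>The positive gap makes the maximiser unique, so it is the greedy action whatever the
  tie-breaking. Every other action has at most \<open>exp (- \<beta> * \<Delta>)\<close> times its
  weight, so the greedy probability is at least 1 / (1 + x), hence at least 1 - x, with x the
  claimed deficit.\<close>

lemma pmf_expert_greedy_ge:
  assumes A: "0 < nA m" and \<beta>: "0 \<le> \<beta>"
    and gap: "\<exists>a<nA m. \<forall>a'<nA m. a' \<noteq> a \<longrightarrow> Q m \<theta> h s a \<ge> Q m \<theta> h s a' + \<Delta>" and \<Delta>: "0 < \<Delta>"
  shows "1 - real (nA m) * exp (- \<beta> * \<Delta>) \<le> pmf (expert m \<beta> \<theta> h s) (greedy m \<theta> h s)"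
proof -
  let ?g = "greedy m \<theta> h s" let ?q = "Q m \<theta> h s"
  have g: "?g < nA m" using A by (rule greedy_less)
  obtain a where a: "a < nA m" "\<And>a'. a' < nA m \<Longrightarrow> a' \<noteq> a \<Longrightarrow> ?q a \<ge> ?q a' + \<Delta>"
    using gap by auto
  have ag: "a = ?g" using a(2)[OF g] Q_le_Q_greedy[OF A a(1), of \<theta> h s] \<Delta> by force
  define x where "x = real (nA m) * exp (- \<beta> * \<Delta>)"
  have x: "0 \<le> x" by (simp add: x_def)
  have "exp (\<beta> * ?q b) \<le> exp (\<beta> * ?q ?g) * exp (- \<beta> * \<Delta>)" if "b \<in> {..<nA m} - {?g}" for b
  proof -
    have "?q b \<le> ?q ?g - \<Delta>" using a(2)[of b] ag that by auto
    then have "\<beta> * ?q b \<le> \<beta> * (?q ?g - \<Delta>)" using \<beta> by (rule mult_left_mono)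
    then show ?thesis by (simp add: exp_add[symmetric] algebra_simps)
  qed
  then have "(\<Sum>b\<in>{..<nA m} - {?g}. exp (\<beta> * ?q b))
      \<le> real (card ({..<nA m} - {?g})) * (exp (\<beta> * ?q ?g) * exp (- \<beta> * \<Delta>))"
    by (rule sum_bounded_above)
  also have "\<dots> \<le> real (nA m) * (exp (\<beta> * ?q ?g) * exp (- \<beta> * \<Delta>))"
    using g by (intro mult_right_mono) auto
  finally have "(\<Sum>b\<in>{..<nA m} - {?g}. exp (\<beta> * ?q b)) \<le> exp (\<beta> * ?q ?g) * x"
    by (simp only: x_def mult_ac)
  moreover have "(\<Sum>b<nA m. exp (\<beta> * ?q b)) = exp (\<beta> * ?q ?g) + (\<Sum>b\<in>{..<nA m} - {?g}. exp (\<beta> * ?q b))"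
    using g by (subst sum.remove[of _ ?g]) auto
  ultimately have Z: "(\<Sum>b<nA m. exp (\<beta> * ?q b)) \<le> exp (\<beta> * ?q ?g) * (1 + x)"
    by (simp add: distrib_left)
  have pos: "0 < (\<Sum>b<nA m. exp (\<beta> * ?q b))" using A by (intro sum_pos) auto
  have "1 - x \<le> 1 / (1 + x)" using x by (simp add: field_simps)
  also have "\<dots> = exp (\<beta> * ?q ?g) / (exp (\<beta> * ?q ?g) * (1 + x))" by simp
  also have "\<dots> \<le> exp (\<beta> * ?q ?g) / (\<Sum>b<nA m. exp (\<beta> * ?q b))"
    using pos x by (intro divide_left_mono Z mult_pos_pos) auto
  finally show ?thesis using g A by (simp add: pmf_expert x_def)
qed

lemma prob_state_action:
  assumes h: "h < hor m"
  shows "measure_pmf.prob (traj_law m \<theta> \<pi>) {\<tau>. state_at h \<tau> = s \<and> action_at h \<tau> = a}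
       = pmf (occ m \<theta> \<pi> h) s * pmf (\<pi> h s) a"
proof -
  have pm: "pmf (bind_pmf (\<pi> h x) (\<lambda>a. return_pmf (x, a))) (s, a) = indicator {s} x * pmf (\<pi> h s) a" for x
  proof (cases "x = s")
    case True
    then show ?thesis
      using pmf_map_inj'[of "Pair s" "\<pi> h s" a] by (simp add: map_pmf_def inj_on_def)
  next
    case False
    then show ?thesis by (auto simp: pmf_eq_0_set_pmf)
  qed
  have "measure_pmf.prob (traj_law m \<theta> \<pi>) {\<tau>. state_at h \<tau> = s \<and> action_at h \<tau> = a}
      = pmf (map_pmf (\<lambda>\<tau>. (state_at h \<tau>, action_at h \<tau>)) (traj_law m \<theta> \<pi>)) (s, a)"
    by (simp add: pmf_map vimage_def)
  also have "\<dots> = pmf (occ m \<theta> \<pi> h) s * pmf (\<pi> h s) a"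
    by (simp add: map_pair_traj_law[OF h] pmf_bind[of "occ m \<theta> \<pi> h"] pm measure_pmf_single)
  finally show ?thesis .
qed

lemma prob_state:
  assumes "h \<le> hor m" "valid_mdp m"
  shows "measure_pmf.prob (traj_law m \<theta> \<pi>) {\<tau>. state_at h \<tau> = s} = pmf (occ m \<theta> \<pi> h) s"
  using state_prob_eq_occ[of h m \<theta> \<pi> s] assms by (simp add: state_prob_def valid_mdp_def)

text \<open>A policy that takes the greedy action with probability at least
  \<open>1 - \<eta>\<close> follows the canonical policy up to a loss of one such factor per period.
  Only states reached by the canonical policy contribute, and there its action is the greedy
  one.\<close>

lemma occ_ge:
  assumes m: "valid_mdp m" and \<theta>: "\<theta> \<in> kernels m" and \<pi>: "\<pi> \<in> policies m" and \<eta>: "0 \<le> \<eta>" "\<eta> \<le> 1"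
    and greedy: "\<And>h s. h < hor m \<Longrightarrow> s < nS m \<Longrightarrow> 1 - \<eta> \<le> pmf (\<pi> h s) (greedy m \<theta> h s)"
  shows "h \<le> hor m \<Longrightarrow> (1 - \<eta>) ^ h * pmf (occ m \<theta> (det (opt_act m \<theta>)) h) s \<le> pmf (occ m \<theta> \<pi> h) s"
proof (induction h arbitrary: s)
  case (Suc h)
  let ?o = "occ m \<theta> (det (opt_act m \<theta>))" let ?f = "opt_act m \<theta>"
  have h: "h < hor m" using Suc.prems by simp
  have "(1 - \<eta>) ^ Suc h * pmf (?o (Suc h)) s = (\<Sum>x<nS m. (1 - \<eta>) ^ Suc h * (pmf (?o h) x * pmf (\<theta> h x (?f h x)) s))"
    using set_occ[OF m \<theta> opt_policy_in[OF m], of h \<theta>] h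
    by (simp add: det_def bind_return_pmf pmf_bind_sum[of "{..<nS m}"] sum_distrib_left)
  also have "\<dots> \<le> (\<Sum>x<nS m. pmf (occ m \<theta> \<pi> h) x * pmf (bind_pmf (\<pi> h x) (\<theta> h x)) s)"
  proof (intro sum_mono)
    fix x assume x: "x \<in> {..<nS m}"
    show "(1 - \<eta>) ^ Suc h * (pmf (?o h) x * pmf (\<theta> h x (?f h x)) s)
        \<le> pmf (occ m \<theta> \<pi> h) x * pmf (bind_pmf (\<pi> h x) (\<theta> h x)) s"
    proof (cases "x \<in> set_pmf (?o h)")
      case True
      then have f: "?f h x = greedy m \<theta> h x" using h by (simp add: opt_act_eq)
      have "(1 - \<eta>) * pmf (\<theta> h x (?f h x)) s \<le> pmf (\<pi> h x) (?f h x) * pmf (\<theta> h x (?f h x)) s"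
        using greedy[of h x] h x f by (intro mult_right_mono) auto
      also have "\<dots> \<le> (\<Sum>a<nA m. pmf (\<pi> h x) a * pmf (\<theta> h x a) s)"
        using opt_act_less[OF m] by (intro member_le_sum[where f = "\<lambda>a. pmf (\<pi> h x) a * pmf (\<theta> h x a) s"]) auto
      also have "\<dots> = pmf (bind_pmf (\<pi> h x) (\<theta> h x)) s"
        using \<pi> h x by (subst pmf_bind_sum[of "{..<nA m}"]) (auto simp: policies_def)
      finally have "((1 - \<eta>) ^ h * pmf (?o h) x) * ((1 - \<eta>) * pmf (\<theta> h x (?f h x)) s)
        \<le> pmf (occ m \<theta> \<pi> h) x * pmf (bind_pmf (\<pi> h x) (\<theta> h x)) s"
        using \<eta> Suc by (intro mult_mono) auto
      then show ?thesis by (simp add: mult_ac)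
    next
      case False
      then have "pmf (?o h) x = 0" by (simp add: pmf_eq_0_set_pmf)
      then show ?thesis by simp
    qed
  qed
  also have "\<dots> = pmf (occ m \<theta> \<pi> (Suc h)) s"
    using set_occ[OF m \<theta> \<pi>, of h] h by (simp add: pmf_bind_sum[of "{..<nS m}"])
  finally show ?case .
qed simp

section \<open>Reading the optimal policy off the offline data\<close>

definition visits :: "nat \<Rightarrow> nat \<Rightarrow> nat \<Rightarrow> traj list \<Rightarrow> nat" where
  "visits h s a D = length (filter (\<lambda>\<tau>. state_at h \<tau> = s \<and> action_at h \<tau> = a) D)"

text \<open>On the good event at most one action passes the threshold \<open>c\<close>, so
  \<open>LEAST\<close> merely names it. The default \<open>act0 m\<close> is also what the canonical
  policy prescribes at states it does not reach.\<close>

definition estimate :: "mdp \<Rightarrow> real \<Rightarrow> traj list \<Rightarrow> nat \<Rightarrow> nat \<Rightarrow> nat" where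
  "estimate m c D h s =
    (if h < hor m \<and> s < nS m \<and> (\<exists>a. c < real (visits h s a D))
     then LEAST a. c < real (visits h s a D) else act0 m)"

text \<open>At each pair of period and state, seeing a non-canonical action has probability at most
  p^2/6, and at reached states seeing the canonical one has probability at least 5/6 * p. The
  threshold L p / 2 separates the two counts off two tail events; the union over all pairs gives the
  factor 2 S H.\<close>

lemma prob_estimate_wrong:
  assumes m: "valid_mdp m" and \<theta>: "\<theta> \<in> kernels m" and \<pi>: "\<pi> \<in> policies m"
    and p: "0 < p" "p \<le> 1" and \<eta>: "0 \<le> \<eta>" "real (hor m) * \<eta> \<le> p\<^sup>2 / 6"
    and greedy: "\<And>h s. h < hor m \<Longrightarrow> s < nS m \<Longrightarrow> 1 - \<eta> \<le> pmf (\<pi> h s) (greedy m \<theta> h s)"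
    and reach: "\<And>h s. h < hor m \<Longrightarrow> s \<in> set_pmf (occ m \<theta> (det (opt_act m \<theta>)) h) \<Longrightarrow>
        p \<le> pmf (occ m \<theta> (det (opt_act m \<theta>)) h) s"
  shows "measure_pmf.prob (replicate_pmf L (traj_law m \<theta> \<pi>)) {D. estimate m (real L * p / 2) D \<noteq> opt_act m \<theta>}
       \<le> 2 * real (nS m) * real (hor m) * exp (- real L * p\<^sup>2 / 18)"
proof -
  let ?o = "occ m \<theta> (det (opt_act m \<theta>))" and ?f = "opt_act m \<theta>" and ?q = "traj_law m \<theta> \<pi>"
  let ?R = "replicate_pmf L ?q" and ?c = "real L * p / 2"
  define good where "good h s \<tau> \<longleftrightarrow> state_at h \<tau> = s \<and> action_at h \<tau> = ?f h s" for h s \<tau>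
  define wrong where "wrong h s \<tau> \<longleftrightarrow> state_at h \<tau> = s \<and> action_at h \<tau> \<noteq> ?f h s" for h s \<tau>
  have H: "1 \<le> hor m" using m by (simp add: valid_mdp_def)
  have "p\<^sup>2 \<le> 1" using p by (simp add: power_le_one)
  have "\<eta> \<le> real (hor m) * \<eta>" using H \<eta> by (simp add: mult_le_cancel_right1)
  then have \<eta>1: "\<eta> \<le> 1" using \<eta> \<open>p\<^sup>2 \<le> 1\<close> by simp
  have pow: "1 - real (hor m) * \<eta> \<le> (1 - \<eta>) ^ h" if "h \<le> hor m" for h
  proof -
    have "1 - real (hor m) * \<eta> \<le> (1 - \<eta>) ^ hor m"
      using Bernoulli_inequality[of "- \<eta>" "hor m"] \<eta>1 by simp
    also have "\<dots> \<le> (1 - \<eta>) ^ h" using that \<eta> \<eta>1 by (intro power_decreasing) auto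
    finally show ?thesis .
  qed
  note ge = occ_ge[OF m \<theta> \<pi> \<eta>(1) \<eta>1 greedy]
  have wrong_le: "measure_pmf.prob ?q {\<tau>. wrong h s \<tau>} \<le> p\<^sup>2 / 6" if h: "h < hor m" and s: "s < nS m" for h s
  proof -
    have "{\<tau>. wrong h s \<tau>} = {\<tau>. state_at h \<tau> = s} - {\<tau>. state_at h \<tau> = s \<and> action_at h \<tau> = ?f h s}"
      by (auto simp: wrong_def)
    then have "measure_pmf.prob ?q {\<tau>. wrong h s \<tau>}
      = measure_pmf.prob ?q {\<tau>. state_at h \<tau> = s} - measure_pmf.prob ?q {\<tau>. state_at h \<tau> = s \<and> action_at h \<tau> = ?f h s}"
      by (simp add: measure_pmf.finite_measure_Diff Collect_mono)
    also have "\<dots> = pmf (occ m \<theta> \<pi> h) s * (1 - pmf (\<pi> h s) (?f h s))"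
      using h m by (simp add: prob_state prob_state_action algebra_simps)
    also have "\<dots> \<le> real (hor m) * \<eta>"
    proof (cases "s \<in> set_pmf (?o h)")
      case True
      then have "1 - pmf (\<pi> h s) (?f h s) \<le> \<eta>"
        using greedy[OF h s] h by (simp add: opt_act_eq)
      then have "pmf (occ m \<theta> \<pi> h) s * (1 - pmf (\<pi> h s) (?f h s)) \<le> 1 * \<eta>"
        by (intro mult_mono) (auto simp: pmf_le_1)
      then show ?thesis using \<open>\<eta> \<le> real (hor m) * \<eta>\<close> by simp
    next
      case False
      have fin: "s \<in> {..<nS m}" "finite {..<nS m}" using s by auto
      have z: "pmf (?o h) s = 0" using False by (simp add: pmf_eq_0_set_pmf)
      have "pmf (?o h) s + (\<Sum>x\<in>{..<nS m} - {s}. pmf (?o h) x) = 1"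
        using sum_pmf_eq_1[of "{..<nS m}" "?o h"] set_occ[OF m \<theta> opt_policy_in[OF m], of h \<theta>] h
        by (simp add: sum.remove[OF fin(2,1)])
      with z have o: "(\<Sum>x\<in>{..<nS m} - {s}. pmf (?o h) x) = 1" by linarith
      \<comment> \<open>At a state outside the canonical support no property of the action is used:
        the other states already carry mass at least \<open>(1 - \<eta>) ^ h\<close>, so the state
        itself is rarely visited.\<close>
      have "(1 - \<eta>) ^ h = (\<Sum>x\<in>{..<nS m} - {s}. (1 - \<eta>) ^ h * pmf (?o h) x)"
        by (simp add: sum_distrib_left[symmetric] o)
      also have "\<dots> \<le> (\<Sum>x\<in>{..<nS m} - {s}. pmf (occ m \<theta> \<pi> h) x)"
        using h by (intro sum_mono ge) auto
      also have "\<dots> = 1 - pmf (occ m \<theta> \<pi> h) s"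
        using sum_pmf_eq_1[of "{..<nS m}" "occ m \<theta> \<pi> h"] set_occ[OF m \<theta> \<pi>, of h] h
        by (simp add: sum.remove[OF fin(2,1)])
      finally have "pmf (occ m \<theta> \<pi> h) s \<le> real (hor m) * \<eta>" using pow[of h] h by simp
      moreover have "pmf (occ m \<theta> \<pi> h) s * (1 - pmf (\<pi> h s) (?f h s)) \<le> pmf (occ m \<theta> \<pi> h) s * 1"
        by (intro mult_left_mono) auto
      ultimately show ?thesis by simp
    qed
    finally show ?thesis using \<eta> by simp
  qed
  have good_ge: "5 / 6 * p \<le> measure_pmf.prob ?q {\<tau>. good h s \<tau>}"
    if h: "h < hor m" and s: "s \<in> set_pmf (?o h)" for h s
  proof -
    have s': "s < nS m" using set_occ[OF m \<theta> opt_policy_in[OF m], of h \<theta>] h s by auto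
    have "5 / 6 * p \<le> (1 - real (hor m) * \<eta>) * p"
      using \<eta> \<open>p\<^sup>2 \<le> 1\<close> p by (intro mult_right_mono) auto
    \<comment> \<open>\<open>h\<close> factors pay for reaching the state and one more for the
      action taken there.\<close>
    also have "\<dots> \<le> (1 - \<eta>) ^ Suc h * pmf (?o h) s"
      using pow[of "Suc h"] reach[OF h s] h p \<eta>1 by (intro mult_mono) auto
    also have "\<dots> = ((1 - \<eta>) ^ h * pmf (?o h) s) * (1 - \<eta>)" by simp
    also have "\<dots> \<le> pmf (occ m \<theta> \<pi> h) s * pmf (\<pi> h s) (?f h s)"
      using greedy[OF h s'] h s \<eta>1 by (intro mult_mono ge) (auto simp: opt_act_eq)
    also have "\<dots> = measure_pmf.prob ?q {\<tau>. good h s \<tau>}"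
      by (simp add: good_def prob_state_action[OF h])
    finally show ?thesis .
  qed
  \<comment> \<open>The lower-tail event is included only at reached states; elsewhere there is no
    lower bound on the number of visits.\<close>
  define B where "B = (\<lambda>(h, s). {D. ?c < real (length (filter (wrong h s) D))}
      \<union> (if s \<in> set_pmf (?o h) then {D. real (length (filter (good h s) D)) \<le> ?c} else {}))"
  have B: "measure_pmf.prob ?R (B x) \<le> 2 * exp (- real L * p\<^sup>2 / 18)" if "x \<in> {..<hor m} \<times> {..<nS m}" for x
  proof -
    obtain h s where x: "x = (h, s)" "h < hor m" "s < nS m" using \<open>x \<in> _\<close> by auto
    have "measure_pmf.prob ?R (B x) \<le> measure_pmf.prob ?R {D. ?c < real (length (filter (wrong h s) D))}
       + measure_pmf.prob ?R (if s \<in> set_pmf (?o h) then {D. real (length (filter (good h s) D)) \<le> ?c} else {})"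
      unfolding x(1) B_def prod.case by (rule measure_Un_le) auto
    also have "\<dots> \<le> exp (- real L * p\<^sup>2 / 18) + exp (- real L * p\<^sup>2 / 18)"
      using replicate_pmf_rare[OF p wrong_le[OF x(2,3)], of L] replicate_pmf_frequent[OF p good_ge[OF x(2)], of s L]
      by (intro add_mono) auto
    finally show ?thesis by simp
  qed
  have "{D. estimate m ?c D \<noteq> ?f} \<subseteq> (\<Union>x\<in>{..<hor m} \<times> {..<nS m}. B x)"
  proof
    fix D assume "D \<in> {D. estimate m ?c D \<noteq> ?f}"
    then obtain h s where ne: "estimate m ?c D h s \<noteq> ?f h s" by (auto simp: fun_eq_iff)
    then have hs: "h < hor m" "s < nS m"
      using opt_act_out[OF m \<theta>, of h s] by (auto simp: estimate_def split: if_splits)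
    have "D \<in> B (h, s)"
    proof (rule ccontr)
      assume nB: "D \<notin> B (h, s)"
      then have w: "real (length (filter (wrong h s) D)) \<le> ?c" by (auto simp: B_def)
      have v: "real (visits h s a D) \<le> ?c" if "a \<noteq> ?f h s" for a
      proof -
        have "{i. i < length D \<and> state_at h (D ! i) = s \<and> action_at h (D ! i) = a} \<subseteq> {i. i < length D \<and> wrong h s (D ! i)}"
          using that by (auto simp: wrong_def)
        then have "visits h s a D \<le> length (filter (wrong h s) D)"
          unfolding visits_def length_filter_conv_card by (intro card_mono) auto
        with w show ?thesis by linarith
      qed
      show False
      proof (cases "s \<in> set_pmf (?o h)")
        case True
        then have "?c < real (visits h s (?f h s) D)"
          using nB by (auto simp: B_def visits_def good_def[abs_def])
        then have "(LEAST a. ?c < real (visits h s a D)) = ?f h s"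
          using v by (intro Least_equality) (auto simp: not_less[symmetric])
        then show False
          using ne hs \<open>?c < real (visits h s (?f h s) D)\<close> by (auto simp: estimate_def split: if_splits)
      next
        case False
        then have f: "?f h s = act0 m" using hs by (simp add: opt_act_eq)
        have "estimate m ?c D h s = act0 m"
        proof (cases "\<exists>a. ?c < real (visits h s a D)")
          case True
          \<comment> \<open>At an unreached state \<open>act0 m\<close> itself may pass the
            threshold. No other action does, so the estimate is the default in either case.\<close>
          then have "?c < real (visits h s (LEAST a. ?c < real (visits h s a D)) D)" by (rule LeastI_ex)
          then have "(LEAST a. ?c < real (visits h s a D)) = act0 m"
            using v f by (metis not_less)
          then show ?thesis using hs True by (simp add: estimate_def)
        qed (simp add: estimate_def)
        then show False using ne f by simp
      qed
    qed
    then show "D \<in> (\<Union>x\<in>{..<hor m} \<times> {..<nS m}. B x)" using hs by blast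
  qed
  then have "measure_pmf.prob ?R {D. estimate m ?c D \<noteq> ?f} \<le> measure_pmf.prob ?R (\<Union>x\<in>{..<hor m} \<times> {..<nS m}. B x)"
    by (intro measure_pmf.finite_measure_mono) auto
  also have "\<dots> \<le> (\<Sum>x\<in>{..<hor m} \<times> {..<nS m}. measure_pmf.prob ?R (B x))"
    by (intro measure_pmf.finite_measure_subadditive_finite) auto
  also have "\<dots> \<le> (\<Sum>x\<in>{..<hor m} \<times> {..<nS m}. 2 * exp (- real L * p\<^sup>2 / 18))"
    by (intro sum_mono B)
  also have "\<dots> = 2 * real (nS m) * real (hor m) * exp (- real L * p\<^sup>2 / 18)"
    by simp
  finally show ?thesis .
qed

section \<open>Measurable dependence on the kernel\<close>

text \<open>Measurability of every point mass. For laws with a common finite support this is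
  equivalent to being a measurable kernel, and it is preserved by monadic binding through finite
  sums, so no sigma-algebra on \<open>pmf\<close> is required.\<close>

definition pmf_measurable :: "'a measure \<Rightarrow> ('a \<Rightarrow> 'b pmf) \<Rightarrow> bool" where
  "pmf_measurable M p \<longleftrightarrow> (\<forall>y. (\<lambda>x. pmf (p x) y) \<in> borel_measurable M)"

lemma pmf_measurableD: "pmf_measurable M p \<Longrightarrow> (\<lambda>x. pmf (p x) y) \<in> borel_measurable M"
  by (simp add: pmf_measurable_def)

lemma pmf_measurable_const: "pmf_measurable M (\<lambda>x. p)"
  by (simp add: pmf_measurable_def)

lemma pmf_measurable_return:
  assumes [measurable]: "g \<in> M \<rightarrow>\<^sub>M count_space UNIV"
  shows "pmf_measurable M (\<lambda>x. return_pmf (g x))"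
proof -
  have "(\<lambda>x. if g x = y then 1 else 0 :: real) \<in> borel_measurable M" for y by measurable
  then show ?thesis by (simp add: pmf_measurable_def pmf_return indicator_def)
qed

lemma pmf_measurable_bind:
  assumes "finite A" "\<And>x. x \<in> space M \<Longrightarrow> set_pmf (p x) \<subseteq> A"
    and p: "pmf_measurable M p" and f: "\<And>y. y \<in> A \<Longrightarrow> pmf_measurable M (\<lambda>x. f x y)"
  shows "pmf_measurable M (\<lambda>x. bind_pmf (p x) (f x))"
  unfolding pmf_measurable_def
proof
  fix y
  have "(\<lambda>x. \<Sum>z\<in>A. pmf (p x) z * pmf (f x z) y) \<in> borel_measurable M"
    using pmf_measurableD[OF p] pmf_measurableD[OF f] by (intro borel_measurable_sum borel_measurable_times) auto
  then show "(\<lambda>x. pmf (bind_pmf (p x) (f x)) y) \<in> borel_measurable M"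
    by (rule measurable_cong[THEN iffD2, rotated]) (simp add: pmf_bind_sum[OF assms(1,2)])
qed

lemma pmf_measurable_replicate:
  assumes "finite A" "\<And>x. x \<in> space M \<Longrightarrow> set_pmf (p x) \<subseteq> A" and p: "pmf_measurable M p"
  shows "pmf_measurable M (\<lambda>x. replicate_pmf n (p x))"
proof (induction n)
  case (Suc n)
  have "pmf_measurable M (\<lambda>x. bind_pmf (replicate_pmf n (p x)) (\<lambda>xs. return_pmf (z # xs)))" for z
    by (rule pmf_measurable_bind[where A = "{xs. set xs \<subseteq> A \<and> length xs = n}"])
       (use assms Suc in \<open>auto simp: set_replicate_pmf pmf_measurable_const intro!: finite_lists_length_eq\<close>)
  then show ?case
    using assms by (auto intro!: pmf_measurable_bind[where A = A])
qed (simp add: pmf_measurable_const)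

text \<open>Bridge from point masses to kernels in the sense of \<open>subprob_algebra\<close>, the
  form in which the joint law binds them.\<close>

lemma measurable_measure_pmf_finite:
  fixes p :: "'a \<Rightarrow> 'b pmf"
  assumes A: "finite A" "\<And>x. x \<in> space M \<Longrightarrow> set_pmf (p x) \<subseteq> A" and p: "pmf_measurable M p"
  shows "(\<lambda>x. measure_pmf (p x)) \<in> M \<rightarrow>\<^sub>M subprob_algebra (count_space UNIV)"
proof (rule measurable_subprob_algebra)
  fix B
  have "(\<lambda>x. ennreal (\<Sum>y\<in>A \<inter> B. pmf (p x) y)) \<in> borel_measurable M"
    using pmf_measurableD[OF p] by measurable
  moreover have "emeasure (p x) B = ennreal (\<Sum>y\<in>A \<inter> B. pmf (p x) y)" if "x \<in> space M" for x
  proof -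
    have "emeasure (p x) B = emeasure (p x) (A \<inter> B)"
      using A(2)[OF that] by (intro emeasure_eq_AE) (auto simp: AE_measure_pmf_iff)
    also have "\<dots> = ennreal (\<Sum>y\<in>A \<inter> B. pmf (p x) y)"
      using A(1) by (subst emeasure_measure_pmf_finite) auto
    finally show ?thesis .
  qed
  ultimately show "(\<lambda>x. emeasure (p x) B) \<in> borel_measurable M"
    by (simp cong: measurable_cong)
qed (auto intro: measure_pmf.subprob_space_axioms)

lemma opt_prefix_less: "valid_mdp m \<Longrightarrow> opt_prefix m \<theta> h i s < nA m"
  by (induction h arbitrary: i s) (auto simp: greedy_less nA_pos valid_mdp_def)

lemma state_prob_out:
  assumes "valid_mdp m" "\<theta> \<in> kernels m" "\<pi> \<in> policies m" "nS m \<le> s"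
  shows "state_prob m \<theta> \<pi> h s = 0"
proof -
  have "set_pmf (traj_law m \<theta> \<pi>) \<inter> {\<tau>. state_at h \<tau> = s} = {}"
    using set_traj_law[OF assms(1-3)] state_at_trajs[of _ m h] assms(4) by fastforce
  then show ?thesis unfolding state_prob_def by (simp add: measure_pmf_zero_iff)
qed

section \<open>Measurability of values, policies and trajectory laws in the parameter\<close>

locale prior_mdp =
  fixes m :: mdp and \<Theta> :: "kernel set" and \<mu> :: "kernel measure"
  assumes valid: "valid_mdp m" and prior: "is_prior m \<Theta> \<mu>"
begin

lemma kernels: "\<Theta> \<subseteq> kernels m"
  using prior by (simp add: is_prior_def)

lemma prob_prior: "prob_space \<mu>"
  using prior by (simp add: is_prior_def)

sublocale prob_space \<mu> by (rule prob_prior)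

lemma sets_prior: "sets \<mu> = sets (kernel_space m \<Theta>)"
  using prior by (simp add: is_prior_def)

lemma space_prior: "space \<mu> = \<Theta>"
  using sets_eq_imp_space_eq[OF sets_prior] by (simp add: kernel_space_def Let_def)

lemma in_kernels: "\<theta> \<in> space \<mu> \<Longrightarrow> \<theta> \<in> kernels m"
  using kernels space_prior by auto

text \<open>The sigma-algebra of the prior is generated by exactly these coordinates. A successor
  outside the state space is no coordinate, but has probability zero under every parameter of the
  space.\<close>

lemma measurable_pmf_kernel:
  assumes "h < hor m" "s < nS m" "a < nA m"
  shows "(\<lambda>\<theta>. pmf (\<theta> h s a) s') \<in> borel_measurable \<mu>"
proof (cases "s' < nS m")
  case True
  let ?I = "{..<hor m} \<times> {..<nS m} \<times> {..<nA m} \<times> {..<nS m}"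
  let ?F = "\<lambda>\<theta>. \<lambda>(h, s, a, s')\<in>?I. pmf (\<theta> h s a) s'"
  have "?F \<in> \<mu> \<rightarrow>\<^sub>M (\<Pi>\<^sub>M i\<in>?I. borel)"
    unfolding measurable_cong_sets[OF sets_prior refl] kernel_space_def Let_def
    by (rule measurable_vimage_algebra1) (auto simp: space_PiM)
  from measurable_compose[OF this measurable_component_singleton[of "(h, s, a, s')"]]
  show ?thesis using assms True by simp
next
  case False
  have "pmf (\<theta> h s a) s' = 0" if "\<theta> \<in> space \<mu>" for \<theta>
  proof -
    have "set_pmf (\<theta> h s a) \<subseteq> {..<nS m}" using in_kernels[OF that] assms unfolding kernels_def by blast
    then show ?thesis using False by (auto simp: pmf_eq_0_set_pmf)
  qed
  then show ?thesis by (simp cong: measurable_cong)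
qed

lemma measurable_V: "s < nS m \<Longrightarrow> (\<lambda>\<theta>. V m \<theta> h s) \<in> borel_measurable \<mu>"
proof (induction "hor m - h" arbitrary: h s)
  case 0
  then show ?case by (simp add: V_terminal)
next
  case (Suc k)
  then have h: "h < hor m" and k: "k = hor m - Suc h" by auto
  have [measurable]: "(\<lambda>\<theta>. V m \<theta> (Suc h) s') \<in> borel_measurable \<mu>" if "s' < nS m" for s'
    using Suc.hyps(1)[OF k that] by simp
  note [measurable] = measurable_pmf_kernel
  have "(\<lambda>\<theta>. Q m \<theta> h s a) \<in> borel_measurable \<mu>" if "a < nA m" for a
    unfolding Q_def using h Suc.prems that
    by (intro borel_measurable_add borel_measurable_sum borel_measurable_times measurable_pmf_kernel) auto
  then show ?case
    unfolding V_eq_Max[OF h] by (intro borel_measurable_Max) auto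
qed

lemma measurable_Q:
  assumes "h < hor m" "s < nS m" "a < nA m"
  shows "(\<lambda>\<theta>. Q m \<theta> h s a) \<in> borel_measurable \<mu>"
  unfolding Q_def using assms
  by (intro borel_measurable_add borel_measurable_sum borel_measurable_times measurable_pmf_kernel measurable_V) auto

lemma measurable_greedy:
  assumes h: "h < hor m" and s: "s < nS m"
  shows "(\<lambda>\<theta>. greedy m \<theta> h s) \<in> \<mu> \<rightarrow>\<^sub>M count_space UNIV"
  unfolding greedy_def
proof (rule measurable_Least)
  fix a
  show "(\<lambda>\<theta>. a < nA m \<and> (\<forall>b<nA m. Q m \<theta> h s b \<le> Q m \<theta> h s a)) \<in> \<mu> \<rightarrow>\<^sub>M count_space UNIV"
  proof (cases "a < nA m")
    case True
    have "(\<lambda>\<theta>. \<forall>b\<in>{..<nA m}. Q m \<theta> h s b \<le> Q m \<theta> h s a) \<in> \<mu> \<rightarrow>\<^sub>M count_space UNIV"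
    proof (intro pred_intros_finite)
      fix b assume "b \<in> {..<nA m}"
      with True have [measurable]: "(\<lambda>\<theta>. Q m \<theta> h s b) \<in> borel_measurable \<mu>"
        "(\<lambda>\<theta>. Q m \<theta> h s a) \<in> borel_measurable \<mu>"
        using h s by (auto intro: measurable_Q)
      show "(\<lambda>\<theta>. Q m \<theta> h s b \<le> Q m \<theta> h s a) \<in> \<mu> \<rightarrow>\<^sub>M count_space UNIV"
        unfolding pred_def by (rule borel_measurable_le) fact+
    qed simp
    moreover have "(\<lambda>\<theta>. a < nA m \<and> (\<forall>b<nA m. Q m \<theta> h s b \<le> Q m \<theta> h s a))
      = (\<lambda>\<theta>. \<forall>b\<in>{..<nA m}. Q m \<theta> h s b \<le> Q m \<theta> h s a)"
      using True by auto
    ultimately show ?thesis by (simp only:)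
  qed simp
qed

lemma pmf_measurable_expert:
  assumes "h < hor m" "s < nS m"
  shows "pmf_measurable \<mu> (\<lambda>\<theta>. expert m \<beta> \<theta> h s)"
  unfolding pmf_measurable_def
proof
  fix a
  have "(\<lambda>\<theta>. exp (\<beta> * Q m \<theta> h s a) / (\<Sum>b<nA m. exp (\<beta> * Q m \<theta> h s b))) \<in> borel_measurable \<mu>" if "a < nA m"
    using assms that measurable_Q
    by (intro borel_measurable_divide borel_measurable_sum measurable_compose[OF _ borel_measurable_exp] borel_measurable_times) auto
  then show "(\<lambda>\<theta>. pmf (expert m \<beta> \<theta> h s) a) \<in> borel_measurable \<mu>"
    by (cases "a < nA m") (simp_all add: pmf_expert[OF nA_pos[OF valid]])
qed

text \<open>Kernel and policy are both functions of a point of an arbitrary space \<open>M\<close>.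
  This covers a policy computed from the kernel itself as well as one computed from a second,
  sampled kernel.\<close>

lemma pmf_measurable_rollout:
  assumes X: "X \<in> M \<rightarrow>\<^sub>M \<mu>" and \<pi>: "\<And>x. x \<in> space M \<Longrightarrow> \<pi> x \<in> policies m"
    and \<pi>': "\<And>h s. h < hor m \<Longrightarrow> s < nS m \<Longrightarrow> pmf_measurable M (\<lambda>x. \<pi> x h s)"
  shows "h + k \<le> hor m \<Longrightarrow> s < nS m \<Longrightarrow> pmf_measurable M (\<lambda>x. rollout (X x) (\<pi> x) k h s)"
proof (induction k arbitrary: h s)
  case 0
  then show ?case by (simp add: pmf_measurable_const)
next
  case (Suc k)
  then have h: "h < hor m" and s: "s < nS m" by auto
  have Xk: "X x \<in> kernels m" if "x \<in> space M" for x
    using measurable_space[OF X that] in_kernels by auto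
  let ?T = "{xs. set xs \<subseteq> {..<nS m} \<times> {..<nA m} \<and> length xs = k} \<times> {..<nS m}"
  have fin: "finite ?T" by (intro finite_cartesian_product finite_lists_length_eq) auto
  have 1: "pmf_measurable M (\<lambda>x. bind_pmf (rollout (X x) (\<pi> x) k (Suc h) s') (\<lambda>\<tau>. return_pmf ((s, a) # fst \<tau>, snd \<tau>)))"
    if s': "s' < nS m" for s' a
    using Suc.IH[of "Suc h" s'] Suc.prems s' set_rollout[OF Xk \<pi>, of _ _ "Suc h" k s']
    by (intro pmf_measurable_bind[OF fin] pmf_measurable_const) auto
  have 2: "pmf_measurable M (\<lambda>x. bind_pmf (X x h s a) (\<lambda>s'. bind_pmf (rollout (X x) (\<pi> x) k (Suc h) s') (\<lambda>\<tau>. return_pmf ((s, a) # fst \<tau>, snd \<tau>))))"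
    if a: "a < nA m" for a
  proof (rule pmf_measurable_bind[where A = "{..<nS m}"])
    show "set_pmf (X x h s a) \<subseteq> {..<nS m}" if "x \<in> space M" for x
      using Xk[OF that] h s a unfolding kernels_def by blast
    show "pmf_measurable M (\<lambda>x. X x h s a)"
      unfolding pmf_measurable_def
      using measurable_compose[OF X measurable_pmf_kernel[OF h s a]] by simp
  qed (use 1 in auto)
  show ?case
    unfolding rollout.simps
  proof (rule pmf_measurable_bind[where A = "{..<nA m}"])
    show "set_pmf (\<pi> x h s) \<subseteq> {..<nA m}" if "x \<in> space M" for x
      using \<pi>[OF that] h s unfolding policies_def by blast
  qed (use 2 \<pi>'[OF h s] in auto)
qed

lemma pmf_measurable_traj_law:
  assumes X: "X \<in> M \<rightarrow>\<^sub>M \<mu>" and \<pi>: "\<And>x. x \<in> space M \<Longrightarrow> \<pi> x \<in> policies m"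
    and \<pi>': "\<And>h s. h < hor m \<Longrightarrow> s < nS m \<Longrightarrow> pmf_measurable M (\<lambda>x. \<pi> x h s)"
  shows "pmf_measurable M (\<lambda>x. traj_law m (X x) (\<pi> x))"
  unfolding traj_law_def
  using valid pmf_measurable_rollout[OF X \<pi> \<pi>', where h = 0 and k = "hor m"]
  by (intro pmf_measurable_bind[where A = "{..<nS m}"] pmf_measurable_const) (auto simp: valid_mdp_def)

text \<open>The reachability test at period \<open>h\<close> involves only the trajectory law under
  the prefix, measurable by induction; beyond the state space it always fails, and the action is
  constant there.\<close>

lemma measurable_opt_prefix: "h \<le> hor m \<Longrightarrow> (\<lambda>\<theta>. opt_prefix m \<theta> h i s) \<in> \<mu> \<rightarrow>\<^sub>M count_space UNIV"
proof (induction h arbitrary: i s)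
    case (Suc h)
    show ?case
    proof (cases "i = h")
      case i: True
      let ?\<pi> = "\<lambda>\<theta>. det (opt_prefix m \<theta> h)"
      have \<pi>: "?\<pi> \<theta> \<in> policies m" for \<theta>
        by (intro det_policies opt_prefix_less valid)
      show ?thesis
      proof (cases "s < nS m")
        case s: True
        have pm: "pmf_measurable \<mu> (\<lambda>\<theta>. traj_law m \<theta> (?\<pi> \<theta>))"
          using Suc \<pi> by (intro pmf_measurable_traj_law measurable_ident) (auto simp: det_def intro!: pmf_measurable_return)
        have "(\<lambda>\<theta>. \<Sum>\<tau>\<in>trajs m \<inter> {\<tau>. state_at h \<tau> = s}. pmf (traj_law m \<theta> (?\<pi> \<theta>)) \<tau>) \<in> borel_measurable \<mu>"
          using pmf_measurableD[OF pm] by measurable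
        moreover have "state_prob m \<theta> (?\<pi> \<theta>) h s = (\<Sum>\<tau>\<in>trajs m \<inter> {\<tau>. state_at h \<tau> = s}. pmf (traj_law m \<theta> (?\<pi> \<theta>)) \<tau>)"
          if "\<theta> \<in> space \<mu>" for \<theta>
        proof -
          have "state_prob m \<theta> (?\<pi> \<theta>) h s = measure_pmf.prob (traj_law m \<theta> (?\<pi> \<theta>)) (trajs m \<inter> {\<tau>. state_at h \<tau> = s})"
            unfolding state_prob_def using set_traj_law[OF valid in_kernels[OF that] \<pi>, of \<theta>]
            by (intro measure_pmf.finite_measure_eq_AE) (auto simp: AE_measure_pmf_iff)
          then show ?thesis by (simp add: measure_measure_pmf_finite finite_trajs)
        qed
        ultimately have [measurable]: "(\<lambda>\<theta>. state_prob m \<theta> (?\<pi> \<theta>) h s) \<in> borel_measurable \<mu>"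
          by (simp cong: measurable_cong)
        have [measurable]: "(\<lambda>\<theta>. greedy m \<theta> h s) \<in> \<mu> \<rightarrow>\<^sub>M count_space UNIV"
          using Suc.prems s by (intro measurable_greedy) auto
        show ?thesis by (simp add: i)
      next
        case False
        then have "state_prob m \<theta> (?\<pi> \<theta>) h s = 0" if "\<theta> \<in> space \<mu>" for \<theta>
          using state_prob_out[OF valid in_kernels[OF that] \<pi>] by auto
        then have "opt_prefix m \<theta> (Suc h) i s = act0 m" if "\<theta> \<in> space \<mu>" for \<theta>
          using that by (simp add: i)
        then show ?thesis by (simp cong: measurable_cong)
      qed
    next
      case False
      then show ?thesis using Suc by simp
    qed
qed simp


section \<open>The joint law of parameter and data\<close>

abbreviation joint :: "(kernel \<times> data) measure" where
  "joint \<equiv> \<mu> \<Otimes>\<^sub>M count_space UNIV"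

text \<open>The data form a countable type with the discrete sigma-algebra, so measurability need
  only be checked for each fixed value of the data.\<close>

lemma measurable_joint:
  assumes "\<And>d. (\<lambda>\<theta>. f (\<theta>, d)) \<in> \<mu> \<rightarrow>\<^sub>M N"
  shows "f \<in> joint \<rightarrow>\<^sub>M N"
proof -
  have "(\<lambda>(d, \<theta>). f (\<theta>, d)) \<in> count_space UNIV \<Otimes>\<^sub>M \<mu> \<rightarrow>\<^sub>M N"
    by (rule measurable_pair_measure_countable1) (use assms in auto)
  from measurable_compose[OF measurable_pair_swap' this] show ?thesis
    by (simp add: split_beta')
qed

lemma measurable_joint_section: "f \<in> joint \<rightarrow>\<^sub>M N \<Longrightarrow> (\<lambda>\<theta>. f (\<theta>, d)) \<in> \<mu> \<rightarrow>\<^sub>M N"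
  by (rule measurable_compose[OF measurable_Pair2']) auto

section \<open>Transition kernels of the algorithm and integrals of its joint law\<close>

lemma pmf_measurable_opt_traj:
  assumes X: "X \<in> M \<rightarrow>\<^sub>M \<mu>" and Y: "Y \<in> M \<rightarrow>\<^sub>M \<mu>"
  shows "pmf_measurable M (\<lambda>x. traj_law m (X x) (opt_policy m (Y x)))"
  unfolding opt_policy_eq
  using measurable_compose[OF Y measurable_opt_prefix[OF order_refl]] opt_policy_in[OF valid]
  by (intro pmf_measurable_traj_law[OF X]) (auto simp: det_def intro!: pmf_measurable_return)

lemma set_opt_traj: "\<theta> \<in> space \<mu> \<Longrightarrow> set_pmf (traj_law m \<theta> (opt_policy m \<theta>')) \<subseteq> trajs m"
  unfolding opt_policy_eq by (intro set_traj_law valid in_kernels opt_policy_in)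

lemma measurable_opt_traj:
  assumes X: "X \<in> M \<rightarrow>\<^sub>M \<mu>" and Y: "Y \<in> M \<rightarrow>\<^sub>M \<mu>"
  shows "(\<lambda>x. measure_pmf (traj_law m (X x) (opt_policy m (Y x)))) \<in> M \<rightarrow>\<^sub>M subprob_algebra (count_space UNIV)"
  using set_opt_traj[OF measurable_space[OF X]]
  by (intro measurable_measure_pmf_finite[OF finite_trajs] pmf_measurable_opt_traj[OF X Y]) auto

lemma measurable_offline:
  "(\<lambda>\<theta>. measure_pmf (replicate_pmf L (traj_law m \<theta> (expert m \<beta> \<theta>)))) \<in> \<mu> \<rightarrow>\<^sub>M subprob_algebra (count_space UNIV)"
proof (rule measurable_measure_pmf_finite[where A = "{D. set D \<subseteq> trajs m \<and> length D = L}"])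
  show "finite {D. set D \<subseteq> trajs m \<and> length D = L}"
    by (rule finite_lists_length_eq[OF finite_trajs])
  have set: "set_pmf (traj_law m \<theta> (expert m \<beta> \<theta>)) \<subseteq> trajs m" if "\<theta> \<in> space \<mu>" for \<theta>
    by (intro set_traj_law valid in_kernels that expert_policies)
  show "set_pmf (replicate_pmf L (traj_law m \<theta> (expert m \<beta> \<theta>))) \<subseteq> {D. set D \<subseteq> trajs m \<and> length D = L}"
    if "\<theta> \<in> space \<mu>" for \<theta>
    using set[OF that] by (auto simp: set_replicate_pmf)
  show "pmf_measurable \<mu> (\<lambda>\<theta>. replicate_pmf L (traj_law m \<theta> (expert m \<beta> \<theta>)))"
    by (intro pmf_measurable_replicate[OF finite_trajs set] pmf_measurable_traj_law
        measurable_ident_sets refl expert_policies valid pmf_measurable_expert)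
qed

lemma kernel_offline:
  "(\<lambda>\<theta>. measure_pmf (replicate_pmf L (traj_law m \<theta> (expert m \<beta> \<theta>))) \<bind> (\<lambda>D. return joint (\<theta>, D, [])))
    \<in> \<mu> \<rightarrow>\<^sub>M subprob_algebra joint"
proof (rule measurable_bind'[OF measurable_offline])
  have "(\<lambda>x. (fst x, (snd x, []))) \<in> \<mu> \<Otimes>\<^sub>M count_space UNIV \<rightarrow>\<^sub>M joint"
    by (intro measurable_Pair measurable_fst measurable_compose[OF measurable_snd measurable_count_space])
  from measurable_compose[OF this return_measurable]
  show "(\<lambda>(\<theta>, D). return joint (\<theta>, D, [])) \<in> \<mu> \<Otimes>\<^sub>M count_space UNIV \<rightarrow>\<^sub>M subprob_algebra joint"
    by (simp add: split_beta')
qed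

lemma not_empty_joint: "space joint \<noteq> {}"
  using not_empty by (simp add: space_pair_measure)

text \<open>Only a subprobability: conditioning on data of probability zero amounts to division 0 /
  0 = 0 and gives the null measure.\<close>

lemma posterior_in:
  assumes J: "J \<in> space (subprob_algebra joint)"
  shows "posterior \<mu> J d \<in> space (subprob_algebra \<mu>)"
proof -
  have sets [measurable_cong]: "sets J = sets joint" and sub: "subprob_space J"
    using J by (auto simp: space_subprob_algebra)
  interpret subprob_space J by (rule sub)
  let ?U = "uniform_measure J {x \<in> space J. snd x = d}"
  have B: "{x \<in> space J. snd x = d} \<in> sets J" by measurable
  have "subprob_space ?U"
  proof (rule subprob_spaceI)
    let ?c = "emeasure J {x \<in> space J. snd x = d}"
    have "?c < top" by (rule order_le_less_trans[OF subprob_emeasure_le_1 ennreal_one_less_top])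
    have "emeasure ?U (space ?U) = ?c / ?c"
      using B by (simp add: Int_absorb2 sets.sets_into_space)
    also have "\<dots> \<le> 1"
      using \<open>?c < top\<close> by (cases "?c = 0") simp_all
    finally show "emeasure ?U (space ?U) \<le> 1" .
    show "space ?U \<noteq> {}" using subprob_not_empty by simp
  qed
  then interpret U: subprob_space ?U .
  have "fst \<in> ?U \<rightarrow>\<^sub>M \<mu>" by measurable
  then show ?thesis
    unfolding posterior_def space_subprob_algebra
    using U.subprob_space_distr[of fst \<mu>] not_empty by simp
qed

lemma measurable_posterior:
  assumes J: "J \<in> space (subprob_algebra joint)"
  shows "(\<lambda>x. posterior \<mu> J (snd x)) \<in> joint \<rightarrow>\<^sub>M subprob_algebra \<mu>"
  using posterior_in[OF J] by (intro measurable_compose[OF measurable_snd]) (simp add: measurable_count_space_eq1)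

lemma kernel_online_inner:
  "(\<lambda>(x, \<theta>'). measure_pmf (traj_law m (fst x) (opt_policy m \<theta>')) \<bind> (\<lambda>\<tau>. return joint (fst x, fst (snd x), snd (snd x) @ [\<tau>])))
    \<in> joint \<Otimes>\<^sub>M \<mu> \<rightarrow>\<^sub>M subprob_algebra joint"
proof -
  let ?F = "\<lambda>y. (fst (fst (fst y)), (fst (snd (fst (fst y))), snd (snd (fst (fst y))) @ [snd y]))"
  have "(\<lambda>y. measure_pmf (traj_law m (fst (fst y)) (opt_policy m (snd y))) \<bind> (\<lambda>\<tau>. return joint (?F (y, \<tau>))))
    \<in> joint \<Otimes>\<^sub>M \<mu> \<rightarrow>\<^sub>M subprob_algebra joint"
  proof (rule measurable_bind'[OF measurable_opt_traj])
    \<comment> \<open>Appending an episode is a map between countable discrete spaces; it is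
      measurable once their product sigma-algebra is recognised as the discrete one.\<close>
    have m1: "(\<lambda>(d :: data, \<tau>). (fst d, snd d @ [\<tau>])) \<in> count_space UNIV \<Otimes>\<^sub>M count_space UNIV \<rightarrow>\<^sub>M count_space UNIV"
      by (simp add: pair_measure_countable)
    have m2: "(\<lambda>y. (snd (fst (fst y)), snd y)) \<in> (joint \<Otimes>\<^sub>M \<mu>) \<Otimes>\<^sub>M count_space (UNIV :: traj set)
      \<rightarrow>\<^sub>M count_space UNIV \<Otimes>\<^sub>M count_space UNIV"
      by measurable
    from measurable_compose[OF m2 m1] have "?F \<in> (joint \<Otimes>\<^sub>M \<mu>) \<Otimes>\<^sub>M count_space UNIV \<rightarrow>\<^sub>M joint"
      by (intro measurable_Pair) (auto simp: split_beta')
    from measurable_compose[OF this return_measurable]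
    show "(\<lambda>(y, \<tau>). return joint (?F (y, \<tau>))) \<in> (joint \<Otimes>\<^sub>M \<mu>) \<Otimes>\<^sub>M count_space UNIV \<rightarrow>\<^sub>M subprob_algebra joint"
      by (simp add: split_beta')
  qed measurable
  then show ?thesis by (simp add: split_beta')
qed

lemma kernel_online:
  assumes J: "J \<in> space (subprob_algebra joint)"
  shows "(\<lambda>x. posterior \<mu> J (snd x) \<bind> (\<lambda>\<theta>'. measure_pmf (traj_law m (fst x) (opt_policy m \<theta>')) \<bind>
      (\<lambda>\<tau>. return joint (fst x, fst (snd x), snd (snd x) @ [\<tau>])))) \<in> joint \<rightarrow>\<^sub>M subprob_algebra joint"
  by (rule measurable_bind'[OF measurable_posterior[OF J] kernel_online_inner])

lemma ipsrl_Suc_eq: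
  "ipsrl m \<mu> \<beta> L (Suc t) = ipsrl m \<mu> \<beta> L t \<bind> (\<lambda>x. posterior \<mu> (ipsrl m \<mu> \<beta> L t) (snd x) \<bind>
     (\<lambda>\<theta>'. measure_pmf (traj_law m (fst x) (opt_policy m \<theta>')) \<bind>
      (\<lambda>\<tau>. return joint (fst x, fst (snd x), snd (snd x) @ [\<tau>]))))"
  by (simp add: split_beta')

text \<open>Enough for binding and for the integral recursions. Total mass one is postponed, since
  it requires the posterior to have mass one at all data of positive probability, which is used
  through the disintegration.\<close>

lemma ipsrl_in: "ipsrl m \<mu> \<beta> L t \<in> space (subprob_algebra joint)"
proof (induction t)
  case 0
  show ?case
    unfolding ipsrl.simps space_subprob_algebra mem_Collect_eq
    by (intro conjI subprob_space_bind[OF _ kernel_offline] sets_bind sets_kernel[OF kernel_offline])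
       (use not_empty in \<open>auto intro: prob_space_imp_subprob_space prob_prior\<close>)
next
  case (Suc t)
  then have "subprob_space (ipsrl m \<mu> \<beta> L t)" "sets (ipsrl m \<mu> \<beta> L t) = sets joint"
    by (auto simp: space_subprob_algebra)
  moreover from this(2) have "space (ipsrl m \<mu> \<beta> L t) = space joint" by (rule sets_eq_imp_space_eq)
  ultimately show ?case
    unfolding ipsrl_Suc_eq space_subprob_algebra mem_Collect_eq
    using kernel_online[OF Suc] not_empty_joint
    by (intro conjI subprob_space_bind[where N = joint] sets_bind sets_kernel[OF kernel_online[OF Suc]])
       (auto cong: measurable_cong_sets)
qed

lemma sets_ipsrl [measurable_cong]: "sets (ipsrl m \<mu> \<beta> L t) = sets joint"
  using ipsrl_in by (auto simp: space_subprob_algebra)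

lemma space_ipsrl: "space (ipsrl m \<mu> \<beta> L t) = space joint"
  by (rule sets_eq_imp_space_eq[OF sets_ipsrl])

lemma sets_posterior_ipsrl [measurable_cong]: "sets (posterior \<mu> J d) = sets \<mu>"
  by (simp add: posterior_def)

lemma nn_integral_ipsrl_0:
  assumes f: "f \<in> borel_measurable joint"
  shows "(\<integral>\<^sup>+x. f x \<partial>ipsrl m \<mu> \<beta> L 0)
    = (\<integral>\<^sup>+\<theta>. \<integral>\<^sup>+D. f (\<theta>, D, []) \<partial>measure_pmf (replicate_pmf L (traj_law m \<theta> (expert m \<beta> \<theta>))) \<partial>\<mu>)"
proof -
  have "(\<integral>\<^sup>+x. f x \<partial>ipsrl m \<mu> \<beta> L 0) = (\<integral>\<^sup>+\<theta>. \<integral>\<^sup>+x. f x \<partial>(measure_pmf (replicate_pmf L (traj_law m \<theta> (expert m \<beta> \<theta>)))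
     \<bind> (\<lambda>D. return joint (\<theta>, D, []))) \<partial>\<mu>)"
    unfolding ipsrl.simps by (rule nn_integral_bind[OF f kernel_offline])
  also have "\<dots> = (\<integral>\<^sup>+\<theta>. \<integral>\<^sup>+D. f (\<theta>, D, []) \<partial>measure_pmf (replicate_pmf L (traj_law m \<theta> (expert m \<beta> \<theta>))) \<partial>\<mu>)"
  proof (rule nn_integral_cong)
    fix \<theta> assume \<theta>: "\<theta> \<in> space \<mu>"
    let ?R = "measure_pmf (replicate_pmf L (traj_law m \<theta> (expert m \<beta> \<theta>)))"
    have r: "(\<lambda>D. return joint (\<theta>, D, [])) \<in> ?R \<rightarrow>\<^sub>M subprob_algebra joint"
      using \<theta> prob_space_return[of _ joint]
      by (auto simp: space_subprob_algebra space_pair_measure intro!: prob_space_imp_subprob_space)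
    show "(\<integral>\<^sup>+x. f x \<partial>(?R \<bind> (\<lambda>D. return joint (\<theta>, D, [])))) = (\<integral>\<^sup>+D. f (\<theta>, D, []) \<partial>?R)"
      unfolding nn_integral_bind[OF f r]
      using \<theta> f by (intro nn_integral_cong nn_integral_return) (auto simp: space_pair_measure)
  qed
  finally show ?thesis .
qed

lemma nn_integral_ipsrl_Suc:
  assumes f: "f \<in> borel_measurable joint"
  shows "(\<integral>\<^sup>+x. f x \<partial>ipsrl m \<mu> \<beta> L (Suc t)) =
    (\<integral>\<^sup>+x. \<integral>\<^sup>+\<theta>'. \<integral>\<^sup>+\<tau>. f (fst x, fst (snd x), snd (snd x) @ [\<tau>]) \<partial>measure_pmf (traj_law m (fst x) (opt_policy m \<theta>'))
      \<partial>posterior \<mu> (ipsrl m \<mu> \<beta> L t) (snd x) \<partial>ipsrl m \<mu> \<beta> L t)"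
proof -
  let ?J = "ipsrl m \<mu> \<beta> L t"
  have k: "(\<lambda>x. posterior \<mu> ?J (snd x) \<bind> (\<lambda>\<theta>'. measure_pmf (traj_law m (fst x) (opt_policy m \<theta>')) \<bind>
      (\<lambda>\<tau>. return joint (fst x, fst (snd x), snd (snd x) @ [\<tau>])))) \<in> ?J \<rightarrow>\<^sub>M subprob_algebra joint"
    using kernel_online[OF ipsrl_in[of \<beta> L t]] by (simp cong: measurable_cong_sets add: sets_ipsrl)
  show ?thesis
    unfolding ipsrl_Suc_eq nn_integral_bind[OF f k]
  proof (rule nn_integral_cong)
    fix x assume x: "x \<in> space ?J"
    then have x': "x \<in> space joint" by (simp add: space_ipsrl)
    then have \<theta>: "fst x \<in> space \<mu>" by (auto simp: space_pair_measure)
    have r: "(\<lambda>\<tau>. return joint (fst x, fst (snd x), snd (snd x) @ [\<tau>])) \<in> measure_pmf p \<rightarrow>\<^sub>M subprob_algebra joint" for p :: "traj pmf"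
      using \<theta> prob_space_return[of _ joint]
      by (auto simp: space_subprob_algebra space_pair_measure intro!: prob_space_imp_subprob_space)
    have k': "(\<lambda>\<theta>'. measure_pmf (traj_law m (fst x) (opt_policy m \<theta>')) \<bind> (\<lambda>\<tau>. return joint (fst x, fst (snd x), snd (snd x) @ [\<tau>])))
      \<in> posterior \<mu> ?J (snd x) \<rightarrow>\<^sub>M subprob_algebra joint"
      using measurable_compose[OF measurable_Pair1'[OF x'] kernel_online_inner] by (simp cong: measurable_cong_sets add: sets_posterior_ipsrl)
    show "(\<integral>\<^sup>+y. f y \<partial>(posterior \<mu> ?J (snd x) \<bind> (\<lambda>\<theta>'. measure_pmf (traj_law m (fst x) (opt_policy m \<theta>')) \<bind>
      (\<lambda>\<tau>. return joint (fst x, fst (snd x), snd (snd x) @ [\<tau>]))))) = (\<integral>\<^sup>+\<theta>'. \<integral>\<^sup>+\<tau>. f (fst x, fst (snd x), snd (snd x) @ [\<tau>]) \<partial>measure_pmf (traj_law m (fst x) (opt_policy m \<theta>'))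
      \<partial>posterior \<mu> ?J (snd x))"
      unfolding nn_integral_bind[OF f k'] nn_integral_bind[OF f r]
      using \<theta> f by (intro nn_integral_cong nn_integral_return) (auto simp: space_pair_measure)
  qed
qed

section \<open>Disintegration over the data and exchangeability\<close>

text \<open>The data are discrete, so the joint law is the mixture of its conditional laws.\<close>

lemma nn_integral_disintegrate:
  assumes J: "J \<in> space (subprob_algebra joint)" and f: "f \<in> borel_measurable joint"
  shows "(\<integral>\<^sup>+x. f x \<partial>J) = (\<integral>\<^sup>+d. emeasure J {x \<in> space J. snd x = d} * (\<integral>\<^sup>+\<theta>. f (\<theta>, d) \<partial>posterior \<mu> J d) \<partial>count_space UNIV)"
proof -
  have sets [measurable_cong]: "sets J = sets joint" and sub: "subprob_space J"
    using J by (auto simp: space_subprob_algebra)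
  interpret subprob_space J by (rule sub)
  define B where "B d = {x \<in> space J. snd x = d}" for d
  have [measurable]: "B d \<in> sets J" for d unfolding B_def by measurable
  have [measurable]: "f \<in> borel_measurable J" using f by measurable
  have *: "(\<lambda>\<theta>. f (\<theta>, d)) \<in> borel_measurable \<mu>" for d by (rule measurable_joint_section[OF f])
  have [measurable]: "(\<lambda>x. f (fst x, d)) \<in> borel_measurable J" for d
    using measurable_compose[OF measurable_fst *] by (simp cong: measurable_cong_sets add: sets)
  have "(\<integral>\<^sup>+x. f x \<partial>J) = (\<integral>\<^sup>+x. \<integral>\<^sup>+d. f (fst x, d) * indicator (B d) x \<partial>count_space UNIV \<partial>J)"
  proof (rule nn_integral_cong)
    fix x assume "x \<in> space J"
    then have "(\<lambda>d. f (fst x, d) * indicator (B d) x) = (\<lambda>d. f x * indicator {snd x} d)"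
      by (auto simp: B_def fun_eq_iff split: split_indicator)
    then show "f x = (\<integral>\<^sup>+d. f (fst x, d) * indicator (B d) x \<partial>count_space UNIV)"
      by (simp add: nn_integral_cmult_indicator)
  qed
  also have "\<dots> = (\<integral>\<^sup>+d. \<integral>\<^sup>+x. f (fst x, d) * indicator (B d) x \<partial>J \<partial>count_space UNIV)"
    by (rule nn_integral_count_space_nn_integral) auto
  also have "\<dots> = (\<integral>\<^sup>+d. emeasure J (B d) * (\<integral>\<^sup>+\<theta>. f (\<theta>, d) \<partial>posterior \<mu> J d) \<partial>count_space UNIV)"
  proof (rule nn_integral_cong)
    fix d
    show "(\<integral>\<^sup>+x. f (fst x, d) * indicator (B d) x \<partial>J) = emeasure J (B d) * (\<integral>\<^sup>+\<theta>. f (\<theta>, d) \<partial>posterior \<mu> J d)"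
    \<comment> \<open>Division by the mass of the data is legitimate only when it is nonzero;
      otherwise both sides vanish because the event is null.\<close>
    proof (cases "emeasure J (B d) = 0")
      case True
      then have "B d \<in> null_sets J" by auto
      then have "(\<integral>\<^sup>+x. f (fst x, d) * indicator (B d) x \<partial>J) = 0"
        by (rule nn_integral_null_set)
      then show ?thesis using True by simp
    next
      case False
      have "fst \<in> uniform_measure J (B d) \<rightarrow>\<^sub>M \<mu>" by measurable
      then have "(\<integral>\<^sup>+\<theta>. f (\<theta>, d) \<partial>posterior \<mu> J d) = (\<integral>\<^sup>+x. f (fst x, d) * indicator (B d) x \<partial>J) / emeasure J (B d)"
        unfolding posterior_def B_def[symmetric] using *
        by (subst nn_integral_distr) (auto simp: nn_integral_uniform_measure)
      moreover have "emeasure J (B d) * (x / emeasure J (B d)) = x" for x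
        using mult_divide_eq_ennreal[of "emeasure J (B d)" x] False emeasure_finite[of "B d"]
        by (simp add: ennreal_times_divide mult.commute)
      ultimately show ?thesis by simp
    qed
  qed
  finally show ?thesis by (simp add: B_def)
qed

lemma posterior_total:
  assumes J: "J \<in> space (subprob_algebra joint)" and d: "emeasure J {x \<in> space J. snd x = d} \<noteq> 0"
  shows "emeasure (posterior \<mu> J d) (space \<mu>) = 1"
proof -
  have sets [measurable_cong]: "sets J = sets joint" and sub: "subprob_space J"
    using J by (auto simp: space_subprob_algebra)
  interpret subprob_space J by (rule sub)
  let ?B = "{x \<in> space J. snd x = d}"
  have [measurable]: "?B \<in> sets J" by measurable
  have f: "fst \<in> uniform_measure J ?B \<rightarrow>\<^sub>M \<mu>" by measurable
  have "fst -` space \<mu> \<inter> space J = space J"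
    using sets_eq_imp_space_eq[OF sets] by (auto simp: space_pair_measure)
  moreover have "emeasure J ?B < top"
    by (rule order_le_less_trans[OF subprob_emeasure_le_1 ennreal_one_less_top])
  ultimately show ?thesis
    unfolding posterior_def using f d by (simp add: emeasure_distr Int_absorb2)
qed

lemma measurable_posterior_nn_integral:
  assumes J: "J \<in> space (subprob_algebra joint)"
    and G: "\<And>d. (\<lambda>(\<theta>, \<theta>'). G \<theta> \<theta>' d) \<in> borel_measurable (\<mu> \<Otimes>\<^sub>M \<mu>)"
  shows "(\<lambda>x. \<integral>\<^sup>+\<theta>'. G (fst x) \<theta>' (snd x) \<partial>posterior \<mu> J (snd x)) \<in> borel_measurable joint"
proof (rule measurable_joint)
  fix d
  note sub = posterior_in[OF J, unfolded space_subprob_algebra mem_Collect_eq]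
  interpret subprob_space "posterior \<mu> J d" using sub by simp
  have "(\<lambda>(\<theta>, \<theta>'). G \<theta> \<theta>' d) \<in> borel_measurable (\<mu> \<Otimes>\<^sub>M posterior \<mu> J d)"
    using G[of d] by (simp cong: measurable_cong_sets sets_pair_measure_cong add: sub)
  from borel_measurable_nn_integral[OF this]
  show "(\<lambda>\<theta>. \<integral>\<^sup>+\<theta>'. G (fst (\<theta>, d)) \<theta>' (snd (\<theta>, d)) \<partial>posterior \<mu> J (snd (\<theta>, d))) \<in> borel_measurable \<mu>"
    by simp
qed

text \<open>Given the data \<open>d\<close>, the true and the sampled parameter are independent
  draws from the same posterior, so swapping them is Fubini for each \<open>d\<close>, followed by
  disintegration.\<close>

lemma posterior_exchange:
  assumes J: "J \<in> space (subprob_algebra joint)"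
    and F: "\<And>d. (\<lambda>(\<theta>, \<theta>'). F \<theta> \<theta>' d) \<in> borel_measurable (\<mu> \<Otimes>\<^sub>M \<mu>)"
  shows "(\<integral>\<^sup>+x. \<integral>\<^sup>+\<theta>'. F (fst x) \<theta>' (snd x) \<partial>posterior \<mu> J (snd x) \<partial>J)
       = (\<integral>\<^sup>+x. \<integral>\<^sup>+\<theta>'. F \<theta>' (fst x) (snd x) \<partial>posterior \<mu> J (snd x) \<partial>J)"
proof -
  note sub = posterior_in[OF J, unfolded space_subprob_algebra mem_Collect_eq]
  have F': "(\<lambda>(\<theta>, \<theta>'). F \<theta>' \<theta> d) \<in> borel_measurable (\<mu> \<Otimes>\<^sub>M \<mu>)" for d
    using measurable_compose[OF measurable_pair_swap' F[of d]] by (simp add: split_beta')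
  have "(\<integral>\<^sup>+\<theta>. \<integral>\<^sup>+\<theta>'. F \<theta> \<theta>' d \<partial>posterior \<mu> J d \<partial>posterior \<mu> J d) = (\<integral>\<^sup>+\<theta>. \<integral>\<^sup>+\<theta>'. F \<theta>' \<theta> d \<partial>posterior \<mu> J d \<partial>posterior \<mu> J d)" for d
  proof -
    interpret subprob_space "posterior \<mu> J d" using sub by simp
    interpret pair_sigma_finite "posterior \<mu> J d" "posterior \<mu> J d" ..
    have "case_prod (\<lambda>\<theta> \<theta>'. F \<theta>' \<theta> d) \<in> borel_measurable (posterior \<mu> J d \<Otimes>\<^sub>M posterior \<mu> J d)"
      using F'[of d] by (simp cong: measurable_cong_sets sets_pair_measure_cong add: sub)
    from Fubini'[OF this] show ?thesis .
  qed
  then show ?thesis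
    using nn_integral_disintegrate[OF J measurable_posterior_nn_integral[OF J, of F, OF F]]
      nn_integral_disintegrate[OF J measurable_posterior_nn_integral[OF J, of "\<lambda>\<theta> \<theta>'. F \<theta>' \<theta>", OF F']] by simp
qed

text \<open>A sampled parameter that the integrand ignores can be integrated out: at data of
  positive probability the posterior has mass one, and all other data carry no weight.\<close>

lemma nn_integral_posterior_const:
  assumes J: "J \<in> space (subprob_algebra joint)" and f: "f \<in> borel_measurable joint"
  shows "(\<integral>\<^sup>+x. \<integral>\<^sup>+\<theta>'. f x \<partial>posterior \<mu> J (snd x) \<partial>J) = (\<integral>\<^sup>+x. f x \<partial>J)"
proof -
  note sub = posterior_in[OF J, unfolded space_subprob_algebra mem_Collect_eq]
  have sp: "space (posterior \<mu> J d) = space \<mu>" for d using sub by (metis sets_eq_imp_space_eq)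
  let ?w = "\<lambda>d. emeasure (posterior \<mu> J d) (space \<mu>)"
  have g: "(\<lambda>x. f x * ?w (snd x)) \<in> borel_measurable joint"
    using measurable_joint_section[OF f] by (intro measurable_joint borel_measurable_times) auto
  have *: "(\<lambda>\<theta>. f (\<theta>, d)) \<in> borel_measurable (posterior \<mu> J d)" for d
    using measurable_joint_section[OF f] by (simp cong: measurable_cong_sets add: sub)
  have "(\<integral>\<^sup>+x. \<integral>\<^sup>+\<theta>'. f x \<partial>posterior \<mu> J (snd x) \<partial>J) = (\<integral>\<^sup>+x. f x * ?w (snd x) \<partial>J)"
    by (simp add: sp)
  also have "\<dots> = (\<integral>\<^sup>+x. f x \<partial>J)"
    unfolding nn_integral_disintegrate[OF J g] nn_integral_disintegrate[OF J f] snd_conv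
  proof (rule nn_integral_cong)
    fix d
    show "emeasure J {x \<in> space J. snd x = d} * (\<integral>\<^sup>+\<theta>. f (\<theta>, d) * ?w d \<partial>posterior \<mu> J d) =
       emeasure J {x \<in> space J. snd x = d} * (\<integral>\<^sup>+\<theta>. f (\<theta>, d) \<partial>posterior \<mu> J d)"
      using posterior_total[OF J, of d]
      by (cases "emeasure J {x \<in> space J. snd x = d} = 0") (auto simp: nn_integral_multc *)
  qed
  finally show ?thesis .
qed

lemma emeasure_ipsrl: "emeasure (ipsrl m \<mu> \<beta> L t) (space joint) = 1"
proof (induction t)
  case 0
  have "(\<integral>\<^sup>+x. 1 \<partial>ipsrl m \<mu> \<beta> L 0) = 1"
    by (subst nn_integral_ipsrl_0) (auto simp: measure_pmf.emeasure_space_1[simplified] emeasure_space_1)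
  then show ?case by (simp add: space_ipsrl del: ipsrl.simps)
next
  case (Suc t)
  have "(\<integral>\<^sup>+x. 1 \<partial>ipsrl m \<mu> \<beta> L (Suc t)) = (\<integral>\<^sup>+x. \<integral>\<^sup>+\<theta>'. 1 \<partial>posterior \<mu> (ipsrl m \<mu> \<beta> L t) (snd x) \<partial>ipsrl m \<mu> \<beta> L t)"
    by (subst nn_integral_ipsrl_Suc) (auto simp: measure_pmf.emeasure_space_1[simplified])
  also have "\<dots> = (\<integral>\<^sup>+x. 1 \<partial>ipsrl m \<mu> \<beta> L t)"
    by (rule nn_integral_posterior_const[OF ipsrl_in]) simp
  finally show ?case using Suc by (simp add: space_ipsrl del: ipsrl.simps)
qed

lemma prob_ipsrl: "prob_space (ipsrl m \<mu> \<beta> L t)"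
  by (rule prob_spaceI) (simp add: emeasure_ipsrl space_ipsrl)

end

section \<open>Concentration of the empirical transition frequencies\<close>

abbreviation triples :: "mdp \<Rightarrow> (nat \<times> nat \<times> nat) set" where
  "triples m \<equiv> {..<hor m} \<times> {..<nS m} \<times> {..<nA m}"

section \<open>A harmonic potential for the visit counts\<close>

definition inverse_sum :: "nat \<Rightarrow> real" where
  "inverse_sum n = (\<Sum>i<n. 1 / max 1 (real i))"

lemma inverse_sum_nonneg: "0 \<le> inverse_sum n"
  by (simp add: inverse_sum_def sum_nonneg)

lemma inverse_sum_le:
  assumes "1 \<le> n"
  shows "inverse_sum n \<le> 2 + ln (real n)"
proof -
  \<comment> \<open>The terms of index 0 and 1 are both 1, which accounts for the constant 2; from
    then on each term is at most a difference of consecutive logarithms.\<close>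
  have *: "inverse_sum (Suc k) \<le> 2 + ln (real k)" if "1 \<le> k" for k
    using that
  proof (induction k rule: dec_induct)
    case (step k)
    have "ln (real k / real (Suc k)) \<le> real k / real (Suc k) - 1"
      using step by (intro ln_le_minus_one) auto
    also have "\<dots> = - 1 / real (Suc k)" by (simp add: field_simps)
    finally have "1 / real (Suc k) \<le> ln (real (Suc k)) - ln (real k)"
      using step by (simp add: ln_div)
    moreover have "inverse_sum (Suc (Suc k)) = inverse_sum (Suc k) + 1 / real (Suc k)"
      by (simp add: inverse_sum_def)
    ultimately show ?case using step by simp
  qed (simp add: inverse_sum_def)
  show ?thesis
  proof (cases "n = 1")
    case False
    then obtain k where "n = Suc k" "1 \<le> k" using assms by (cases n) auto
    then show ?thesis using *[of k] by (smt (verit) ln_le_cancel_iff of_nat_0_less_iff of_nat_Suc zero_less_Suc One_nat_def Suc_le_lessD)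
  qed (simp add: inverse_sum_def)
qed

text \<open>Term \<open>i\<close> of \<open>inverse_sum\<close> is the price of a visit made when
  \<open>i\<close> earlier ones are on record, so the potential is the total price of a history. It
  telescopes the price of single episodes without reference to the policies that were
  played.\<close>

definition potential :: "mdp \<Rightarrow> traj list \<Rightarrow> real" where
  "potential m hist = (\<Sum>(h, s, a)\<in>triples m. inverse_sum (visits h s a hist))"

definition increment :: "mdp \<Rightarrow> traj list \<Rightarrow> traj \<Rightarrow> real" where
  "increment m hist \<tau> = (\<Sum>h<hor m. 1 / max 1 (real (visits h (state_at h \<tau>) (action_at h \<tau>) hist)))"

lemma visits_snoc:
  "visits h s a (hist @ [\<tau>]) = visits h s a hist + of_bool (state_at h \<tau> = s \<and> action_at h \<tau> = a)"
  by (simp add: visits_def)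

lemma visits_le_length: "visits h s a hist \<le> length hist"
  by (simp add: visits_def)

text \<open>A trajectory visits exactly one state-action pair in each period, so in each period
  exactly one summand of the potential gains a term, namely the one charged by
  \<open>increment\<close>. Counts are those before the episode; within an episode no triple occurs
  twice, because the period is part of it.\<close>

lemma potential_snoc:
  assumes "\<tau> \<in> trajs m"
  shows "potential m (hist @ [\<tau>]) = potential m hist + increment m hist \<tau>"
proof -
  have h: "inverse_sum (visits h s a (hist @ [\<tau>])) = inverse_sum (visits h s a hist)
     + (if state_at h \<tau> = s then if action_at h \<tau> = a then 1 / max 1 (real (visits h s a hist)) else 0 else 0)"
    for h s a
    by (simp add: visits_snoc inverse_sum_def)
  have "potential m (hist @ [\<tau>]) - potential m hist
    = (\<Sum>h<hor m. \<Sum>s<nS m. \<Sum>a<nA m. if state_at h \<tau> = s then if action_at h \<tau> = a then 1 / max 1 (real (visits h s a hist)) else 0 else 0)"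
    by (simp add: potential_def sum.cartesian_product[symmetric] h sum.distrib)
  also have "\<dots> = increment m hist \<tau>"
    unfolding increment_def
  proof (rule sum.cong[OF refl])
    fix h assume "h \<in> {..<hor m}"
    then have "state_at h \<tau> < nS m" "action_at h \<tau> < nA m"
      using assms by (auto intro: state_at_trajs action_at_trajs)
    moreover have "(\<Sum>s<nS m. \<Sum>a<nA m. if state_at h \<tau> = s then if action_at h \<tau> = a then 1 / max 1 (real (visits h s a hist)) else 0 else 0)
      = (\<Sum>s<nS m. if state_at h \<tau> = s then \<Sum>a<nA m. if action_at h \<tau> = a then 1 / max 1 (real (visits h s a hist)) else 0 else 0)"
      by (intro sum.cong refl) auto
    ultimately show "(\<Sum>s<nS m. \<Sum>a<nA m. if state_at h \<tau> = s then if action_at h \<tau> = a then 1 / max 1 (real (visits h s a hist)) else 0 else 0)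
       = 1 / max 1 (real (visits h (state_at h \<tau>) (action_at h \<tau>) hist))"
      by (simp add: sum.delta)
  qed
  finally show ?thesis by simp
qed

lemma increment_nonneg: "0 \<le> increment m hist \<tau>"
  by (simp add: increment_def sum_nonneg)

lemma potential_nonneg: "0 \<le> potential m hist"
  by (auto simp: potential_def intro!: sum_nonneg inverse_sum_nonneg)

lemma potential_le:
  assumes "length hist = T" "1 \<le> T"
  shows "potential m hist \<le> real (hor m) * real (nS m) * real (nA m) * (2 + ln (real T))"
proof -
  have "inverse_sum (visits h s a hist) \<le> 2 + ln (real T)" for h s a
  proof -
    have "inverse_sum (visits h s a hist) \<le> inverse_sum T"
      unfolding inverse_sum_def using visits_le_length[of h s a hist] assms by (intro sum_mono2) auto
    then show ?thesis using inverse_sum_le[OF assms(2)] by simp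
  qed
  then have "potential m hist \<le> (\<Sum>x\<in>triples m. 2 + ln (real T))"
    unfolding potential_def by (intro sum_mono) auto
  then show ?thesis by (simp add: mult.assoc)
qed

section \<open>An exponential supermartingale for the transition counts\<close>

text \<open>The empirical frequency of \<open>s'\<close> minus its probability, multiplied by the number of visits so
  that unvisited triples need no special treatment.\<close>

definition deviation :: "kernel \<Rightarrow> nat \<Rightarrow> nat \<Rightarrow> nat \<Rightarrow> traj list \<Rightarrow> nat \<Rightarrow> real" where
  "deviation \<theta> h s a hist s' =
    real (length (filter (\<lambda>\<tau>. state_at h \<tau> = s \<and> action_at h \<tau> = a \<and> state_at (Suc h) \<tau> = s') hist))
     - real (visits h s a hist) * pmf (\<theta> h s a) s'"

text \<open>In terms of frequencies, the L1 error of the empirical law exceeds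
  \<open>sqrt (y / n)\<close> after n visits. Unvisited triples are never inaccurate.\<close>

definition inaccurate :: "mdp \<Rightarrow> real \<Rightarrow> kernel \<Rightarrow> traj list \<Rightarrow> nat \<times> nat \<times> nat \<Rightarrow> bool" where
  "inaccurate m y \<theta> hist = (\<lambda>(h, s, a). 1 \<le> visits h s a hist \<and>
     sqrt (y * real (visits h s a hist)) < (\<Sum>s'<nS m. \<bar>deviation \<theta> h s a hist s'\<bar>))"

text \<open>Sign patterns express the L1 norm as a maximum of linear functionals, each of which can
  be treated by an exponential moment.\<close>

definition sgn_on :: "nat set \<Rightarrow> nat \<Rightarrow> real" where
  "sgn_on U s = (if s \<in> U then 1 else - 1)"

definition signed_deviation :: "mdp \<Rightarrow> nat set \<Rightarrow> kernel \<Rightarrow> traj list \<Rightarrow> nat \<times> nat \<times> nat \<Rightarrow> real" where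
  "signed_deviation m U \<theta> hist = (\<lambda>(h, s, a). \<Sum>s'<nS m. sgn_on U s' * deviation \<theta> h s a hist s')"

text \<open>The compensator \<open>l\<^sup>2 / 2\<close> per visit is the bound of Hoeffding's lemma
  for a variable with values in [-1, 1].\<close>

definition supermart :: "mdp \<Rightarrow> nat set \<Rightarrow> real \<Rightarrow> kernel \<Rightarrow> traj list \<Rightarrow> nat \<times> nat \<times> nat \<Rightarrow> real" where
  "supermart m U l \<theta> hist = (\<lambda>(h, s, a).
     exp (l * signed_deviation m U \<theta> hist (h, s, a) - l\<^sup>2 / 2 * real (visits h s a hist)))"

lemma supermart_Nil: "supermart m U l \<theta> [] x = 1"
  by (cases x) (simp add: supermart_def signed_deviation_def deviation_def visits_def)

lemma signed_deviation_snoc: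
  "signed_deviation m U \<theta> (hist @ [\<tau>]) (h, s, a) = signed_deviation m U \<theta> hist (h, s, a) +
    (if state_at h \<tau> = s \<and> action_at h \<tau> = a
     then (if state_at (Suc h) \<tau> < nS m then sgn_on U (state_at (Suc h) \<tau>) else 0)
       - (\<Sum>s'<nS m. pmf (\<theta> h s a) s' * sgn_on U s') else 0)"
proof -
  have d: "deviation \<theta> h s a (hist @ [\<tau>]) s' = deviation \<theta> h s a hist s' +
    (if state_at h \<tau> = s \<and> action_at h \<tau> = a then (if s' = state_at (Suc h) \<tau> then 1 else 0) - pmf (\<theta> h s a) s' else 0)" for s'
    by (auto simp: deviation_def visits_snoc algebra_simps)
  show ?thesis
  proof (cases "state_at h \<tau> = s \<and> action_at h \<tau> = a")
    case True
    have "(\<Sum>s'<nS m. sgn_on U s' * (if s' = state_at (Suc h) \<tau> then 1 else 0)) =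
      (\<Sum>s'<nS m. if s' = state_at (Suc h) \<tau> then sgn_on U s' else 0)"
      by (intro sum.cong refl) auto
    also have "\<dots> = (if state_at (Suc h) \<tau> < nS m then sgn_on U (state_at (Suc h) \<tau>) else 0)"
      by (simp add: sum.delta)
    finally show ?thesis using True
      by (simp add: signed_deviation_def d distrib_left right_diff_distrib sum.distrib sum_subtractf mult.commute)
  next
    case False
    have "deviation \<theta> h s a (hist @ [\<tau>]) s' = deviation \<theta> h s a hist s'" for s'
      by (simp only: d if_not_P[OF False] add_0_right)
    then show ?thesis by (simp only: signed_deviation_def prod.case if_not_P[OF False] add_0_right)
  qed
qed

text \<open>An episode changes the process only if it visits the triple, and then the successor is
  drawn from \<open>\<theta> h s a\<close>, so that Hoeffding's lemma makes the mean factor at most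
  one. The policy is arbitrary, which allows it to be sampled from the posterior.\<close>

lemma nn_integral_supermart_step:
  assumes \<theta>: "\<theta> \<in> kernels m" and x: "x \<in> triples m" and l: "0 < l"
  shows "(\<integral>\<^sup>+\<tau>. ennreal (supermart m U l \<theta> (hist @ [\<tau>]) x) \<partial>measure_pmf (traj_law m \<theta> \<pi>))
     \<le> ennreal (supermart m U l \<theta> hist x)"
proof -
  obtain h s a where xe: "x = (h, s, a)" and h: "h < hor m" and s: "s < nS m" and a: "a < nA m"
    using x by auto
  define \<sigma> where "\<sigma> s' = (if s' < nS m then sgn_on U s' else 0)" for s'
  define e where "e = (\<Sum>s'<nS m. pmf (\<theta> h s a) s' * sgn_on U s')"
  \<comment> \<open>\<open>g\<close> is the factor by which one episode multiplies the process; it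
    depends on the trajectory only through the triple of period \<open>h\<close>.\<close>
  define g where "g = (\<lambda>(x, b, s'). if x = s \<and> b = a then exp (l * (\<sigma> s' - e) - l\<^sup>2 / 2) else 1)"
  have e: "e = measure_pmf.expectation (\<theta> h s a) \<sigma>"
    by (simp add: e_def kernels_expectation[OF \<theta> h s a] \<sigma>_def)
  have inner: "(\<integral>\<^sup>+s'. ennreal (g (z, b, s')) \<partial>measure_pmf (\<theta> h z b)) \<le> 1" for z b
  proof (cases "z = s \<and> b = a")
    case True
    interpret interval_bounded_random_variable "measure_pmf (\<theta> h s a)" \<sigma> "- 1" 1
      by unfold_locales (auto simp: \<sigma>_def sgn_on_def)
    have "(\<integral>\<^sup>+s'. ennreal (exp (l * (\<sigma> s' - e) - l\<^sup>2 / 2)) \<partial>measure_pmf (\<theta> h s a))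
      = ennreal (exp (- l\<^sup>2 / 2)) * (\<integral>\<^sup>+s'. ennreal (exp (l * (\<sigma> s' - e))) \<partial>measure_pmf (\<theta> h s a))"
      by (simp add: nn_integral_cmult[symmetric] ennreal_mult[symmetric] exp_add[symmetric] algebra_simps)
    also have "\<dots> \<le> ennreal (exp (- l\<^sup>2 / 2)) * ennreal (exp (l\<^sup>2 * (1 - (- 1))\<^sup>2 / 8))"
      unfolding e by (intro mult_left_mono Hoeffdings_lemma_nn_integral l) auto
    also have "\<dots> = 1" by (simp add: ennreal_mult[symmetric] exp_add[symmetric])
    finally show ?thesis using True by (simp add: g_def)
  next
    case False
    then have "g (z, b, s') = 1" for s' by (auto simp: g_def)
    then show ?thesis by simp
  qed
  have "(\<integral>\<^sup>+\<tau>. ennreal (g (state_at h \<tau>, action_at h \<tau>, state_at (Suc h) \<tau>)) \<partial>measure_pmf (traj_law m \<theta> \<pi>))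
     = (\<integral>\<^sup>+y. ennreal (g y) \<partial>measure_pmf (map_pmf (\<lambda>\<tau>. (state_at h \<tau>, action_at h \<tau>, state_at (Suc h) \<tau>)) (traj_law m \<theta> \<pi>)))"
    by simp
  also have "\<dots> = (\<integral>\<^sup>+z. \<integral>\<^sup>+b. \<integral>\<^sup>+s'. ennreal (g (z, b, s')) \<partial>measure_pmf (\<theta> h z b) \<partial>measure_pmf (\<pi> h z) \<partial>measure_pmf (occ m \<theta> \<pi> h))"
    unfolding map_triple_traj_law[OF h] by simp
  also have "\<dots> \<le> (\<integral>\<^sup>+z. \<integral>\<^sup>+b. 1 \<partial>measure_pmf (\<pi> h z) \<partial>measure_pmf (occ m \<theta> \<pi> h))"
    by (intro nn_integral_mono inner)
  also have "\<dots> = 1" by (simp add: measure_pmf.emeasure_space_1[simplified])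
  finally have le1: "(\<integral>\<^sup>+\<tau>. ennreal (g (state_at h \<tau>, action_at h \<tau>, state_at (Suc h) \<tau>)) \<partial>measure_pmf (traj_law m \<theta> \<pi>)) \<le> 1" .
  have "supermart m U l \<theta> (hist @ [\<tau>]) x = supermart m U l \<theta> hist x * g (state_at h \<tau>, action_at h \<tau>, state_at (Suc h) \<tau>)" for \<tau>
    by (auto simp: xe supermart_def signed_deviation_snoc visits_snoc g_def \<sigma>_def e_def exp_add[symmetric] algebra_simps)
  then have "(\<integral>\<^sup>+\<tau>. ennreal (supermart m U l \<theta> (hist @ [\<tau>]) x) \<partial>measure_pmf (traj_law m \<theta> \<pi>))
     = ennreal (supermart m U l \<theta> hist x) * (\<integral>\<^sup>+\<tau>. ennreal (g (state_at h \<tau>, action_at h \<tau>, state_at (Suc h) \<tau>)) \<partial>measure_pmf (traj_law m \<theta> \<pi>))"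
    by (subst nn_integral_cmult[symmetric])
       (auto intro!: nn_integral_cong simp: ennreal_mult[symmetric] supermart_def g_def xe split: prod.splits)
  also have "\<dots> \<le> ennreal (supermart m U l \<theta> hist x) * 1"
    by (intro mult_left_mono le1) auto
  finally show ?thesis by simp
qed

text \<open>On \<open>inaccurate\<close> with \<open>n\<close> visits, the supermartingale for the signs of the deviations and the
  tilt \<open>sqrt (y / n)\<close> exceeds \<open>exp (y / 2)\<close>.\<close>

lemma inaccurate_le_supermart:
  assumes y: "0 \<le> y" and T: "length hist \<le> T" and inaccurate: "inaccurate m y \<theta> hist x"
  shows "1 \<le> (\<Sum>n=1..T. \<Sum>U\<in>Pow {..<nS m}. exp (- y / 2) * supermart m U (sqrt (y / real n)) \<theta> hist x)"
proof -
  obtain h s a where x: "x = (h, s, a)" by (cases x)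
  define n where "n = visits h s a hist"
  define U where "U = {s'. s' < nS m \<and> 0 \<le> deviation \<theta> h s a hist s'}"
  have n: "1 \<le> n" "n \<le> T" and dev: "sqrt (y * real n) < (\<Sum>s'<nS m. \<bar>deviation \<theta> h s a hist s'\<bar>)"
    using inaccurate T visits_le_length[of h s a hist] by (auto simp: inaccurate_def x n_def)
  have "(\<Sum>s'<nS m. \<bar>deviation \<theta> h s a hist s'\<bar>) = signed_deviation m U \<theta> hist x"
    unfolding signed_deviation_def x prod.case by (intro sum.cong refl) (auto simp: sgn_on_def U_def)
  with dev have sd: "sqrt (y * real n) \<le> signed_deviation m U \<theta> hist x" by simp
  have "sqrt (y / real n) * sqrt (y * real n) = y"
    using y n by (simp add: real_sqrt_mult[symmetric])
  then have "y \<le> sqrt (y / real n) * signed_deviation m U \<theta> hist x"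
    using mult_left_mono[OF sd, of "sqrt (y / real n)"] y by simp
  moreover have "(sqrt (y / real n))\<^sup>2 / 2 * real n = y / 2" using y n by simp
  ultimately have "0 \<le> - y / 2 + (sqrt (y / real n) * signed_deviation m U \<theta> hist x - (sqrt (y / real n))\<^sup>2 / 2 * real n)"
    by simp
  then have "1 \<le> exp (- y / 2 + (sqrt (y / real n) * signed_deviation m U \<theta> hist x - (sqrt (y / real n))\<^sup>2 / 2 * real n))"
    by simp
  also have "\<dots> = exp (- y / 2) * supermart m U (sqrt (y / real n)) \<theta> hist x"
    unfolding exp_add by (simp add: supermart_def x n_def)
  also have "\<dots> \<le> (\<Sum>U\<in>Pow {..<nS m}. exp (- y / 2) * supermart m U (sqrt (y / real n)) \<theta> hist x)"
    by (rule member_le_sum[where f = "\<lambda>U. exp (- y / 2) * supermart m U (sqrt (y / real n)) \<theta> hist x"])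
       (auto simp: U_def supermart_def x)
  also have "\<dots> \<le> (\<Sum>n=1..T. \<Sum>U\<in>Pow {..<nS m}. exp (- y / 2) * supermart m U (sqrt (y / real n)) \<theta> hist x)"
    using n by (intro member_le_sum[where f = "\<lambda>n. \<Sum>U\<in>Pow {..<nS m}. exp (- y / 2) * supermart m U (sqrt (y / real n)) \<theta> hist x"])
       (auto intro!: sum_nonneg simp: supermart_def x)
  finally show ?thesis .
qed

text \<open>The triangle inequality through the empirical frequencies gives a distance of at most
  \<open>2 * sqrt (y / n)\<close> when both kernels are accurate. Otherwise the trivial bound 4 on
  the squared distance suffices; at unvisited triples \<open>4 * y\<close> already covers it because
  \<open>1 \<le> y\<close>.\<close>

lemma l1dist_sq_le:
  assumes \<theta>: "\<theta> \<in> kernels m" and \<theta>': "\<theta>' \<in> kernels m" and h: "h < hor m" and s: "s < nS m" and a: "a < nA m"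
    and y: "1 \<le> y"
  shows "(l1dist m \<theta> \<theta>' h s a)\<^sup>2 \<le> 4 * y / max 1 (real (visits h s a hist))
     + 4 * of_bool (inaccurate m y \<theta> hist (h, s, a)) + 4 * of_bool (inaccurate m y \<theta>' hist (h, s, a))"
proof -
  let ?D = "l1dist m \<theta> \<theta>' h s a" and ?n = "visits h s a hist"
  have D0: "0 \<le> ?D" by (simp add: l1dist_def sum_nonneg)
  have "?D \<le> (\<Sum>s'<nS m. pmf (\<theta> h s a) s' + pmf (\<theta>' h s a) s')"
    unfolding l1dist_def by (intro sum_mono) (smt (verit) pmf_nonneg)
  also have "\<dots> = 2" by (simp add: sum.distrib kernels_sum_pmf[OF \<theta> h s a] kernels_sum_pmf[OF \<theta>' h s a])
  finally have "?D\<^sup>2 \<le> 2\<^sup>2" using D0 by (intro power_mono) auto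
  then have D4: "?D\<^sup>2 \<le> 4" by simp
  have nn: "0 \<le> 4 * y / max 1 (real ?n)" using y by simp
  consider "inaccurate m y \<theta> hist (h, s, a) \<or> inaccurate m y \<theta>' hist (h, s, a)" | "?n = 0"
    | "1 \<le> ?n" "\<not> inaccurate m y \<theta> hist (h, s, a)" "\<not> inaccurate m y \<theta>' hist (h, s, a)" by linarith
  then show ?thesis
  proof cases
    case 1
    then have "4 \<le> 4 * of_bool (inaccurate m y \<theta> hist (h, s, a)) + (4 * of_bool (inaccurate m y \<theta>' hist (h, s, a)) :: real)" by auto
    then show ?thesis using D4 nn by linarith
  next
    case 2
    then have "4 \<le> 4 * y / max 1 (real ?n)" using y by simp
    moreover have "0 \<le> 4 * of_bool (inaccurate m y \<theta> hist (h, s, a)) + (4 * of_bool (inaccurate m y \<theta>' hist (h, s, a)) :: real)" by simp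
    ultimately show ?thesis using D4 by linarith
  next
    case 3
    have "real ?n * ?D = (\<Sum>s'<nS m. \<bar>deviation \<theta>' h s a hist s' - deviation \<theta> h s a hist s'\<bar>)"
      unfolding l1dist_def sum_distrib_left
      by (intro sum.cong refl) (simp add: deviation_def abs_mult_pos' right_diff_distrib[symmetric])
    also have "\<dots> \<le> (\<Sum>s'<nS m. \<bar>deviation \<theta>' h s a hist s'\<bar> + \<bar>deviation \<theta> h s a hist s'\<bar>)"
      by (intro sum_mono) auto
    also have "\<dots> \<le> 2 * sqrt (y * real ?n)"
      using 3 by (auto simp: inaccurate_def sum.distrib)
    finally have "(real ?n * ?D)\<^sup>2 \<le> (2 * sqrt (y * real ?n))\<^sup>2"
      using D0 by (intro power_mono) auto
    then have "real ?n * (real ?n * ?D\<^sup>2) \<le> real ?n * (4 * y)"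
      using y by (simp add: power_mult_distrib power2_eq_square mult_ac)
    then have "real ?n * ?D\<^sup>2 \<le> 4 * y" using 3 by simp
    then show ?thesis using 3 by (simp add: field_simps max_def)
  qed
qed

context prior_mdp
begin

lemma measurable_supermart:
  assumes "x \<in> triples m"
  shows "(\<lambda>\<theta>. supermart m U l \<theta> hist x) \<in> borel_measurable \<mu>"
proof -
  obtain h s a where x: "x = (h, s, a)" "h < hor m" "s < nS m" "a < nA m" using assms by auto
  note [measurable] = measurable_pmf_kernel[OF x(2-4)]
  show ?thesis unfolding supermart_def signed_deviation_def deviation_def x(1) prod.case by measurable
qed

lemma measurable_inaccurate:
  assumes "x \<in> triples m"
  shows "Measurable.pred \<mu> (\<lambda>\<theta>. inaccurate m y \<theta> hist x)"
proof -
  obtain h s a where x: "x = (h, s, a)" "h < hor m" "s < nS m" "a < nA m" using assms by auto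
  note [measurable] = measurable_pmf_kernel[OF x(2-4)]
  show ?thesis unfolding inaccurate_def deviation_def x(1) prod.case by measurable
qed

text \<open>Proved as a vanishing integral of the indicator of the exceptional set, since the
  recursion over episodes is available for nonnegative integrals.\<close>

lemma AE_ipsrl_hist: "AE x in ipsrl m \<mu> \<beta> L t. length (snd (snd x)) = t \<and> set (snd (snd x)) \<subseteq> trajs m"
proof -
  let ?P = "\<lambda>t x. length (snd (snd x)) = t \<and> set (snd (snd x)) \<subseteq> trajs m"
  have m: "(\<lambda>x. indicator {x. \<not> ?P t x} x :: ennreal) \<in> borel_measurable joint" for t
    by (rule measurable_joint) (simp add: indicator_def)
  have "(\<integral>\<^sup>+x. indicator {x. \<not> ?P t x} x \<partial>ipsrl m \<mu> \<beta> L t) = (0 :: ennreal)"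
  proof (induction t)
    case 0
    show ?case by (subst nn_integral_ipsrl_0[OF m]) (simp add: indicator_def)
  next
    case (Suc t)
    have "(\<integral>\<^sup>+x. indicator {x. \<not> ?P (Suc t) x} x \<partial>ipsrl m \<mu> \<beta> L (Suc t))
      \<le> (\<integral>\<^sup>+x. \<integral>\<^sup>+\<theta>'. indicator {x. \<not> ?P t x} x \<partial>posterior \<mu> (ipsrl m \<mu> \<beta> L t) (snd x) \<partial>ipsrl m \<mu> \<beta> L t)"
      unfolding nn_integral_ipsrl_Suc[OF m]
    proof (intro nn_integral_mono)
      fix x \<theta>' assume "x \<in> space (ipsrl m \<mu> \<beta> L t)"
      then have "fst x \<in> space \<mu>" by (auto simp: space_ipsrl space_pair_measure)
      then have "AE \<tau> in traj_law m (fst x) (opt_policy m \<theta>'). \<tau> \<in> trajs m"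
        using set_opt_traj[of "fst x" \<theta>'] by (auto simp: AE_measure_pmf_iff)
      then have "(\<integral>\<^sup>+\<tau>. indicator {x. \<not> ?P (Suc t) x} (fst x, fst (snd x), snd (snd x) @ [\<tau>]) \<partial>measure_pmf (traj_law m (fst x) (opt_policy m \<theta>')))
        \<le> (\<integral>\<^sup>+\<tau>. (indicator {x. \<not> ?P t x} x :: ennreal) \<partial>measure_pmf (traj_law m (fst x) (opt_policy m \<theta>')))"
        by (intro nn_integral_mono_AE) (auto elim!: eventually_mono split: split_indicator)
      then show "(\<integral>\<^sup>+\<tau>. indicator {x. \<not> ?P (Suc t) x} (fst x, fst (snd x), snd (snd x) @ [\<tau>]) \<partial>measure_pmf (traj_law m (fst x) (opt_policy m \<theta>')))
        \<le> (indicator {x. \<not> ?P t x} x :: ennreal)" by (simp add: measure_pmf.emeasure_space_1[simplified])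
    qed
    also have "\<dots> = 0" unfolding nn_integral_posterior_const[OF ipsrl_in m] by (rule Suc)
    finally show ?case by simp
  qed
  then have "AE x in ipsrl m \<mu> \<beta> L t. indicator {x. \<not> ?P t x} x = (0 :: ennreal)"
    using m[of t] by (subst (asm) nn_integral_0_iff_AE) (auto cong: measurable_cong_sets simp: sets_ipsrl)
  then show ?thesis by (auto elim!: eventually_mono split: split_indicator_asm)
qed

text \<open>The one-episode bound holds for every sampled parameter, so the posterior integrates out
  and the mean stays below its initial value 1.\<close>

lemma nn_integral_supermart:
  assumes x: "x \<in> triples m" and l: "0 < l"
  shows "(\<integral>\<^sup>+z. ennreal (supermart m U l (fst z) (snd (snd z)) x) \<partial>ipsrl m \<mu> \<beta> L t) \<le> 1"
proof (induction t)
  have m: "(\<lambda>z. ennreal (supermart m U l (fst z) (snd (snd z)) x)) \<in> borel_measurable joint"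
    using measurable_supermart[OF x] by (intro measurable_joint) auto
  {
    case 0
    show ?case by (subst nn_integral_ipsrl_0[OF m]) (simp add: supermart_Nil measure_pmf.emeasure_space_1[simplified] emeasure_space_1)
  next
    case (Suc t)
    have "(\<integral>\<^sup>+z. ennreal (supermart m U l (fst z) (snd (snd z)) x) \<partial>ipsrl m \<mu> \<beta> L (Suc t))
      \<le> (\<integral>\<^sup>+z. \<integral>\<^sup>+\<theta>'. ennreal (supermart m U l (fst z) (snd (snd z)) x) \<partial>posterior \<mu> (ipsrl m \<mu> \<beta> L t) (snd z) \<partial>ipsrl m \<mu> \<beta> L t)"
      unfolding nn_integral_ipsrl_Suc[OF m] fst_conv snd_conv
      by (intro nn_integral_mono nn_integral_supermart_step x l in_kernels) (auto simp: space_ipsrl space_pair_measure)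
    also have "\<dots> \<le> 1" unfolding nn_integral_posterior_const[OF ipsrl_in m] by (rule Suc)
    finally show ?case .
  }
qed

text \<open>Markov's inequality and a union over the T possible visit counts, each with its own
  tilt, and the \<open>2 ^ nS m\<close> sign patterns. Every supermartingale has mean at most one,
  and the factor \<open>exp (- y / 2)\<close> comes from its size on the event.\<close>

lemma nn_integral_inaccurate:
  assumes x: "x \<in> triples m" and y: "0 < y" and t: "t \<le> T"
  shows "(\<integral>\<^sup>+z. of_bool (inaccurate m y (fst z) (snd (snd z)) x) \<partial>ipsrl m \<mu> \<beta> L t)
    \<le> ennreal (real T * 2 ^ nS m * exp (- y / 2))"
proof -
  let ?J = "ipsrl m \<mu> \<beta> L t"
  let ?S = "\<lambda>n U (z :: kernel \<times> data). supermart m U (sqrt (y / real n)) (fst z) (snd (snd z)) x"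
  have S0: "0 \<le> ?S n U z" for n U z by (cases x) (simp add: supermart_def)
  have ms: "(\<lambda>z. ennreal (?S n U z)) \<in> borel_measurable ?J" for n U
  proof -
    have "(\<lambda>z. ennreal (?S n U z)) \<in> borel_measurable joint"
      using measurable_supermart[OF x] by (intro measurable_joint) auto
    then show ?thesis by (simp cong: measurable_cong_sets add: sets_ipsrl)
  qed
  have "(\<integral>\<^sup>+z. of_bool (inaccurate m y (fst z) (snd (snd z)) x) \<partial>?J)
     \<le> (\<integral>\<^sup>+z. (\<Sum>n=1..T. \<Sum>U\<in>Pow {..<nS m}. ennreal (exp (- y / 2)) * ennreal (?S n U z)) \<partial>?J)"
  proof (rule nn_integral_mono_AE, use AE_ipsrl_hist[where \<beta> = \<beta> and L = L and t = t] in eventually_elim)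
    fix z :: "kernel \<times> data" assume z: "length (snd (snd z)) = t \<and> set (snd (snd z)) \<subseteq> trajs m"
    have "ennreal (of_bool (inaccurate m y (fst z) (snd (snd z)) x)) \<le> ennreal (\<Sum>n=1..T. \<Sum>U\<in>Pow {..<nS m}. exp (- y / 2) * ?S n U z)"
    proof (intro ennreal_leI)
      show "of_bool (inaccurate m y (fst z) (snd (snd z)) x) \<le> (\<Sum>n=1..T. \<Sum>U\<in>Pow {..<nS m}. exp (- y / 2) * ?S n U z)"
        using inaccurate_le_supermart[of y "snd (snd z)" T m "fst z" x] z y t S0
        by (cases "inaccurate m y (fst z) (snd (snd z)) x") (auto intro!: sum_nonneg)
    qed
    also have "\<dots> = (\<Sum>n=1..T. \<Sum>U\<in>Pow {..<nS m}. ennreal (exp (- y / 2)) * ennreal (?S n U z))"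
      using S0 by (simp add: sum_nonneg ennreal_mult[symmetric])
    finally show "of_bool (inaccurate m y (fst z) (snd (snd z)) x) \<le> (\<Sum>n=1..T. \<Sum>U\<in>Pow {..<nS m}. ennreal (exp (- y / 2)) * ennreal (?S n U z))"
      by (cases "inaccurate m y (fst z) (snd (snd z)) x") auto
  qed
  also have "\<dots> = (\<Sum>n=1..T. \<Sum>U\<in>Pow {..<nS m}. ennreal (exp (- y / 2)) * (\<integral>\<^sup>+z. ennreal (?S n U z) \<partial>?J))"
    using ms by (simp add: nn_integral_sum nn_integral_cmult)
  also have "\<dots> \<le> (\<Sum>n=1..T. \<Sum>U\<in>Pow {..<nS m}. ennreal (exp (- y / 2)) * 1)"
    using y by (intro sum_mono mult_left_mono nn_integral_supermart x) auto
  also have "\<dots> = ennreal (real T * 2 ^ nS m * exp (- y / 2))"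
    by (simp add: card_Pow ennreal_mult ennreal_of_nat_eq_real_of_nat mult.assoc ennreal_power[symmetric])
  finally show ?thesis .
qed

end

section \<open>Posterior resampling and regret\<close>

lemma borel_measurable_sum_list:
  fixes f :: "'b \<Rightarrow> 'a \<Rightarrow> ennreal"
  assumes "\<And>y. y \<in> set ys \<Longrightarrow> f y \<in> borel_measurable M"
  shows "(\<lambda>x. \<Sum>y\<leftarrow>ys. f y x) \<in> borel_measurable M"
  using assms by (induction ys) auto

definition inaccurate_count :: "mdp \<Rightarrow> real \<Rightarrow> kernel \<Rightarrow> traj list \<Rightarrow> real" where
  "inaccurate_count m y \<theta> hist = (\<Sum>x\<in>triples m. of_bool (inaccurate m y \<theta> hist x))"

lemma inaccurate_count_nonneg: "0 \<le> inaccurate_count m y \<theta> hist"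
  by (simp add: inaccurate_count_def sum_nonneg)

text \<open>Counting the inaccurate triples of the whole problem instead of those on the trajectory
  removes the dependence on the policy, so the count can be averaged over parameter and data
  alone.\<close>

lemma inaccurate_count_traj_le:
  assumes "\<tau> \<in> trajs m"
  shows "(\<Sum>h<hor m. of_bool (inaccurate m y \<theta> hist (h, state_at h \<tau>, action_at h \<tau>))) \<le> inaccurate_count m y \<theta> hist"
proof -
  let ?g = "\<lambda>h. (h, state_at h \<tau>, action_at h \<tau>)"
  have "(\<Sum>h<hor m. of_bool (inaccurate m y \<theta> hist (?g h))) = (\<Sum>x\<in>?g ` {..<hor m}. of_bool (inaccurate m y \<theta> hist x) :: real)"
    by (subst sum.reindex) (auto simp: inj_on_def)
  also have "\<dots> \<le> inaccurate_count m y \<theta> hist"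
    unfolding inaccurate_count_def
    using state_at_trajs[OF assms] action_at_trajs[OF assms] by (intro sum_mono2) auto
  finally show ?thesis .
qed

text \<open>Twice the product of \<open>\<kappa>\<close> and a distance is at most the sum of the
  squares; dividing by \<open>2 * \<kappa>\<close> turns the constants 4 of
  \<open>l1dist_sq_le\<close> into 2. The bound holds for each fixed history and pair of kernels,
  without any probability over the data.\<close>

lemma resampling_regret_le:
  assumes m: "valid_mdp m" and \<theta>: "\<theta> \<in> kernels m" and \<theta>': "\<theta>' \<in> kernels m"
    and f: "det f \<in> policies m" and \<kappa>: "0 < \<kappa>" and y: "1 \<le> y"
  shows "pvalue m \<theta>' f - pvalue m \<theta> f \<le> real (hor m) * (real (hor m) * \<kappa> / 2
     + 2 * y / \<kappa> * measure_pmf.expectation (traj_law m \<theta> (det f)) (increment m hist)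
     + 2 / \<kappa> * (inaccurate_count m y \<theta> hist + inaccurate_count m y \<theta>' hist))"
proof -
  let ?p = "traj_law m \<theta> (det f)" and ?D = "l1dist m \<theta> \<theta>'"
  note int = integrable_measure_pmf_finite[OF finite_set_traj_law[OF m \<theta> f]]
  have ineq: "(\<Sum>h<hor m. ?D h (state_at h \<tau>) (action_at h \<tau>)) \<le> real (hor m) * \<kappa> / 2
     + 2 * y / \<kappa> * increment m hist \<tau> + 2 / \<kappa> * (inaccurate_count m y \<theta> hist + inaccurate_count m y \<theta>' hist)"
    if \<tau>: "\<tau> \<in> trajs m" for \<tau>
  proof -
    let ?n = "\<lambda>h. max 1 (real (visits h (state_at h \<tau>) (action_at h \<tau>) hist))"
    let ?b = "\<lambda>\<theta> h. of_bool (inaccurate m y \<theta> hist (h, state_at h \<tau>, action_at h \<tau>)) :: real"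
    have "?D h (state_at h \<tau>) (action_at h \<tau>) \<le> \<kappa> / 2 + 2 * y / \<kappa> * (1 / ?n h) + 2 / \<kappa> * ?b \<theta> h + 2 / \<kappa> * ?b \<theta>' h"
      if h: "h < hor m" for h
    proof -
      let ?d = "?D h (state_at h \<tau>) (action_at h \<tau>)"
      have "0 \<le> (?d - \<kappa>)\<^sup>2" by simp
      then have "2 * \<kappa> * ?d \<le> \<kappa>\<^sup>2 + ?d\<^sup>2" by (simp add: power2_diff mult_ac)
      also have "?d\<^sup>2 \<le> 4 * y / ?n h + 4 * ?b \<theta> h + 4 * ?b \<theta>' h"
        by (rule l1dist_sq_le[OF \<theta> \<theta>' h state_at_trajs[OF \<tau>] action_at_trajs[OF \<tau> h] y])
      finally have "?d \<le> (\<kappa>\<^sup>2 + (4 * y / ?n h + 4 * ?b \<theta> h + 4 * ?b \<theta>' h)) / (2 * \<kappa>)"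
        using \<kappa> by (simp add: pos_le_divide_eq mult_ac)
      also have "\<dots> = \<kappa> / 2 + 2 * y / \<kappa> * (1 / ?n h) + 2 / \<kappa> * ?b \<theta> h + 2 / \<kappa> * ?b \<theta>' h"
        using \<kappa> by (simp add: add_divide_distrib power2_eq_square)
      finally show ?thesis .
    qed
    then have "(\<Sum>h<hor m. ?D h (state_at h \<tau>) (action_at h \<tau>))
      \<le> (\<Sum>h<hor m. \<kappa> / 2 + 2 * y / \<kappa> * (1 / ?n h) + 2 / \<kappa> * ?b \<theta> h + 2 / \<kappa> * ?b \<theta>' h)"
      by (intro sum_mono) auto
    also have "\<dots> = real (hor m) * \<kappa> / 2 + 2 * y / \<kappa> * increment m hist \<tau>
      + 2 / \<kappa> * (\<Sum>h<hor m. ?b \<theta> h) + 2 / \<kappa> * (\<Sum>h<hor m. ?b \<theta>' h)"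
      unfolding increment_def sum_distrib_left by (simp add: sum.distrib)
    also have "\<dots> \<le> real (hor m) * \<kappa> / 2 + 2 * y / \<kappa> * increment m hist \<tau>
      + 2 / \<kappa> * inaccurate_count m y \<theta> hist + 2 / \<kappa> * inaccurate_count m y \<theta>' hist"
      using \<kappa> y by (intro add_mono order_refl mult_left_mono inaccurate_count_traj_le[OF \<tau>]) auto
    finally show ?thesis by (simp add: distrib_left)
  qed
  have "measure_pmf.expectation ?p (\<lambda>\<tau>. \<Sum>h<hor m. ?D h (state_at h \<tau>) (action_at h \<tau>))
     \<le> measure_pmf.expectation ?p (\<lambda>\<tau>. real (hor m) * \<kappa> / 2
     + 2 * y / \<kappa> * increment m hist \<tau> + 2 / \<kappa> * (inaccurate_count m y \<theta> hist + inaccurate_count m y \<theta>' hist))"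
    using set_traj_law[OF m \<theta> f] ineq by (intro integral_mono_AE int) (auto simp: AE_measure_pmf_iff)
  also have "\<dots> = real (hor m) * \<kappa> / 2 + 2 * y / \<kappa> * measure_pmf.expectation ?p (increment m hist)
     + 2 / \<kappa> * (inaccurate_count m y \<theta> hist + inaccurate_count m y \<theta>' hist)"
    by (simp add: int)
  finally show ?thesis
    using pvalue_diff_le[OF m \<theta> \<theta>' f] by (meson mult_left_mono of_nat_0_le_iff order_trans)
qed

context prior_mdp
begin

section \<open>Joint expectations over the true parameter, the sampled parameter and the
  data\<close>

lemma measurable_opt_act: "(\<lambda>\<theta>. opt_act m \<theta> h s) \<in> \<mu> \<rightarrow>\<^sub>M count_space UNIV"
  by (rule measurable_opt_prefix) simp

lemma pred_opt_act_eq_const: "Measurable.pred \<mu> (\<lambda>\<theta>. opt_act m \<theta> = f)"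
  unfolding fun_eq_iff using measurable_opt_act by measurable

lemma pred_opt_act_eq: "Measurable.pred (\<mu> \<Otimes>\<^sub>M \<mu>) (\<lambda>(\<theta>, \<theta>'). opt_act m \<theta> = opt_act m \<theta>')"
proof -
  have "Measurable.pred (\<mu> \<Otimes>\<^sub>M \<mu>) (\<lambda>x. opt_act m (fst x) h s = opt_act m (snd x) h s)" for h s
  proof -
    note [measurable] = measurable_compose[OF measurable_fst measurable_opt_act[of h s]]
      measurable_compose[OF measurable_snd measurable_opt_act[of h s]]
    \<comment> \<open>Equality of two random actions is a countable union over their common
      value.\<close>
    have "Measurable.pred (\<mu> \<Otimes>\<^sub>M \<mu>) (\<lambda>x. \<exists>n. opt_act m (fst x) h s = n \<and> opt_act m (snd x) h s = n)"
      by measurable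
    then show ?thesis by (simp add: eq_commute)
  qed
  then have "Measurable.pred (\<mu> \<Otimes>\<^sub>M \<mu>) (\<lambda>x. \<forall>h s. opt_act m (fst x) h s = opt_act m (snd x) h s)"
    by (intro pred_intros_countable)
  then show ?thesis by (simp add: fun_eq_iff split_beta')
qed

lemma measurable_pvalue: "(\<lambda>(\<theta>, \<theta>'). pvalue m \<theta> (opt_act m \<theta>')) \<in> borel_measurable (\<mu> \<Otimes>\<^sub>M \<mu>)"
proof -
  have pm: "pmf_measurable (\<mu> \<Otimes>\<^sub>M \<mu>) (\<lambda>x. traj_law m (fst x) (opt_policy m (snd x)))"
    by (rule pmf_measurable_opt_traj) measurable
  have "(\<lambda>x. \<Sum>\<tau>\<in>trajs m. total_reward m \<tau> * pmf (traj_law m (fst x) (opt_policy m (snd x))) \<tau>) \<in> borel_measurable (\<mu> \<Otimes>\<^sub>M \<mu>)"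
    using pmf_measurableD[OF pm] by measurable
  moreover have "(case x of (\<theta>, \<theta>') \<Rightarrow> pvalue m \<theta> (opt_act m \<theta>'))
    = (\<Sum>\<tau>\<in>trajs m. total_reward m \<tau> * pmf (traj_law m (fst x) (opt_policy m (snd x))) \<tau>)"
    if "x \<in> space (\<mu> \<Otimes>\<^sub>M \<mu>)" for x
  proof -
    have "fst x \<in> space \<mu>" using that by (auto simp: space_pair_measure)
    from set_opt_traj[OF this] show ?thesis
      by (subst integral_measure_pmf_real[OF finite_trajs, symmetric])
         (auto simp: pvalue_def opt_policy_eq split_beta')
  qed
  ultimately show ?thesis by (simp cong: measurable_cong)
qed

lemma measurable_inner_nn_integral:
  fixes f :: "traj \<Rightarrow> ennreal"
  shows "(\<lambda>(\<theta>, \<theta>'). \<integral>\<^sup>+\<tau>. f \<tau> \<partial>measure_pmf (traj_law m \<theta> (opt_policy m \<theta>'))) \<in> borel_measurable (\<mu> \<Otimes>\<^sub>M \<mu>)"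
proof -
  have "(\<lambda>x. measure_pmf (traj_law m (fst x) (opt_policy m (snd x)))) \<in> \<mu> \<Otimes>\<^sub>M \<mu> \<rightarrow>\<^sub>M subprob_algebra (count_space UNIV)"
    by (rule measurable_opt_traj) measurable
  from measurable_compose[OF this nn_integral_measurable_subprob_algebra[of f]] show ?thesis
    by (simp add: split_beta')
qed

definition resample :: "(kernel \<times> data) measure \<Rightarrow> (kernel \<Rightarrow> kernel \<Rightarrow> data \<Rightarrow> ennreal) \<Rightarrow> ennreal" where
  "resample J F = (\<integral>\<^sup>+x. \<integral>\<^sup>+\<theta>'. F (fst x) \<theta>' (snd x) \<partial>posterior \<mu> J (snd x) \<partial>J)"

text \<open>Joint measurability in the two parameters for each value of the data; as the data are
  countable, this is all that \<open>resample\<close> demands of an integrand. The first argument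
  stands for the true parameter, the second for the sampled one.\<close>

definition resample_measurable :: "(kernel \<Rightarrow> kernel \<Rightarrow> data \<Rightarrow> ennreal) \<Rightarrow> bool" where
  "resample_measurable F \<longleftrightarrow> (\<forall>d. (\<lambda>(\<theta>, \<theta>'). F \<theta> \<theta>' d) \<in> borel_measurable (\<mu> \<Otimes>\<^sub>M \<mu>))"

lemma resample_measurableI:
  "(\<And>d. (\<lambda>x. F (fst x) (snd x) d) \<in> borel_measurable (\<mu> \<Otimes>\<^sub>M \<mu>)) \<Longrightarrow> resample_measurable F"
  unfolding resample_measurable_def split_beta' by blast

lemma resample_measurableD:
  "resample_measurable F \<Longrightarrow> (\<lambda>(\<theta>, \<theta>'). F \<theta> \<theta>' d) \<in> borel_measurable (\<mu> \<Otimes>\<^sub>M \<mu>)"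
  unfolding resample_measurable_def by blast

lemma resample_measurableD':
  "resample_measurable F \<Longrightarrow> (\<lambda>x. F (fst x) (snd x) d) \<in> borel_measurable (\<mu> \<Otimes>\<^sub>M \<mu>)"
  unfolding resample_measurable_def split_beta' by blast

lemma resample_measurable_fst:
  assumes "\<And>d. (\<lambda>\<theta>. f \<theta> d) \<in> borel_measurable \<mu>"
  shows "resample_measurable (\<lambda>\<theta> \<theta>' d. f \<theta> d)"
proof (rule resample_measurableI)
  fix d
  from measurable_compose[OF measurable_fst assms[of d]]
  show "(\<lambda>x. f (fst x) d) \<in> borel_measurable (\<mu> \<Otimes>\<^sub>M \<mu>)" .
qed

lemma resample_measurable_snd:
  assumes "\<And>d. (\<lambda>\<theta>. f \<theta> d) \<in> borel_measurable \<mu>"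
  shows "resample_measurable (\<lambda>\<theta> \<theta>' d. f \<theta>' d)"
proof (rule resample_measurableI)
  fix d
  from measurable_compose[OF measurable_snd assms[of d]]
  show "(\<lambda>x. f (snd x) d) \<in> borel_measurable (\<mu> \<Otimes>\<^sub>M \<mu>)" .
qed

lemma resample_measurable_add:
  assumes "resample_measurable F" "resample_measurable G"
  shows "resample_measurable (\<lambda>\<theta> \<theta>' d. F \<theta> \<theta>' d + G \<theta> \<theta>' d)"
proof (rule resample_measurableI)
  fix d
  note [measurable] = resample_measurableD'[OF assms(1), of d] resample_measurableD'[OF assms(2), of d]
  show "(\<lambda>x. F (fst x) (snd x) d + G (fst x) (snd x) d) \<in> borel_measurable (\<mu> \<Otimes>\<^sub>M \<mu>)" by measurable
qed

lemma resample_measurable_cmult: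
  assumes "resample_measurable F"
  shows "resample_measurable (\<lambda>\<theta> \<theta>' d. c * F \<theta> \<theta>' d)"
proof (rule resample_measurableI)
  fix d
  note [measurable] = resample_measurableD'[OF assms, of d]
  show "(\<lambda>x. c * F (fst x) (snd x) d) \<in> borel_measurable (\<mu> \<Otimes>\<^sub>M \<mu>)" by measurable
qed

context
  fixes J
  assumes J: "J \<in> space (subprob_algebra joint)"
begin

lemma resample_section:
  assumes "resample_measurable F" "x \<in> space J"
  shows "(\<lambda>\<theta>'. F (fst x) \<theta>' (snd x)) \<in> borel_measurable (posterior \<mu> J (snd x))"
proof -
  have "fst x \<in> space \<mu>"
    using assms(2) J by (auto simp: space_subprob_algebra space_pair_measure dest!: sets_eq_imp_space_eq)
  from measurable_compose[OF measurable_Pair1'[OF this] resample_measurableD'[OF assms(1), of "snd x"]]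
  show ?thesis by (simp cong: measurable_cong_sets)
qed

lemma resample_outer:
  assumes "resample_measurable F"
  shows "(\<lambda>x. \<integral>\<^sup>+\<theta>'. F (fst x) \<theta>' (snd x) \<partial>posterior \<mu> J (snd x)) \<in> borel_measurable J"
proof -
  have "sets J = sets joint" using J by (auto simp: space_subprob_algebra)
  then show ?thesis
    using measurable_posterior_nn_integral[OF J, of F, OF resample_measurableD[OF assms]]
    by (simp cong: measurable_cong_sets)
qed

lemma resample_add:
  assumes "resample_measurable F" "resample_measurable G"
  shows "resample J (\<lambda>\<theta> \<theta>' d. F \<theta> \<theta>' d + G \<theta> \<theta>' d) = resample J F + resample J G"
  unfolding resample_def
  using assms by (subst nn_integral_add[symmetric])
    (auto intro!: nn_integral_cong nn_integral_add resample_section resample_outer)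

lemma resample_cmult:
  assumes "resample_measurable F"
  shows "resample J (\<lambda>\<theta> \<theta>' d. c * F \<theta> \<theta>' d) = c * resample J F"
  unfolding resample_def
  using assms by (subst nn_integral_cmult[symmetric])
    (auto intro!: nn_integral_cong nn_integral_cmult resample_section resample_outer)

lemma resample_mono:
  assumes "\<And>\<theta> \<theta>' d. \<theta> \<in> space \<mu> \<Longrightarrow> \<theta>' \<in> space \<mu> \<Longrightarrow> F \<theta> \<theta>' d \<le> G \<theta> \<theta>' d"
  shows "resample J F \<le> resample J G"
  unfolding resample_def
proof (intro nn_integral_mono)
  fix x \<theta>' assume "x \<in> space J" "\<theta>' \<in> space (posterior \<mu> J (snd x))"
  moreover have "space J = space joint" using J by (auto simp: space_subprob_algebra dest!: sets_eq_imp_space_eq)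
  ultimately show "F (fst x) \<theta>' (snd x) \<le> G (fst x) \<theta>' (snd x)"
    using sets_eq_imp_space_eq[OF sets_posterior_ipsrl[of J "snd x"]] by (intro assms) (auto simp: space_pair_measure)
qed

lemma resample_exchange:
  assumes "resample_measurable F"
  shows "resample J F = resample J (\<lambda>\<theta> \<theta>' d. F \<theta>' \<theta> d)"
  unfolding resample_def by (rule posterior_exchange[OF J resample_measurableD[OF assms]])

lemma resample_fst:
  assumes "\<And>d. (\<lambda>\<theta>. f \<theta> d) \<in> borel_measurable \<mu>"
  shows "resample J (\<lambda>\<theta> \<theta>' d. f \<theta> d) = (\<integral>\<^sup>+x. f (fst x) (snd x) \<partial>J)"
  unfolding resample_def using assms
  by (intro nn_integral_posterior_const[OF J] measurable_joint) simp

text \<open>The sampled parameter has the same joint law with the data as the true one. In this form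
  statements about the true parameter, such as accuracy or agreement with the estimate, pass to the
  sampled one.\<close>

lemma resample_snd:
  assumes "\<And>d. (\<lambda>\<theta>. f \<theta> d) \<in> borel_measurable \<mu>"
  shows "resample J (\<lambda>\<theta> \<theta>' d. f \<theta>' d) = (\<integral>\<^sup>+x. f (fst x) (snd x) \<partial>J)"
  using resample_exchange[OF resample_measurable_fst[of f, OF assms]] resample_fst[OF assms] by simp

end

text \<open>The event involves only the true parameter and the offline data, which online episodes
  leave alone, so the bound at time 0 persists in every episode.\<close>

lemma nn_integral_estimate_wrong:
  assumes e: "\<And>\<theta>. \<theta> \<in> space \<mu> \<Longrightarrow>
    measure_pmf.prob (replicate_pmf L (traj_law m \<theta> (expert m \<beta> \<theta>))) {D. est D \<noteq> opt_act m \<theta>} \<le> e"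
  shows "(\<integral>\<^sup>+x. of_bool (est (fst (snd x)) \<noteq> opt_act m (fst x)) \<partial>ipsrl m \<mu> \<beta> L t) \<le> ennreal e"
proof (induction t)
  let ?f = "\<lambda>x :: kernel \<times> data. of_bool (est (fst (snd x)) \<noteq> opt_act m (fst x)) :: ennreal"
  have f: "?f \<in> borel_measurable joint"
  proof (rule measurable_joint)
    fix d :: data
    have "Measurable.pred \<mu> (\<lambda>\<theta>. \<not> opt_act m \<theta> = est (fst d))"
      using pred_opt_act_eq_const by measurable
    then show "(\<lambda>\<theta>. ?f (\<theta>, d)) \<in> borel_measurable \<mu>"
      by (simp add: of_bool_def eq_commute)
  qed
  {
    case 0
    have "(\<integral>\<^sup>+x. ?f x \<partial>ipsrl m \<mu> \<beta> L 0) \<le> (\<integral>\<^sup>+\<theta>. ennreal e \<partial>\<mu>)"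
      unfolding nn_integral_ipsrl_0[OF f] fst_conv snd_conv
    proof (intro nn_integral_mono)
      fix \<theta> assume "\<theta> \<in> space \<mu>"
      let ?R = "replicate_pmf L (traj_law m \<theta> (expert m \<beta> \<theta>))"
      have "(\<integral>\<^sup>+D. of_bool (est D \<noteq> opt_act m \<theta>) \<partial>measure_pmf ?R) = (\<integral>\<^sup>+D. indicator {D. est D \<noteq> opt_act m \<theta>} D \<partial>measure_pmf ?R)"
        by (intro nn_integral_cong) (simp add: indicator_def)
      also have "\<dots> \<le> ennreal e"
        using e[OF \<open>\<theta> \<in> space \<mu>\<close>] by (simp add: measure_pmf.emeasure_eq_measure ennreal_leI)
      finally show "(\<integral>\<^sup>+D. of_bool (est D \<noteq> opt_act m \<theta>) \<partial>measure_pmf ?R) \<le> ennreal e" .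
    qed
    then show ?case by (simp add: emeasure_space_1)
  next
    case (Suc t)
    have "(\<integral>\<^sup>+x. ?f x \<partial>ipsrl m \<mu> \<beta> L (Suc t))
      = (\<integral>\<^sup>+x. \<integral>\<^sup>+\<theta>'. ?f x \<partial>posterior \<mu> (ipsrl m \<mu> \<beta> L t) (snd x) \<partial>ipsrl m \<mu> \<beta> L t)"
      unfolding nn_integral_ipsrl_Suc[OF f] fst_conv snd_conv by (simp add: measure_pmf.emeasure_space_1[simplified])
    also have "\<dots> \<le> ennreal e" unfolding nn_integral_posterior_const[OF ipsrl_in f] by (rule Suc)
    finally show ?case .
  }
qed

end

context prior_mdp
begin

lemma expectation_V_traj:
  assumes "\<theta> \<in> kernels m"
  shows "measure_pmf.expectation (traj_law m \<theta> \<pi>) (\<lambda>\<tau>. V m \<theta> 0 (state_at 0 \<tau>)) = pvalue m \<theta> (opt_act m \<theta>)"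
proof -
  have "measure_pmf.expectation (map_pmf (state_at 0) (traj_law m \<theta> \<pi>)) (V m \<theta> 0) = pvalue m \<theta> (opt_act m \<theta>)"
    using valid by (subst map_state_traj_law) (auto simp: valid_mdp_def pvalue_opt_act[OF valid assms])
  then show ?thesis by simp
qed

section \<open>Recursion of the regret over the episodes\<close>

text \<open>The shift by \<open>H + 1\<close> makes the regret of a trajectory nonnegative, so that no integrability has to
  be tracked in the recursion.\<close>

definition step_regret :: "kernel \<Rightarrow> traj \<Rightarrow> ennreal" where
  "step_regret \<theta> \<tau> = (if \<tau> \<in> trajs m
     then ennreal (real (hor m) + 1 + V m \<theta> 0 (state_at 0 \<tau>) - total_reward m \<tau>) else 0)"

lemma measurable_step_regret: "(\<lambda>\<theta>. step_regret \<theta> \<tau>) \<in> borel_measurable \<mu>"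
proof (cases "\<tau> \<in> trajs m")
  case True
  note [measurable] = measurable_V[OF state_at_trajs[OF True, of 0], of 0]
  show ?thesis unfolding step_regret_def by measurable
qed (simp add: step_regret_def)

lemma step_regret_nonneg:
  assumes "\<theta> \<in> kernels m" "\<tau> \<in> trajs m"
  shows "0 \<le> real (hor m) + 1 + V m \<theta> 0 (state_at 0 \<tau>) - total_reward m \<tau>"
  using V_bounds[OF valid assms(1) state_at_trajs[OF assms(2)], of 0 0] total_reward_bounds[OF valid assms(2)] by simp

lemma nn_integral_step_regret:
  assumes \<theta>: "\<theta> \<in> space \<mu>"
  shows "(\<integral>\<^sup>+\<tau>. step_regret \<theta> \<tau> \<partial>measure_pmf (traj_law m \<theta> (opt_policy m \<theta>')))
     = ennreal (real (hor m) + 1 + pvalue m \<theta> (opt_act m \<theta>) - pvalue m \<theta> (opt_act m \<theta>'))"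
proof -
  let ?p = "traj_law m \<theta> (opt_policy m \<theta>')"
  have fin: "finite (set_pmf ?p)" using set_opt_traj[OF \<theta>] finite_trajs finite_subset by blast
  note int = integrable_measure_pmf_finite[OF fin]
  have AE: "AE \<tau> in ?p. \<tau> \<in> trajs m" using set_opt_traj[OF \<theta>, of \<theta>'] by (auto simp: AE_measure_pmf_iff)
  let ?g = "\<lambda>\<tau>. real (hor m) + 1 + V m \<theta> 0 (state_at 0 \<tau>) - total_reward m \<tau>"
  have "(\<integral>\<^sup>+\<tau>. step_regret \<theta> \<tau> \<partial>measure_pmf ?p) = (\<integral>\<^sup>+\<tau>. ennreal (?g \<tau>) \<partial>measure_pmf ?p)"
    using AE by (intro nn_integral_cong_AE) (auto elim!: eventually_mono simp: step_regret_def)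
  also have "\<dots> = ennreal (measure_pmf.expectation ?p ?g)"
    using AE step_regret_nonneg[OF in_kernels[OF \<theta>]]
    by (intro nn_integral_eq_integral int) (auto elim!: eventually_mono)
  also have "measure_pmf.expectation ?p ?g = real (hor m) + 1 + pvalue m \<theta> (opt_act m \<theta>) - pvalue m \<theta> (opt_act m \<theta>')"
  proof -
    have "measure_pmf.expectation ?p (total_reward m) = pvalue m \<theta> (opt_act m \<theta>')"
      by (simp add: pvalue_def opt_policy_eq)
    then show ?thesis
      using expectation_V_traj[OF in_kernels[OF \<theta>], of "opt_policy m \<theta>'"] by (simp add: int)
  qed
  finally show ?thesis .
qed

lemma pvalue_opt_bounds:
  assumes "\<theta> \<in> space \<mu>"
  shows "0 \<le> pvalue m \<theta> (opt_act m \<theta>')" "pvalue m \<theta> (opt_act m \<theta>') \<le> real (hor m) + 1"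
  using pvalue_bounds[OF valid in_kernels[OF assms] opt_policy_in[OF valid]] by auto

abbreviation expected_increment :: "kernel \<Rightarrow> kernel \<Rightarrow> data \<Rightarrow> ennreal" where
  "expected_increment \<theta> \<theta>' d \<equiv>
     \<integral>\<^sup>+\<tau>. ennreal (increment m (snd d) \<tau>) \<partial>measure_pmf (traj_law m \<theta> (opt_policy m \<theta>'))"

text \<open>With equal policies the regret is zero, so only values on the event of differing
  policies enter, and there \<open>resampling_regret_le\<close> applies with the current history.
  The summand \<open>H + 1\<close> is the shift of \<open>step_regret\<close>. The increment is kept
  as an expectation, since a good bound exists only for its sum over the episodes.\<close>

lemma resample_regret_le:
  fixes est :: "traj list \<Rightarrow> nat \<Rightarrow> nat \<Rightarrow> nat"
  defines "H \<equiv> real (hor m)" and "N \<equiv> real (hor m) * real (nS m) * real (nA m)"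
  assumes J: "J \<in> space (subprob_algebra joint)" and J1: "emeasure J (space J) = 1"
    and \<kappa>: "0 < \<kappa>" and y: "1 \<le> y" and e: "0 \<le> e" and b: "0 \<le> b"
    and est: "(\<integral>\<^sup>+x. of_bool (est (fst (snd x)) \<noteq> opt_act m (fst x)) \<partial>J) \<le> ennreal e"
    and inaccurate: "\<And>x. x \<in> triples m \<Longrightarrow> (\<integral>\<^sup>+z. of_bool (inaccurate m y (fst z) (snd (snd z)) x) \<partial>J) \<le> ennreal b"
  shows "resample J (\<lambda>\<theta> \<theta>' d. ennreal (H + 1 + pvalue m \<theta> (opt_act m \<theta>) - pvalue m \<theta> (opt_act m \<theta>')))
    \<le> ennreal (H + 1 + H\<^sup>2 * \<kappa> * e + 4 * H / \<kappa> * N * b) + ennreal (2 * y * H / \<kappa>) * resample J expected_increment"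
proof -
  define ne where "ne \<theta> \<theta>' = (of_bool (opt_act m \<theta> \<noteq> opt_act m \<theta>') :: real)" for \<theta> \<theta>'
  let ?v = "\<lambda>\<theta> \<theta>'. pvalue m \<theta> (opt_act m \<theta>')"
  let ?R = "resample J"
  have H0: "0 \<le> H" by (simp add: H_def)
  have sJ: "sets J = sets joint" using J by (auto simp: space_subprob_algebra)
  have mv: "(\<lambda>x. ?v (fst x) (snd x)) \<in> borel_measurable (\<mu> \<Otimes>\<^sub>M \<mu>)"
    using measurable_pvalue by (simp add: split_beta')
  have mdiag: "(\<lambda>\<theta>. ?v \<theta> \<theta>) \<in> borel_measurable \<mu>"
    using measurable_compose[OF measurable_Pair[OF measurable_ident measurable_ident] mv] by simp
  have mne: "(\<lambda>x. ne (fst x) (snd x)) \<in> borel_measurable (\<mu> \<Otimes>\<^sub>M \<mu>)"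
  proof -
    have [measurable]: "Measurable.pred (\<mu> \<Otimes>\<^sub>M \<mu>) (\<lambda>x. opt_act m (fst x) = opt_act m (snd x))"
      using pred_opt_act_eq by (simp add: split_beta')
    show ?thesis unfolding ne_def of_bool_def by measurable
  qed
  note mdiag1 = measurable_compose[OF measurable_fst mdiag] and mdiag2 = measurable_compose[OF measurable_snd mdiag]
  note [measurable] = mv mne mdiag1 mdiag2
  have m1: "resample_measurable (\<lambda>\<theta> \<theta>' d. ennreal (H + 1 + ?v \<theta> \<theta> - ?v \<theta> \<theta>'))"
    by (rule resample_measurableI) measurable
  have m2: "resample_measurable (\<lambda>\<theta> \<theta>' d. ennreal (ne \<theta> \<theta>' * ?v \<theta> \<theta>'))"
    by (rule resample_measurableI) measurable
  have m3: "resample_measurable (\<lambda>\<theta> \<theta>' d. ennreal (ne \<theta> \<theta>' * ?v \<theta> \<theta>))"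
    by (rule resample_measurableI) measurable
  have m4: "resample_measurable (\<lambda>\<theta> \<theta>' d. ennreal (ne \<theta> \<theta>'))"
    by (rule resample_measurableI) measurable
  have m5: "resample_measurable expected_increment"
    by (rule resample_measurableI) (use measurable_inner_nn_integral in \<open>simp add: split_beta'\<close>)
  have mb: "(\<lambda>\<theta>. ennreal (inaccurate_count m y \<theta> (snd d))) \<in> borel_measurable \<mu>" for d :: data
  proof -
    have "(\<lambda>\<theta>. of_bool (inaccurate m y \<theta> (snd d) x) :: real) \<in> borel_measurable \<mu>" if "x \<in> triples m" for x
    proof -
      note [measurable] = measurable_inaccurate[OF that, of y "snd d"]
      show ?thesis unfolding of_bool_def by measurable
    qed
    then show ?thesis unfolding inaccurate_count_def
      by (intro measurable_compose[OF _ measurable_ennreal] borel_measurable_sum)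
  qed
  have mb1: "resample_measurable (\<lambda>\<theta> \<theta>' d. ennreal (inaccurate_count m y \<theta> (snd d)))"
    by (rule resample_measurable_fst[OF mb])
  have mb2: "resample_measurable (\<lambda>\<theta> \<theta>' d. ennreal (inaccurate_count m y \<theta>' (snd d)))"
    by (rule resample_measurable_snd[OF mb])
  have mc: "resample_measurable (\<lambda>\<theta> \<theta>' d. c)" for c
    by (rule resample_measurableI) simp
  have Rconst: "?R (\<lambda>\<theta> \<theta>' d. c) = c" for c
    using resample_fst[OF J, of "\<lambda>_ _. c"] J1 by simp
  \<comment> \<open>The indicator \<open>ne\<close> is kept on the constant part alone. The other
    two parts are needed only on the event, but are small in total without it.\<close>
  let ?W = "\<lambda>\<theta> \<theta>' d. ennreal (H\<^sup>2 * \<kappa> / 2) * ennreal (ne \<theta> \<theta>') + ennreal (2 * y * H / \<kappa>) * expected_increment \<theta> \<theta>' d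
      + ennreal (2 * H / \<kappa>) * (ennreal (inaccurate_count m y \<theta> (snd d)) + ennreal (inaccurate_count m y \<theta>' (snd d)))"
  have mW: "resample_measurable ?W"
    by (intro resample_measurable_add resample_measurable_cmult m4 m5 mb1 mb2)
  have pt: "ennreal (ne \<theta> \<theta>' * ?v \<theta>' \<theta>') \<le> ennreal (ne \<theta> \<theta>' * ?v \<theta> \<theta>') + ?W \<theta> \<theta>' d"
    if \<theta>: "\<theta> \<in> space \<mu>" and \<theta>': "\<theta>' \<in> space \<mu>" for \<theta> \<theta>' d
  proof (cases "opt_act m \<theta> = opt_act m \<theta>'")
    case True
    then show ?thesis by (simp add: ne_def)
  next
    case False
    let ?p = "traj_law m \<theta> (opt_policy m \<theta>')"
    have fin: "finite (set_pmf ?p)" using set_opt_traj[OF \<theta>] finite_trajs finite_subset by blast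
    have inc: "expected_increment \<theta> \<theta>' d = ennreal (measure_pmf.expectation ?p (increment m (snd d)))"
      by (intro nn_integral_eq_integral integrable_measure_pmf_finite fin) (simp add: increment_nonneg)
    have inc0: "0 \<le> measure_pmf.expectation ?p (increment m (snd d))"
      by (simp add: increment_nonneg)
    have "?v \<theta>' \<theta>' \<le> ?v \<theta> \<theta>' + (H\<^sup>2 * \<kappa> / 2 + 2 * y * H / \<kappa> * measure_pmf.expectation ?p (increment m (snd d))
        + 2 * H / \<kappa> * (inaccurate_count m y \<theta> (snd d) + inaccurate_count m y \<theta>' (snd d)))"
      using resampling_regret_le[OF valid in_kernels[OF \<theta>] in_kernels[OF \<theta>'] opt_policy_in[OF valid, of \<theta>'] \<kappa> y, of "snd d"]
      by (simp add: opt_policy_eq H_def power2_eq_square distrib_left mult_ac)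
    then have "ennreal (?v \<theta>' \<theta>') \<le> ennreal (?v \<theta> \<theta>' + (H\<^sup>2 * \<kappa> / 2 + 2 * y * H / \<kappa> * measure_pmf.expectation ?p (increment m (snd d))
        + 2 * H / \<kappa> * (inaccurate_count m y \<theta> (snd d) + inaccurate_count m y \<theta>' (snd d))))"
      by (rule ennreal_leI)
    also have "\<dots> = ennreal (?v \<theta> \<theta>') + (ennreal (H\<^sup>2 * \<kappa> / 2) + ennreal (2 * y * H / \<kappa>) * expected_increment \<theta> \<theta>' d
      + ennreal (2 * H / \<kappa>) * (ennreal (inaccurate_count m y \<theta> (snd d)) + ennreal (inaccurate_count m y \<theta>' (snd d))))"
      using pvalue_opt_bounds[OF \<theta>, of \<theta>'] \<kappa> y H0 inc0 inaccurate_count_nonneg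
      by (simp add: inc ennreal_plus[symmetric] ennreal_mult[symmetric] del: ennreal_plus)
    finally show ?thesis using False by (simp add: ne_def)
  qed
  \<comment> \<open>\<open>A\<close> is the value that the resampled policy earns on the event that the policies differ. It is added on both
    sides, and cancelled below, because \<open>ennreal\<close> has no differences. The exchange replaces \<open>?v \<theta> \<theta>\<close> by
    \<open>?v \<theta>' \<theta>'\<close> in between.\<close>
  define A where "A = ?R (\<lambda>\<theta> \<theta>' d. ennreal (ne \<theta> \<theta>' * ?v \<theta> \<theta>'))"
  have "A \<le> ?R (\<lambda>\<theta> \<theta>' d. ennreal (H + 1))"
    unfolding A_def by (intro resample_mono[OF J] ennreal_leI)
      (use pvalue_opt_bounds in \<open>auto simp: ne_def H_def\<close>)
  then have A: "A \<noteq> \<top>" unfolding Rconst by (auto simp: top_unique)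
  have "?R (\<lambda>\<theta> \<theta>' d. ennreal (H + 1 + ?v \<theta> \<theta> - ?v \<theta> \<theta>')) + A
     = ?R (\<lambda>\<theta> \<theta>' d. ennreal (H + 1 + ?v \<theta> \<theta> - ?v \<theta> \<theta>') + ennreal (ne \<theta> \<theta>' * ?v \<theta> \<theta>'))"
    unfolding A_def by (rule resample_add[OF J m1 m2, symmetric])
  also have "\<dots> \<le> ?R (\<lambda>\<theta> \<theta>' d. ennreal (H + 1) + ennreal (ne \<theta> \<theta>' * ?v \<theta> \<theta>))"
  proof (rule resample_mono[OF J])
    fix \<theta> \<theta>' and d :: data assume \<theta>: "\<theta> \<in> space \<mu>" "\<theta>' \<in> space \<mu>"
    have *: "0 \<le> H + 1 + ?v \<theta> \<theta> - ?v \<theta> \<theta>'"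
      using pvalue_opt_bounds[OF \<theta>(1), of \<theta>] pvalue_opt_bounds[OF \<theta>(1), of \<theta>'] by (simp add: H_def)
    show "ennreal (H + 1 + ?v \<theta> \<theta> - ?v \<theta> \<theta>') + ennreal (ne \<theta> \<theta>' * ?v \<theta> \<theta>')
       \<le> ennreal (H + 1) + ennreal (ne \<theta> \<theta>' * ?v \<theta> \<theta>)"
    proof (cases "opt_act m \<theta> = opt_act m \<theta>'")
      case True
      then have "?v \<theta> \<theta> = ?v \<theta> \<theta>'" by simp
      then show ?thesis using True by (simp add: ne_def)
    next
      case False
      then show ?thesis using * H0 pvalue_opt_bounds[OF \<theta>(1)]
        by (simp add: ne_def ennreal_plus[symmetric] del: ennreal_plus)
    qed
  qed
  also have "\<dots> = ennreal (H + 1) + ?R (\<lambda>\<theta> \<theta>' d. ennreal (ne \<theta> \<theta>' * ?v \<theta> \<theta>))"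
    by (simp add: resample_add[OF J mc m3] Rconst)
  also have "?R (\<lambda>\<theta> \<theta>' d. ennreal (ne \<theta> \<theta>' * ?v \<theta> \<theta>)) = ?R (\<lambda>\<theta> \<theta>' d. ennreal (ne \<theta> \<theta>' * ?v \<theta>' \<theta>'))"
    by (subst resample_exchange[OF J m3]) (simp add: ne_def eq_commute)
  also have "\<dots> \<le> ?R (\<lambda>\<theta> \<theta>' d. ennreal (ne \<theta> \<theta>' * ?v \<theta> \<theta>') + ?W \<theta> \<theta>' d)"
    by (rule resample_mono[OF J pt])
  also have "\<dots> = A + ?R ?W"
    unfolding A_def by (rule resample_add[OF J m2 mW])
  finally have "A + ?R (\<lambda>\<theta> \<theta>' d. ennreal (H + 1 + ?v \<theta> \<theta> - ?v \<theta> \<theta>')) \<le> A + (ennreal (H + 1) + ?R ?W)"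
    by (simp add: add_ac)
  then have main: "?R (\<lambda>\<theta> \<theta>' d. ennreal (H + 1 + ?v \<theta> \<theta> - ?v \<theta> \<theta>')) \<le> ennreal (H + 1) + ?R ?W"
    using A by (simp add: ennreal_add_left_cancel_le)
  have W: "?R ?W = ennreal (H\<^sup>2 * \<kappa> / 2) * ?R (\<lambda>\<theta> \<theta>' d. ennreal (ne \<theta> \<theta>')) + ennreal (2 * y * H / \<kappa>) * ?R expected_increment
     + ennreal (2 * H / \<kappa>) * (?R (\<lambda>\<theta> \<theta>' d. ennreal (inaccurate_count m y \<theta> (snd d))) + ?R (\<lambda>\<theta> \<theta>' d. ennreal (inaccurate_count m y \<theta>' (snd d))))"
    by (simp only: resample_add[OF J resample_measurable_add[OF resample_measurable_cmult[OF m4] resample_measurable_cmult[OF m5]]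
          resample_measurable_cmult[OF resample_measurable_add[OF mb1 mb2]]]
        resample_add[OF J resample_measurable_cmult[OF m4] resample_measurable_cmult[OF m5]]
        resample_add[OF J mb1 mb2] resample_cmult[OF J m4] resample_cmult[OF J m5]
        resample_cmult[OF J resample_measurable_add[OF mb1 mb2]])
  have mest: "(\<lambda>\<theta>. of_bool (est (fst d) \<noteq> opt_act m \<theta>) :: ennreal) \<in> borel_measurable \<mu>" for d :: data
  proof -
    have "Measurable.pred \<mu> (\<lambda>\<theta>. \<not> opt_act m \<theta> = est (fst d))"
      using pred_opt_act_eq_const by measurable
    then show ?thesis by (simp add: of_bool_def eq_commute)
  qed
  \<comment> \<open>If the policies differ, at least one of them differs from the estimate, which
    depends on the offline data only; the two possibilities have the same probability.\<close>
  have Rne: "?R (\<lambda>\<theta> \<theta>' d. ennreal (ne \<theta> \<theta>')) \<le> ennreal (2 * e)"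
  proof -
    have "?R (\<lambda>\<theta> \<theta>' d. ennreal (ne \<theta> \<theta>'))
      \<le> ?R (\<lambda>\<theta> \<theta>' d. of_bool (est (fst d) \<noteq> opt_act m \<theta>) + of_bool (est (fst d) \<noteq> opt_act m \<theta>'))"
      by (rule resample_mono[OF J]) (auto simp: ne_def)
    also have "\<dots> \<le> ennreal e + ennreal e"
      using est resample_fst[OF J mest] resample_snd[OF J mest]
      by (subst resample_add[OF J resample_measurable_fst[OF mest] resample_measurable_snd[OF mest]]) (auto intro!: add_mono)
    finally show ?thesis using e by (simp add: ennreal_plus[symmetric] del: ennreal_plus)
  qed
  have bc: "(\<integral>\<^sup>+z. ennreal (inaccurate_count m y (fst z) (snd (snd z))) \<partial>J) \<le> ennreal (N * b)"
  proof -
    have "(\<integral>\<^sup>+z. ennreal (inaccurate_count m y (fst z) (snd (snd z))) \<partial>J)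
       = (\<integral>\<^sup>+z. (\<Sum>x\<in>triples m. of_bool (inaccurate m y (fst z) (snd (snd z)) x)) \<partial>J)"
      by (intro nn_integral_cong) (simp add: inaccurate_count_def sum_ennreal[symmetric] of_bool_def del: sum_ennreal, intro sum.cong refl, simp)
    also have "\<dots> = (\<Sum>x\<in>triples m. \<integral>\<^sup>+z. of_bool (inaccurate m y (fst z) (snd (snd z)) x) \<partial>J)"
    proof (rule nn_integral_sum)
      fix x assume x: "x \<in> triples m"
      have "(\<lambda>z :: kernel \<times> data. of_bool (inaccurate m y (fst z) (snd (snd z)) x) :: ennreal) \<in> borel_measurable joint"
      proof (rule measurable_joint)
        fix d :: data
        note [measurable] = measurable_inaccurate[OF x, of y "snd d"]
        show "(\<lambda>\<theta>. of_bool (inaccurate m y (fst (\<theta>, d)) (snd (snd (\<theta>, d))) x) :: ennreal) \<in> borel_measurable \<mu>"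
          unfolding of_bool_def fst_conv snd_conv by measurable
      qed
      then show "(\<lambda>z. of_bool (inaccurate m y (fst z) (snd (snd z)) x) :: ennreal) \<in> borel_measurable J"
        by (simp cong: measurable_cong_sets add: sJ)
    qed
    also have "\<dots> \<le> (\<Sum>x\<in>triples m. ennreal b)" by (intro sum_mono inaccurate)
    also have "\<dots> = ennreal (N * b)"
      using b by (simp add: N_def ennreal_mult ennreal_of_nat_eq_real_of_nat mult.assoc)
    finally show ?thesis .
  qed
  have Rb: "?R (\<lambda>\<theta> \<theta>' d. ennreal (inaccurate_count m y \<theta> (snd d))) \<le> ennreal (N * b)"
    "?R (\<lambda>\<theta> \<theta>' d. ennreal (inaccurate_count m y \<theta>' (snd d))) \<le> ennreal (N * b)"
    using bc resample_fst[OF J mb] resample_snd[OF J mb] by auto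
  have N0: "0 \<le> N" by (simp add: N_def)
  have "?R ?W \<le> ennreal (H\<^sup>2 * \<kappa> / 2) * ennreal (2 * e) + ennreal (2 * y * H / \<kappa>) * ?R expected_increment
     + ennreal (2 * H / \<kappa>) * (ennreal (N * b) + ennreal (N * b))"
    unfolding W by (intro add_mono mult_left_mono Rne Rb order_refl) auto
  also have "\<dots> = ennreal (H\<^sup>2 * \<kappa> * e + 4 * H / \<kappa> * N * b) + ennreal (2 * y * H / \<kappa>) * ?R expected_increment"
  proof -
    have "ennreal (H\<^sup>2 * \<kappa> / 2) * ennreal (2 * e) + ennreal (2 * H / \<kappa>) * (ennreal (N * b) + ennreal (N * b))
      = ennreal (H\<^sup>2 * \<kappa> * e + 4 * H / \<kappa> * N * b)"
      using \<kappa> H0 e b N0 by (simp add: ennreal_plus[symmetric] ennreal_mult[symmetric] del: ennreal_plus)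
    then show ?thesis by (simp add: add_ac)
  qed
  finally have "ennreal (H + 1) + ?R ?W \<le> ennreal (H + 1) + (ennreal (H\<^sup>2 * \<kappa> * e + 4 * H / \<kappa> * N * b) + ennreal (2 * y * H / \<kappa>) * ?R expected_increment)"
    by (rule add_left_mono)
  also have "\<dots> = ennreal (H + 1 + H\<^sup>2 * \<kappa> * e + 4 * H / \<kappa> * N * b) + ennreal (2 * y * H / \<kappa>) * ?R expected_increment"
    using \<kappa> H0 e b N0 by (simp add: ennreal_plus[symmetric] add.assoc[symmetric] del: ennreal_plus)
  finally show ?thesis using main by (rule order_trans[rotated])
qed

definition total_regret :: "kernel \<times> data \<Rightarrow> ennreal" where
  "total_regret x = (\<Sum>\<tau>\<leftarrow>snd (snd x). step_regret (fst x) \<tau>)"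

lemma measurable_total_regret: "total_regret \<in> borel_measurable joint"
  unfolding total_regret_def
  by (rule measurable_joint) (simp add: borel_measurable_sum_list measurable_step_regret)

lemma measurable_potential: "(\<lambda>x. ennreal (potential m (snd (snd x)))) \<in> borel_measurable joint"
  by (rule measurable_joint) simp

text \<open>The recursion for any functional that is additive in the episodes. Applied to the
  shifted regret and to the potential, it makes their growths comparable episode by episode.\<close>

lemma nn_integral_snoc:
  assumes f: "f \<in> borel_measurable joint"
    and g: "\<And>d \<tau>. (\<lambda>\<theta>. g \<theta> d \<tau>) \<in> borel_measurable \<mu>"
    and G: "resample_measurable (\<lambda>\<theta> \<theta>' d. \<integral>\<^sup>+\<tau>. g \<theta> d \<tau> \<partial>measure_pmf (traj_law m \<theta> (opt_policy m \<theta>')))"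
    and snoc: "\<And>\<theta> d \<tau>. \<theta> \<in> space \<mu> \<Longrightarrow> \<tau> \<in> trajs m \<Longrightarrow> f (\<theta>, fst d, snd d @ [\<tau>]) = f (\<theta>, d) + g \<theta> d \<tau>"
  shows "(\<integral>\<^sup>+x. f x \<partial>ipsrl m \<mu> \<beta> L (Suc t)) = (\<integral>\<^sup>+x. f x \<partial>ipsrl m \<mu> \<beta> L t)
    + resample (ipsrl m \<mu> \<beta> L t) (\<lambda>\<theta> \<theta>' d. \<integral>\<^sup>+\<tau>. g \<theta> d \<tau> \<partial>measure_pmf (traj_law m \<theta> (opt_policy m \<theta>')))"
proof -
  let ?J = "ipsrl m \<mu> \<beta> L t"
  have mf: "(\<lambda>\<theta>. f (\<theta>, d)) \<in> borel_measurable \<mu>" for d by (rule measurable_joint_section[OF f])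
  have "(\<integral>\<^sup>+x. f x \<partial>ipsrl m \<mu> \<beta> L (Suc t))
    = resample ?J (\<lambda>\<theta> \<theta>' d. f (\<theta>, d) + (\<integral>\<^sup>+\<tau>. g \<theta> d \<tau> \<partial>measure_pmf (traj_law m \<theta> (opt_policy m \<theta>'))))"
    unfolding nn_integral_ipsrl_Suc[OF f] resample_def
  proof (intro nn_integral_cong)
    fix x \<theta>' assume "x \<in> space ?J"
    then have \<theta>: "fst x \<in> space \<mu>" by (auto simp: space_ipsrl space_pair_measure)
    then have AE: "AE \<tau> in traj_law m (fst x) (opt_policy m \<theta>'). \<tau> \<in> trajs m"
      using set_opt_traj[OF \<theta>, of \<theta>'] by (auto simp: AE_measure_pmf_iff)
    have "(\<integral>\<^sup>+\<tau>. f (fst x, fst (snd x), snd (snd x) @ [\<tau>]) \<partial>measure_pmf (traj_law m (fst x) (opt_policy m \<theta>')))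
      = (\<integral>\<^sup>+\<tau>. f (fst x, snd x) + g (fst x) (snd x) \<tau> \<partial>measure_pmf (traj_law m (fst x) (opt_policy m \<theta>')))"
      by (rule nn_integral_cong_AE) (use AE in eventually_elim, rule snoc[OF \<theta>])
    also have "\<dots> = f (fst x, snd x) + (\<integral>\<^sup>+\<tau>. g (fst x) (snd x) \<tau> \<partial>measure_pmf (traj_law m (fst x) (opt_policy m \<theta>')))"
      by (subst nn_integral_add) (auto simp: measure_pmf.emeasure_space_1[simplified])
    finally show "(\<integral>\<^sup>+\<tau>. f (fst x, fst (snd x), snd (snd x) @ [\<tau>]) \<partial>measure_pmf (traj_law m (fst x) (opt_policy m \<theta>')))
      = f (fst x, snd x) + (\<integral>\<^sup>+\<tau>. g (fst x) (snd x) \<tau> \<partial>measure_pmf (traj_law m (fst x) (opt_policy m \<theta>')))" .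
  qed
  also have "\<dots> = resample ?J (\<lambda>\<theta> \<theta>' d. f (\<theta>, d)) + resample ?J (\<lambda>\<theta> \<theta>' d. \<integral>\<^sup>+\<tau>. g \<theta> d \<tau> \<partial>measure_pmf (traj_law m \<theta> (opt_policy m \<theta>')))"
    by (rule resample_add[OF ipsrl_in resample_measurable_fst[OF mf] G])
  also have "resample ?J (\<lambda>\<theta> \<theta>' d. f (\<theta>, d)) = (\<integral>\<^sup>+x. f x \<partial>?J)"
    using resample_fst[OF ipsrl_in, of "\<lambda>\<theta> d. f (\<theta>, d)", OF mf] by simp
  finally show ?thesis .
qed

lemma nn_integral_total_regret_Suc:
  "(\<integral>\<^sup>+x. total_regret x \<partial>ipsrl m \<mu> \<beta> L (Suc t)) = (\<integral>\<^sup>+x. total_regret x \<partial>ipsrl m \<mu> \<beta> L t)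
    + resample (ipsrl m \<mu> \<beta> L t) (\<lambda>\<theta> \<theta>' d. ennreal (real (hor m) + 1 + pvalue m \<theta> (opt_act m \<theta>) - pvalue m \<theta> (opt_act m \<theta>')))"
proof -
  let ?G = "\<lambda>\<theta> \<theta>' (d :: data). \<integral>\<^sup>+\<tau>. step_regret \<theta> \<tau> \<partial>measure_pmf (traj_law m \<theta> (opt_policy m \<theta>'))"
  let ?G' = "\<lambda>\<theta> \<theta>' (d :: data). ennreal (real (hor m) + 1 + pvalue m \<theta> (opt_act m \<theta>) - pvalue m \<theta> (opt_act m \<theta>'))"
  have mv: "(\<lambda>x. pvalue m (fst x) (opt_act m (snd x))) \<in> borel_measurable (\<mu> \<Otimes>\<^sub>M \<mu>)"
    using measurable_pvalue by (simp add: split_beta')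
  have mdiag: "(\<lambda>\<theta>. pvalue m \<theta> (opt_act m \<theta>)) \<in> borel_measurable \<mu>"
    using measurable_compose[OF measurable_Pair[OF measurable_ident measurable_ident] mv] by simp
  note [measurable] = mv measurable_compose[OF measurable_fst mdiag]
  have eq: "?G (fst x) (snd x) d = ?G' (fst x) (snd x) d" if "x \<in> space (\<mu> \<Otimes>\<^sub>M \<mu>)" for x d
    using that by (intro nn_integral_step_regret) (auto simp: space_pair_measure)
  have G: "resample_measurable ?G"
    by (rule resample_measurableI, subst measurable_cong[OF eq]) measurable
  have "(\<integral>\<^sup>+x. total_regret x \<partial>ipsrl m \<mu> \<beta> L (Suc t)) = (\<integral>\<^sup>+x. total_regret x \<partial>ipsrl m \<mu> \<beta> L t)
    + resample (ipsrl m \<mu> \<beta> L t) ?G"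
    by (rule nn_integral_snoc[OF measurable_total_regret measurable_step_regret G])
       (simp add: total_regret_def)
  also have "resample (ipsrl m \<mu> \<beta> L t) ?G = resample (ipsrl m \<mu> \<beta> L t) ?G'"
    by (intro antisym resample_mono[OF ipsrl_in]) (simp_all add: nn_integral_step_regret)
  finally show ?thesis .
qed

lemma nn_integral_potential_Suc:
  "(\<integral>\<^sup>+x. ennreal (potential m (snd (snd x))) \<partial>ipsrl m \<mu> \<beta> L (Suc t))
    = (\<integral>\<^sup>+x. ennreal (potential m (snd (snd x))) \<partial>ipsrl m \<mu> \<beta> L t) + resample (ipsrl m \<mu> \<beta> L t) expected_increment"
proof (rule nn_integral_snoc[OF measurable_potential])
  show "resample_measurable expected_increment"
    by (rule resample_measurableI) (use measurable_inner_nn_integral in \<open>simp add: split_beta'\<close>)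
qed (simp_all add: potential_snoc potential_nonneg increment_nonneg)

text \<open>The expected potential at time \<open>t\<close> stays on the right-hand side, so that
  the expected increments are absorbed exactly instead of being bounded one at a time. The failure
  level \<open>b\<close> refers to the final \<open>T\<close> and serves all earlier
  episodes.\<close>

lemma total_regret_le:
  fixes est :: "traj list \<Rightarrow> nat \<Rightarrow> nat \<Rightarrow> nat"
  defines "H \<equiv> real (hor m)" and "N \<equiv> real (hor m) * real (nS m) * real (nA m)"
  assumes \<kappa>: "0 < \<kappa>" and y: "1 \<le> y" and e: "0 \<le> e"
    and est: "\<And>\<theta>. \<theta> \<in> space \<mu> \<Longrightarrow>
      measure_pmf.prob (replicate_pmf L (traj_law m \<theta> (expert m \<beta> \<theta>))) {D. est D \<noteq> opt_act m \<theta>} \<le> e"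
    and b: "b = real T * 2 ^ nS m * exp (- y / 2)"
  shows "t \<le> T \<Longrightarrow> (\<integral>\<^sup>+x. total_regret x \<partial>ipsrl m \<mu> \<beta> L t)
    \<le> ennreal (real t * (H + 1 + H\<^sup>2 * \<kappa> * e + 4 * H / \<kappa> * N * b))
      + ennreal (2 * y * H / \<kappa>) * (\<integral>\<^sup>+x. ennreal (potential m (snd (snd x))) \<partial>ipsrl m \<mu> \<beta> L t)"
proof (induction t)
  case 0
  show ?case
    unfolding nn_integral_ipsrl_0[OF measurable_total_regret] by (simp add: total_regret_def)
next
  case (Suc t)
  let ?J = "ipsrl m \<mu> \<beta> L t" and ?a = "H + 1 + H\<^sup>2 * \<kappa> * e + 4 * H / \<kappa> * N * b" and ?c = "2 * y * H / \<kappa>"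
  let ?P = "\<lambda>t. \<integral>\<^sup>+x. ennreal (potential m (snd (snd x))) \<partial>ipsrl m \<mu> \<beta> L t"
  have b0: "0 \<le> b" by (simp add: b)
  have a0: "0 \<le> ?a" using \<kappa> e b0 by (simp add: H_def N_def)
  have step: "resample ?J (\<lambda>\<theta> \<theta>' d. ennreal (H + 1 + pvalue m \<theta> (opt_act m \<theta>) - pvalue m \<theta> (opt_act m \<theta>')))
    \<le> ennreal ?a + ennreal ?c * resample ?J expected_increment"
    unfolding H_def N_def
    using y Suc.prems unfolding b
    by (intro resample_regret_le[OF ipsrl_in _ \<kappa> y e _ nn_integral_estimate_wrong[OF est]] nn_integral_inaccurate)
       (auto simp: emeasure_ipsrl space_ipsrl)
  have "(\<integral>\<^sup>+x. total_regret x \<partial>ipsrl m \<mu> \<beta> L (Suc t))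
    \<le> (ennreal (real t * ?a) + ennreal ?c * ?P t) + (ennreal ?a + ennreal ?c * resample ?J expected_increment)"
    unfolding nn_integral_total_regret_Suc using Suc step by (intro add_mono) (auto simp: H_def)
  also have "\<dots> = (ennreal (real t * ?a) + ennreal ?a) + ennreal ?c * (?P t + resample ?J expected_increment)"
    by (simp only: distrib_left add_ac)
  also have "ennreal (real t * ?a) + ennreal ?a = ennreal (real (Suc t) * ?a)"
  proof -
    have "real t * ?a + ?a = real (Suc t) * ?a" by (simp only: of_nat_Suc distrib_right mult_1_left add.commute)
    moreover have "ennreal (real t * ?a) + ennreal ?a = ennreal (real t * ?a + ?a)"
      using a0 by (intro ennreal_plus[symmetric] mult_nonneg_nonneg) auto
    ultimately show ?thesis by simp
  qed
  also have "?P t + resample ?J expected_increment = ?P (Suc t)"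
    by (rule nn_integral_potential_Suc[symmetric])
  finally show ?case .
qed

text \<open>Returns from nonnegative to real integrals: the shift, \<open>H + 1\<close> per episode,
  appears on both sides and cancels. Only here is the potential bounded, using that the history
  almost surely has length \<open>T\<close>.\<close>

lemma bayes_regret_le:
  fixes est :: "traj list \<Rightarrow> nat \<Rightarrow> nat \<Rightarrow> nat"
  defines "H \<equiv> real (hor m)" and "N \<equiv> real (hor m) * real (nS m) * real (nA m)"
  assumes \<kappa>: "0 < \<kappa>" and y: "1 \<le> y" and e: "0 \<le> e" and T: "1 \<le> T"
    and est: "\<And>\<theta>. \<theta> \<in> space \<mu> \<Longrightarrow>
      measure_pmf.prob (replicate_pmf L (traj_law m \<theta> (expert m \<beta> \<theta>))) {D. est D \<noteq> opt_act m \<theta>} \<le> e"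
    and b: "b = real T * 2 ^ nS m * exp (- y / 2)"
  shows "bayes_regret m \<mu> \<beta> L T
    \<le> real T * (H\<^sup>2 * \<kappa> * e + 4 * H / \<kappa> * N * b) + 2 * y * H / \<kappa> * (N * (2 + ln (real T)))"
proof -
  let ?J = "ipsrl m \<mu> \<beta> L T"
  let ?bound = "real T * (H\<^sup>2 * \<kappa> * e + 4 * H / \<kappa> * N * b) + 2 * y * H / \<kappa> * (N * (2 + ln (real T)))"
  interpret J: prob_space ?J by (rule prob_ipsrl)
  have b0: "0 \<le> b" by (simp add: b)
  have H0: "0 \<le> H" and N0: "0 \<le> N" by (auto simp: H_def N_def)
  have l0: "0 \<le> ln (real T)" using T by simp
  have bound0: "0 \<le> ?bound" using \<kappa> e b0 H0 N0 y l0 by simp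
  let ?f = "\<lambda>x :: kernel \<times> data. \<Sum>\<tau>\<leftarrow>snd (snd x). V m (fst x) 0 (state_at 0 \<tau>) - total_reward m \<tau>"
  have br: "bayes_regret m \<mu> \<beta> L T = (\<integral>x. ?f x \<partial>?J)"
    by (simp add: bayes_regret_def split_beta')
  show ?thesis
  proof (cases "integrable ?J ?f")
    \<comment> \<open>The integrand may fail to be measurable at histories outside the state space, where the sigma-algebra
      says nothing about the kernel. A non-integrable function has integral 0.\<close>
    case False
    then have "bayes_regret m \<mu> \<beta> L T = 0" unfolding br by (rule not_integrable_integral_eq)
    then show ?thesis using bound0 by simp
  next
    case True
    have AE: "AE x in ?J. length (snd (snd x)) = T \<and> set (snd (snd x)) \<subseteq> trajs m"
      by (rule AE_ipsrl_hist)
    \<comment> \<open>Pointwise link between the real and the shifted regret. Nonnegativity is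
      carried along because \<open>ennreal\<close> respects sums only of nonnegative terms.\<close>
    have shift: "ennreal (real (length D) * (H + 1) + (\<Sum>\<tau>\<leftarrow>D. V m \<theta> 0 (state_at 0 \<tau>) - total_reward m \<tau>)) = (\<Sum>\<tau>\<leftarrow>D. step_regret \<theta> \<tau>)
      \<and> 0 \<le> real (length D) * (H + 1) + (\<Sum>\<tau>\<leftarrow>D. V m \<theta> 0 (state_at 0 \<tau>) - total_reward m \<tau>)"
      if \<theta>: "\<theta> \<in> kernels m" and D: "set D \<subseteq> trajs m" for D \<theta>
      using D
    proof (induction D)
      case (Cons \<tau> D)
      have 1: "0 \<le> H + 1 + V m \<theta> 0 (state_at 0 \<tau>) - total_reward m \<tau>"
        using step_regret_nonneg[OF \<theta>, of \<tau>] Cons.prems by (simp add: H_def)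
      let ?s = "\<Sum>\<tau>\<leftarrow>D. V m \<theta> 0 (state_at 0 \<tau>) - total_reward m \<tau>"
      have IH: "ennreal (real (length D) * (H + 1) + ?s) = (\<Sum>\<tau>\<leftarrow>D. step_regret \<theta> \<tau>)" "0 \<le> real (length D) * (H + 1) + ?s"
        using Cons by auto
      have eq: "real (length (\<tau> # D)) * (H + 1) + (\<Sum>\<tau>\<leftarrow>\<tau> # D. V m \<theta> 0 (state_at 0 \<tau>) - total_reward m \<tau>)
        = (H + 1 + V m \<theta> 0 (state_at 0 \<tau>) - total_reward m \<tau>) + (real (length D) * (H + 1) + ?s)"
        by (simp add: algebra_simps)
      have "step_regret \<theta> \<tau> = ennreal (H + 1 + V m \<theta> 0 (state_at 0 \<tau>) - total_reward m \<tau>)"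
        using Cons.prems by (simp add: step_regret_def H_def)
      then show ?case
        unfolding eq using 1 IH by (simp add: ennreal_plus)
    qed simp
    have kern: "fst x \<in> kernels m" if "x \<in> space ?J" for x
      using that by (intro in_kernels) (auto simp: space_ipsrl space_pair_measure)
    have AE': "AE x in ?J. ennreal (real T * (H + 1) + ?f x) = total_regret x \<and> 0 \<le> real T * (H + 1) + ?f x"
      using AE AE_space
    proof eventually_elim
      case (elim x)
      then show ?case using shift[OF kern, of x "snd (snd x)"] by (simp add: total_regret_def)
    qed
    have int: "integrable ?J (\<lambda>x. real T * (H + 1) + ?f x)" using True by simp
    have "ennreal (real T * (H + 1) + bayes_regret m \<mu> \<beta> L T) = ennreal (\<integral>x. real T * (H + 1) + ?f x \<partial>?J)"
      unfolding br using True by (simp add: J.prob_space)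
    also have "\<dots> = (\<integral>\<^sup>+x. ennreal (real T * (H + 1) + ?f x) \<partial>?J)"
      by (rule nn_integral_eq_integral[OF int, symmetric]) (use AE' in eventually_elim, simp)
    also have "\<dots> = (\<integral>\<^sup>+x. total_regret x \<partial>?J)"
      by (rule nn_integral_cong_AE) (use AE' in eventually_elim, simp)
    also have "\<dots> \<le> ennreal (real T * (H + 1 + H\<^sup>2 * \<kappa> * e + 4 * H / \<kappa> * N * b))
      + ennreal (2 * y * H / \<kappa>) * (\<integral>\<^sup>+x. ennreal (potential m (snd (snd x))) \<partial>?J)"
      unfolding H_def N_def by (rule total_regret_le[OF \<kappa> y e est b order_refl])
    also have "(\<integral>\<^sup>+x. ennreal (potential m (snd (snd x))) \<partial>?J) \<le> (\<integral>\<^sup>+x. ennreal (N * (2 + ln (real T))) \<partial>?J)"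
      by (rule nn_integral_mono_AE) (use AE in eventually_elim, use T in \<open>auto simp: N_def intro!: ennreal_leI potential_le\<close>)
    also have "\<dots> = ennreal (N * (2 + ln (real T)))" by (simp add: J.emeasure_space_1)
    also have "ennreal (real T * (H + 1 + H\<^sup>2 * \<kappa> * e + 4 * H / \<kappa> * N * b))
      + ennreal (2 * y * H / \<kappa>) * ennreal (N * (2 + ln (real T))) = ennreal (real T * (H + 1) + ?bound)"
      using \<kappa> e b0 H0 N0 y l0
      by (simp add: ennreal_plus[symmetric] ennreal_mult[symmetric] algebra_simps del: ennreal_plus)
    finally have "ennreal (real T * (H + 1) + bayes_regret m \<mu> \<beta> L T) \<le> ennreal (real T * (H + 1) + ?bound)"
      by (simp add: add_left_mono mult_left_mono)
    then have "real T * (H + 1) + bayes_regret m \<mu> \<beta> L T \<le> real T * (H + 1) + ?bound"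
      using bound0 H0 by (subst (asm) ennreal_le_iff) auto
    then show ?thesis by simp
  qed
qed

end

section \<open>The regret bound\<close>

lemma p_min_le:
  assumes "\<theta> \<in> \<Theta>" "h < hor m" "s < nS m" "0 < p_opt m h s \<theta>"
  shows "p_min m \<Theta> \<le> p_opt m h s \<theta>"
  unfolding p_min_def
proof (rule cInf_lower)
  show "p_opt m h s \<theta> \<in> {p_opt m h s \<theta> | h s \<theta>. h < hor m \<and> s < nS m \<and> \<theta> \<in> \<Theta> \<and> p_opt m h s \<theta> > 0}"
    using assms by blast
  show "bdd_below {p_opt m h s \<theta> | h s \<theta>. h < hor m \<and> s < nS m \<and> \<theta> \<in> \<Theta> \<and> p_opt m h s \<theta> > 0}"
    by (rule bdd_belowI[of _ 0]) auto
qed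

lemma p_opt_eq_occ:
  assumes "valid_mdp m" "h \<le> hor m"
  shows "p_opt m h s \<theta> = pmf (occ m \<theta> (det (opt_act m \<theta>)) h) s"
  using assms by (simp add: p_opt_def opt_policy_eq state_prob_eq_occ valid_mdp_def)

text \<open>Any state charged by the initial law is reached at period 0 with positive probability,
  so the infimum is over a nonempty set with an element at most one. The Chernoff bounds assume this
  of their parameter.\<close>

lemma (in prior_mdp) p_min_le_1: "p_min m \<Theta> \<le> 1"
proof -
  obtain \<theta> where \<theta>: "\<theta> \<in> \<Theta>" using not_empty space_prior by auto
  obtain s where s: "s \<in> set_pmf (init m)" using set_pmf_not_empty[of "init m"] by auto
  have "p_opt m 0 s \<theta> = pmf (init m) s" by (simp add: p_opt_eq_occ[OF valid])
  moreover have "0 < pmf (init m) s" using s by (simp add: pmf_positive_iff)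
  ultimately show ?thesis
    using p_min_le[OF \<theta>, of 0 m s] valid s pmf_le_1[of "init m" s] by (auto simp: valid_mdp_def)
qed

text \<open>Uses \<open>\<eta> = A * exp (- \<beta> * \<Delta>)\<close> as the expert's error per
  period. The condition on \<open>\<beta>\<close> only asks that H such errors stay below a sixth of
  \<open>(p_min m \<Theta>)\<^sup>2\<close>, so the sample size does not occur in it.\<close>

lemma (in prior_mdp) prob_estimate_wrong_le_eps:
  assumes p: "0 < p_min m \<Theta>" and \<Delta>: "0 < \<Delta>" and \<beta>: "0 \<le> \<beta>"
    and gap: "\<forall>\<theta>\<in>\<Theta>. \<forall>h<hor m. \<forall>s<nS m. \<exists>a<nA m. \<forall>a'<nA m. a' \<noteq> a \<longrightarrow> Q m \<theta> h s a \<ge> Q m \<theta> h s a' + \<Delta>"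
    and \<eta>: "real (hor m) * (real (nA m) * exp (- \<beta> * \<Delta>)) \<le> (p_min m \<Theta>)\<^sup>2 / 6"
    and \<theta>: "\<theta> \<in> \<Theta>"
  shows "measure_pmf.prob (replicate_pmf L (traj_law m \<theta> (expert m \<beta> \<theta>)))
     {D. estimate m (real L * p_min m \<Theta> / 2) D \<noteq> opt_act m \<theta>} \<le> eps m \<Theta> L"
proof -
  let ?p = "p_min m \<Theta>"
  have \<theta>k: "\<theta> \<in> kernels m" using \<theta> kernels by auto
  have "measure_pmf.prob (replicate_pmf L (traj_law m \<theta> (expert m \<beta> \<theta>)))
     {D. estimate m (real L * ?p / 2) D \<noteq> opt_act m \<theta>} \<le> 2 * real (nS m) * real (hor m) * exp (- real L * ?p\<^sup>2 / 18)"
  proof (rule prob_estimate_wrong[OF valid \<theta>k expert_policies[OF valid] p p_min_le_1 _ \<eta>])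
    show "1 - real (nA m) * exp (- \<beta> * \<Delta>) \<le> pmf (expert m \<beta> \<theta> h s) (greedy m \<theta> h s)"
      if "h < hor m" "s < nS m" for h s
      using gap \<theta> that by (intro pmf_expert_greedy_ge[OF nA_pos[OF valid] \<beta> _ \<Delta>]) blast
    show "?p \<le> pmf (occ m \<theta> (det (opt_act m \<theta>)) h) s"
      if "h < hor m" "s \<in> set_pmf (occ m \<theta> (det (opt_act m \<theta>)) h)" for h s
    proof -
      have "s < nS m" using set_occ[OF valid \<theta>k opt_policy_in[OF valid], of h \<theta>] that by auto
      then show ?thesis
        using p_min_le[OF \<theta> that(1), of s] that by (simp add: p_opt_eq_occ[OF valid] pmf_positive_iff)
    qed
  qed simp
  also have "\<dots> \<le> 2 * real (nS m) * real (hor m) * (exp (- real L * ?p\<^sup>2 / 18) + exp (- real L * ?p / 36))"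
    by (intro mult_left_mono) auto
  finally show ?thesis by (simp add: eps_def)
qed

lemma exists_beta_threshold:
  assumes "0 < p" "0 < \<Delta>" "0 < c"
  shows "\<exists>\<beta>\<^sub>0\<ge>0. \<forall>\<beta>\<ge>\<beta>\<^sub>0. c * exp (- \<beta> * \<Delta>) \<le> (p :: real)"
proof (intro exI conjI allI impI)
  fix \<beta> assume "max 0 (ln (c / p) / \<Delta>) \<le> \<beta>"
  then have "ln (c / p) \<le> \<beta> * \<Delta>" using assms by (simp add: pos_divide_le_eq)
  then have "exp (ln (c / p)) \<le> exp (\<beta> * \<Delta>)" by simp
  then have "c / p \<le> exp (\<beta> * \<Delta>)" using assms by simp
  then show "c * exp (- \<beta> * \<Delta>) \<le> p" using assms by (simp add: exp_minus field_simps)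
qed simp

text \<open>\<open>\<kappa>\<close> is chosen so that the term with \<open>e\<close> equals the
  square root times \<open>l\<close>. The failure term then costs at most 4 times this and the
  potential term at most 16 times, as y is at most \<open>4 * (S * l)\<close> and 2 + ln T at most
  \<open>2 * l\<close>; together 21.\<close>

lemma regret_bound_arithmetic:
  fixes H S A T e :: real
  assumes H: "1 \<le> H" and S: "1 \<le> S" and A: "1 \<le> A" and T: "1 \<le> T" and e: "0 < e"
  defines "l \<equiv> 1 + ln T"
  defines "\<kappa> \<equiv> S * A * l / sqrt (A * e * T)" and "y \<equiv> 2 * (S * ln 2 + 2 * ln T)"
  shows "T * (H\<^sup>2 * \<kappa> * e + 4 * H / \<kappa> * (H * S * A) * (1 / T)) + 2 * y * H / \<kappa> * (H * S * A * (2 + ln T))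
    \<le> 21 * sqrt (e * H ^ 4 * S\<^sup>2 * A * T) * l"
proof -
  define q where "q = sqrt (A * e * T)"
  have q: "0 < q" using A e T by (simp add: q_def)
  have qq: "A * e * T = q * q" using A e T by (simp add: q_def)
  have l: "1 \<le> l" using T by (simp add: l_def)
  have G: "sqrt (e * H ^ 4 * S\<^sup>2 * A * T) = H\<^sup>2 * S * q"
  proof -
    have "e * H ^ 4 * S\<^sup>2 * A * T = (H\<^sup>2 * S)\<^sup>2 * (A * e * T)" by (simp add: power_mult_distrib mult_ac)
    moreover have "0 \<le> H\<^sup>2 * S" using S by simp
    ultimately show ?thesis by (simp only: real_sqrt_mult real_sqrt_abs abs_of_nonneg q_def)
  qed
  have \<kappa>: "\<kappa> = S * A * l / q" by (simp add: \<kappa>_def q_def)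
  have HSq: "0 \<le> H\<^sup>2 * S * q" using S q by simp
  have 1: "T * (H\<^sup>2 * \<kappa> * e) = H\<^sup>2 * S * q * l"
  proof -
    have "T * (H\<^sup>2 * \<kappa> * e) = H\<^sup>2 * S * l * (A * e * T) / q" by (simp add: \<kappa> mult_ac)
    also have "\<dots> = H\<^sup>2 * S * l * (q * q) / q" by (simp only: qq)
    also have "\<dots> = H\<^sup>2 * S * q * l" using q by simp
    finally show ?thesis .
  qed
  have 2: "T * (4 * H / \<kappa> * (H * S * A) * (1 / T)) \<le> 4 * (H\<^sup>2 * S * q * l)"
  proof -
    have "T * (4 * H / \<kappa> * (H * S * A) * (1 / T)) = 4 * (H\<^sup>2 * q) / l"
      using q S A l T by (simp add: \<kappa> field_simps power2_eq_square)
    also have "\<dots> \<le> 4 * (H\<^sup>2 * q) / 1" using l q by (intro divide_left_mono) auto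
    also have "\<dots> = 4 * (H\<^sup>2 * 1 * q * 1)" by simp
    also have "\<dots> \<le> 4 * (H\<^sup>2 * S * q * l)" using S l q by (intro mult_left_mono mult_mono) auto
    finally show ?thesis .
  qed
  have 3: "2 * y * H / \<kappa> * (H * S * A * (2 + ln T)) \<le> 16 * (H\<^sup>2 * S * q * l)"
  proof -
    have "ln (2 :: real) \<le> 1" using ln_2_less_1 by simp
    then have "S * ln 2 \<le> S" using S by (simp add: mult_left_le)
    moreover have "1 * ln T \<le> S * ln T" using S T by (intro mult_right_mono) auto
    ultimately have y: "y \<le> 4 * (S * l)"
      using S unfolding y_def l_def distrib_left by linarith
    have "2 * y * H / \<kappa> * (H * S * A * (2 + ln T)) = 2 * H\<^sup>2 * q / l * (y * (2 + ln T))"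
      using q S A l by (simp add: \<kappa> field_simps power2_eq_square)
    also have "\<dots> \<le> 2 * H\<^sup>2 * q / l * (4 * (S * l) * (2 * l))"
      using y q l S T by (intro mult_left_mono mult_mono) (auto simp: l_def)
    also have "\<dots> = 16 * (H\<^sup>2 * S * q * l)" using l by (simp add: field_simps)
    finally show ?thesis .
  qed
  show ?thesis unfolding G distrib_left[of T] mult.assoc[of 21] using 1 2 3 by linarith
qed

theorem theorem3p5:
  shows "\<exists>C::real. \<forall>m \<Theta> \<mu>.
    valid_mdp m \<and> is_prior m \<Theta> \<mu> \<and> uniform_gap m \<Theta> \<and> p_min m \<Theta> > 0 \<longrightarrow>
    (\<exists>\<beta>\<^sub>0\<ge>0. \<forall>\<beta>\<ge>\<beta>\<^sub>0. \<forall>L\<ge>1. \<forall>T\<ge>1.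
       bayes_regret m \<mu> \<beta> L T \<le>
         C * sqrt (eps m \<Theta> L * real (hor m) ^ 4 * real (nS m) ^ 2 * real (nA m) * real T)
           * (1 + ln (real T)))"
proof (rule exI[of _ 21], intro allI impI, elim conjE)
  fix m \<Theta> \<mu>
  assume "valid_mdp m" "is_prior m \<Theta> \<mu>" and gap: "uniform_gap m \<Theta>" and p: "p_min m \<Theta> > 0"
  then interpret prior_mdp m \<Theta> \<mu> by unfold_locales
  let ?p = "p_min m \<Theta>" and ?H = "real (hor m)" and ?S = "real (nS m)" and ?A = "real (nA m)"
  obtain \<Delta> where \<Delta>: "0 < \<Delta>"
    "\<forall>\<theta>\<in>\<Theta>. \<forall>h<hor m. \<forall>s<nS m. \<exists>a<nA m. \<forall>a'<nA m. a' \<noteq> a \<longrightarrow> Q m \<theta> h s a \<ge> Q m \<theta> h s a' + \<Delta>"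
    using gap by (auto simp: uniform_gap_def)
  have H: "1 \<le> ?H" using valid by (simp add: valid_mdp_def)
  have A: "1 \<le> ?A" using nA_pos[OF valid] by simp
  have S: "1 \<le> ?S"
    using valid set_pmf_not_empty[of "init m"] by (cases "nS m") (auto simp: valid_mdp_def)
  obtain \<beta>\<^sub>0 where \<beta>\<^sub>0: "0 \<le> \<beta>\<^sub>0" "\<And>\<beta>. \<beta>\<^sub>0 \<le> \<beta> \<Longrightarrow> ?H * ?A * exp (- \<beta> * \<Delta>) \<le> ?p\<^sup>2 / 6"
    using exists_beta_threshold[of "?p\<^sup>2 / 6" \<Delta> "?H * ?A"] p \<Delta>(1) H A by auto
  show "\<exists>\<beta>\<^sub>0\<ge>0. \<forall>\<beta>\<ge>\<beta>\<^sub>0. \<forall>L\<ge>1. \<forall>T\<ge>1. bayes_regret m \<mu> \<beta> L T \<le>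
         21 * sqrt (eps m \<Theta> L * ?H ^ 4 * ?S ^ 2 * ?A * real T) * (1 + ln (real T))"
  proof (intro exI[of _ \<beta>\<^sub>0] conjI allI impI \<beta>\<^sub>0(1))
    fix \<beta> :: real and L T :: nat assume \<beta>: "\<beta>\<^sub>0 \<le> \<beta>" and T: "1 \<le> T"
    let ?e = "eps m \<Theta> L"
    \<comment> \<open>Chosen so that \<open>exp (- y / 2)\<close> is 2^(-S) / T^2, which cancels the
      number of sign patterns and one union over visit counts and leaves 1 / T.\<close>
    define y where "y = 2 * (?S * ln 2 + 2 * ln (real T))"
    define \<kappa> where "\<kappa> = ?S * ?A * (1 + ln (real T)) / sqrt (?A * ?e * real T)"
    \<comment> \<open>Strict positivity, for any \<open>L\<close>, keeps the denominator of
      \<open>\<kappa>\<close> away from zero.\<close>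
    have e: "0 < ?e" using H S by (simp add: eps_def add_pos_pos)
    have l: "0 \<le> ln (real T)" using T by simp
    have \<kappa>: "0 < \<kappa>"
      unfolding \<kappa>_def using S A T e by (intro divide_pos_pos mult_pos_pos real_sqrt_gt_zero add_pos_nonneg l) auto
    have y: "1 \<le> y"
    proof -
      \<comment> \<open>Even with one state and one episode y is at least 4/3, which secures the
        trivial bound at unvisited triples.\<close>
      have "1 * (2 / 3) \<le> ?S * ln 2" using S ln2_ge_two_thirds by (intro mult_mono) auto
      then show ?thesis using l by (simp add: y_def)
    qed
    have b: "1 / real T = real T * 2 ^ nS m * exp (- y / 2)"
    proof -
      have "exp (- y / 2) = exp (- (?S * ln 2)) * exp (- (2 * ln (real T)))"
        by (simp add: y_def exp_add[symmetric])
      also have "exp (- (?S * ln 2)) = 1 / 2 ^ nS m"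
        by (simp add: exp_minus exp_of_nat_mult field_simps)
      also have "exp (- (2 * ln (real T))) = 1 / (real T)\<^sup>2"
        using T by (simp add: exp_minus exp_double field_simps)
      finally show ?thesis using T by (simp add: power2_eq_square field_simps)
    qed
    have "bayes_regret m \<mu> \<beta> L T \<le> real T * (?H\<^sup>2 * \<kappa> * ?e + 4 * ?H / \<kappa> * (?H * ?S * ?A) * (1 / real T))
      + 2 * y * ?H / \<kappa> * (?H * ?S * ?A * (2 + ln (real T)))"
    proof (rule bayes_regret_le[OF \<kappa> y less_imp_le[OF e] T _ b])
      show "measure_pmf.prob (replicate_pmf L (traj_law m \<theta> (expert m \<beta> \<theta>)))
         {D. estimate m (real L * ?p / 2) D \<noteq> opt_act m \<theta>} \<le> ?e" if "\<theta> \<in> space \<mu>" for \<theta>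
        using prob_estimate_wrong_le_eps[OF p \<Delta>(1) _ \<Delta>(2), of \<beta> \<theta> L] \<beta>\<^sub>0(1) \<beta>\<^sub>0(2)[OF \<beta>] \<beta> that
        by (simp add: space_prior mult.assoc)
    qed
    also have "\<dots> \<le> 21 * sqrt (?e * ?H ^ 4 * ?S\<^sup>2 * ?A * real T) * (1 + ln (real T))"
      unfolding \<kappa>_def y_def using T by (intro regret_bound_arithmetic H S A e) simp
    finally show "bayes_regret m \<mu> \<beta> L T \<le> 21 * sqrt (?e * ?H ^ 4 * ?S ^ 2 * ?A * real T) * (1 + ln (real T))" .
  qed
qed

end
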